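(* Let $r\ge 2$ be an integer, and let $\mathcal{A}^*$ be an $(r-1)$-connected Poincaré DGCA of degree $n$ over $\mathbb{K}$ admitting a Hodge homotopy, with harmonic subspace $\mathcal{H}^*\subseteq\mathcal{A}^*$ and projection $\pi_{\mathcal{H}^*}:\mathcal{A}^*\to\mathcal{H}^*$. If $n\le \ell(r-1)+2$ for an integer $\ell\ge 4$, then $\mathcal{H}^*$ carries a minimal unital $C_\infty$-algebra structure $(m_k)_{k\ge 2}$ making it $C_\infty$-quasi-isomorphic to $\mathcal{A}^*$, whose multiplication $m_2$ is $m_2(\alpha,\beta)=\pi_{\mathcal{H}^*}(\alpha\cdot\beta)$, and whose multiplications $m_k$ vanish for all $k\ge \ell-1$. In particular: all the multiplications $m_k$ with $k\ge 5$ vanish if $n\le 6r-4$; all the multiplications $m_k$ with $k\ge 4$ vanish if $n\le 5r-3$; and all the multiplications $m_k$ with $k\ge 3$ vanish if $n\le 4r-2$, so that $\mathcal{A}^*$ is formal in this last case.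
   Context: $\mathbb{K}$ is a field of characteristic zero. A DGCA is a unital differential graded commutative algebra with differential $d$ of degree $+1$. A Poincaré DGCA of degree $n$ is a DGCA $(\mathcal{A}^*=\bigoplus_{k=0}^n\mathcal{A}^k,d)$ with finite-dimensional cohomology $H^*(\mathcal{A})$ and a linear functional (fundamental class) $\int: H^n(\mathcal{A})\to\mathbb{K}$ such that the pairing on $H^*(\mathcal{A})$ given on homogeneous elements by $\langle a,b\rangle=\int a\cdot b$ if $\deg a+\deg b=n$ and $0$ otherwise is non-degenerate. It induces a pairing on $\mathcal{A}^*$: $\langle\alpha,\beta\rangle=\int[\alpha\cdot\beta]$ if $\deg\alpha+\deg\beta=n$, and $0$ otherwise. A Hodge homotopy is a linear operator $d^-:\mathcal{A}^*\to\mathcal{A}^{*-1}$ with $d^-d^-=0$, $d^-dd^-=d^-$, $dd^-d=d$, $\langle \mathrm{Im}(d^-),\mathrm{Im}(d^-)\rangle=0$ and $\langle\mathrm{Im}(\pi_{\mathcal{H}^*}),\mathrm{Im}(d^-)\rangle=0$, where $\pi_{\mathcal{H}^*}:=\mathrm{id}_{\mathcal{A}^*}-(dd^-+d^-d)$ (a projection). The harmonic subspace is $\mathcal{H}^*:=\mathrm{Im}(\pi_{\mathcal{H}^*})$; it consists of closed elements and $\mathcal{H}^*\to H^*(\mathcal{A})$, $\alpha\mapsto[\alpha]$, is an isomorphism. $\mathcal{A}^*$ is $(r-1)$-connected ($r\ge2$) if $H^0(\mathcal{A})=\mathbb{K}$ and $H^k(\mathcal{A})=0$ for $1\le k\le r-1$.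 A minimal $C_\infty$-algebra structure on a graded vector space $V$ is a sequence of linear maps $m_k:V^{\otimes k}\to V$ of degree $2-k$, $k\ge2$ (with $m_1=0$), satisfying the $A_\infty$ (Stasheff) relations and vanishing on signed shuffles: for $0<i<k$, $\sum_\sigma \pm m_k(\sigma\cdot(a_1\otimes\dots\otimes a_k))=0$, summing over $(i,k-i)$-shuffles with sign the product of $\mathrm{sgn}(\sigma)$ and the Koszul sign. It is unital with unit $1$ if $m_2(1,a)=m_2(a,1)=a$ and $m_k(\dots,1,\dots)=0$ for $k\ge3$. A DGCA is a unital $C_\infty$-algebra with $m_1=d$, $m_2=\cdot$, $m_k=0$ for $k\ge3$; $C_\infty$-quasi-isomorphism is meant in this sense. $\mathcal{A}^*$ is formal if it is connected to $(H^*(\mathcal{A}),0)$ by a zig-zag of quasi-isomorphisms of DGCAs. *)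

theory Defs
  imports "HOL-Algebra.QuotRing" "HOL-Algebra.Module" "HOL-Combinatorics.Permutations"
begin

section \<open>Graded vector spaces\<close>

text \<open>
  One record serves for graded vector spaces and for graded algebras: where only a graded vector
  space is meant, the field \<open>mult\<close> is ignored.  Degrees are integers, so that operators of negative
  degree need no truncation.
\<close>

record ('k, 'a) graded_alg = "('k, 'a) module" +
  grade :: "int \<Rightarrow> 'a set"

text \<open>\<open>g\<close> is the family of homogeneous components of \<open>x\<close>.\<close>

definition homog_decomp :: "('k, 'a) graded_alg \<Rightarrow> 'a \<Rightarrow> (int \<Rightarrow> 'a) \<Rightarrow> bool" where
  "homog_decomp V x g \<longleftrightarrow>
     (\<forall>k. g k \<in> grade V k) \<and> finite {k. g k \<noteq> \<zero>\<^bsub>V\<^esub>} \<and>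
     x = (\<Oplus>\<^bsub>V\<^esub> k \<in> {k. g k \<noteq> \<zero>\<^bsub>V\<^esub>}. g k)"

definition component :: "('k, 'a) graded_alg \<Rightarrow> int \<Rightarrow> 'a \<Rightarrow> 'a" where
  "component V k x = (THE g. homog_decomp V x g) k"

locale graded_vector_space = K?: field K + module K V
  for K :: "'k ring" (structure) and V :: "('k, 'a) graded_alg" (structure) +
  assumes grade_submodule: "submodule (grade V k) K V"
    and direct_sum: "x \<in> carrier V \<Longrightarrow> \<exists>!g. homog_decomp V x g"

definition linear_map ::
    "'k ring \<Rightarrow> ('k, 'a) graded_alg \<Rightarrow> ('k, 'b) graded_alg \<Rightarrow> ('a \<Rightarrow> 'b) \<Rightarrow> bool" where
  "linear_map K V W f \<longleftrightarrow>
     f \<in> carrier V \<rightarrow> carrier W \<and>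
     (\<forall>x\<in>carrier V. \<forall>y\<in>carrier V. f (x \<oplus>\<^bsub>V\<^esub> y) = f x \<oplus>\<^bsub>W\<^esub> f y) \<and>
     (\<forall>c\<in>carrier K. \<forall>x\<in>carrier V. f (c \<odot>\<^bsub>V\<^esub> x) = c \<odot>\<^bsub>W\<^esub> f x)"

definition finite_dimensional :: "'k ring \<Rightarrow> ('k, 'a) graded_alg \<Rightarrow> bool" where
  "finite_dimensional K V \<longleftrightarrow>
     (\<exists>B. finite B \<and> B \<subseteq> carrier V \<and>
        (\<forall>x\<in>carrier V. \<exists>c \<in> B \<rightarrow> carrier K. x = (\<Oplus>\<^bsub>V\<^esub> b \<in> B. c b \<odot>\<^bsub>V\<^esub> b)))"

text \<open>The sign \<open>(-1)\<^sup>e\<close>; it acts on an additive group by the library's integer multiples.\<close>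

definition par :: "int \<Rightarrow> int" where
  "par e = (if even e then 1 else -1)"


section \<open>Cohomology\<close>

definition cocycles :: "('k, 'a) graded_alg \<Rightarrow> ('a \<Rightarrow> 'a) \<Rightarrow> 'a set" where
  "cocycles V d = {x \<in> carrier V. d x = \<zero>\<^bsub>V\<^esub>}"

definition coboundaries :: "('k, 'a) graded_alg \<Rightarrow> ('a \<Rightarrow> 'a) \<Rightarrow> 'a set" where
  "coboundaries V d = d ` carrier V"

definition coh_class :: "('k, 'a) graded_alg \<Rightarrow> ('a \<Rightarrow> 'a) \<Rightarrow> 'a \<Rightarrow> 'a set" where
  "coh_class V d x = coboundaries V d +>\<^bsub>V\<^esub> x"

text \<open>
  The quotient of the cocycles by the coboundaries.  If \<open>(V, d)\<close> is merely a complex, then \<open>mult\<close>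
  and \<open>one\<close> below have no meaning.
\<close>

definition cohomology :: "('k, 'a) graded_alg \<Rightarrow> ('a \<Rightarrow> 'a) \<Rightarrow> ('k, 'a set) graded_alg" where
  "cohomology V d =
     (let Q = (V\<lparr>carrier := cocycles V d\<rparr>) Quot (coboundaries V d) in
      \<lparr>carrier = carrier Q, monoid.mult = monoid.mult Q, one = one Q, zero = zero Q, add = add Q,
       smult = (\<lambda>c X. \<Union>x\<in>X. coh_class V d (c \<odot>\<^bsub>V\<^esub> x)),
       grade = (\<lambda>k. coh_class V d ` (cocycles V d \<inter> grade V k))\<rparr>)"

definition coh_map ::
    "('k, 'b) graded_alg \<Rightarrow> ('b \<Rightarrow> 'b) \<Rightarrow> ('a \<Rightarrow> 'b) \<Rightarrow> 'a set \<Rightarrow> 'b set" where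
  "coh_map W e f X = (\<Union>x\<in>X. coh_class W e (f x))"

definition iso_on_cohomology ::
    "('k, 'a) graded_alg \<Rightarrow> ('a \<Rightarrow> 'a) \<Rightarrow> ('k, 'b) graded_alg \<Rightarrow> ('b \<Rightarrow> 'b) \<Rightarrow>
     ('a \<Rightarrow> 'b) \<Rightarrow> bool" where
  "iso_on_cohomology V d W e f \<longleftrightarrow>
     bij_betw (coh_map W e f) (carrier (cohomology V d)) (carrier (cohomology W e))"


section \<open>Differential graded commutative algebras\<close>

locale dgca = graded_vector_space K A + ring A
  for K :: "'k ring" (structure) and A :: "('k, 'a) graded_alg" (structure) +
  fixes d :: "'a \<Rightarrow> 'a"
  assumes smult_mult_left:
      "\<lbrakk>c \<in> carrier K; x \<in> carrier A; y \<in> carrier A\<rbrakk> \<Longrightarrow>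
        (c \<odot>\<^bsub>A\<^esub> x) \<otimes>\<^bsub>A\<^esub> y = c \<odot>\<^bsub>A\<^esub> (x \<otimes>\<^bsub>A\<^esub> y)"
    and smult_mult_right:
      "\<lbrakk>c \<in> carrier K; x \<in> carrier A; y \<in> carrier A\<rbrakk> \<Longrightarrow>
        x \<otimes>\<^bsub>A\<^esub> (c \<odot>\<^bsub>A\<^esub> y) = c \<odot>\<^bsub>A\<^esub> (x \<otimes>\<^bsub>A\<^esub> y)"
    and one_grade: "\<one>\<^bsub>A\<^esub> \<in> grade A 0"
    and mult_grade: "\<lbrakk>x \<in> grade A i; y \<in> grade A j\<rbrakk> \<Longrightarrow> x \<otimes>\<^bsub>A\<^esub> y \<in> grade A (i + j)"
    and graded_comm:
      "\<lbrakk>x \<in> grade A i; y \<in> grade A j\<rbrakk> \<Longrightarrow> y \<otimes>\<^bsub>A\<^esub> x = [par (i * j)] \<cdot>\<^bsub>A\<^esub> (x \<otimes>\<^bsub>A\<^esub> y)"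
    and d_linear: "linear_map K A A d"
    and d_grade: "x \<in> grade A i \<Longrightarrow> d x \<in> grade A (i + 1)"
    and d_d: "x \<in> carrier A \<Longrightarrow> d (d x) = \<zero>\<^bsub>A\<^esub>"
    and leibniz:
      "\<lbrakk>x \<in> grade A i; y \<in> carrier A\<rbrakk> \<Longrightarrow>
        d (x \<otimes>\<^bsub>A\<^esub> y) = (d x \<otimes>\<^bsub>A\<^esub> y) \<oplus>\<^bsub>A\<^esub> [par i] \<cdot>\<^bsub>A\<^esub> (x \<otimes>\<^bsub>A\<^esub> d y)"

definition dgca_quasi_iso ::
    "'k ring \<Rightarrow> ('k, 'a) graded_alg \<Rightarrow> ('a \<Rightarrow> 'a) \<Rightarrow> ('k, 'b) graded_alg \<Rightarrow> ('b \<Rightarrow> 'b) \<Rightarrow>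
     ('a \<Rightarrow> 'b) \<Rightarrow> bool" where
  "dgca_quasi_iso K A d B e f \<longleftrightarrow>
     dgca K A d \<and> dgca K B e \<and>
     f \<in> ring_hom A B \<and> linear_map K A B f \<and> (\<forall>k. f ` grade A k \<subseteq> grade B k) \<and>
     (\<forall>x\<in>carrier A. f (d x) = e (f x)) \<and>
     iso_on_cohomology A d B e f"

definition dgca_zigzag_step ::
    "'k ring \<Rightarrow> ('k, 'a) graded_alg \<times> ('a \<Rightarrow> 'a) \<Rightarrow> ('k, 'b) graded_alg \<times> ('b \<Rightarrow> 'b) \<Rightarrow> bool" where
  "dgca_zigzag_step K = (\<lambda>(A, d) (B, e).
     (\<exists>f. dgca_quasi_iso K A d B e f) \<or> (\<exists>g. dgca_quasi_iso K B e A d g))"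

text \<open>
  A formula cannot quantify over types, so the intermediate algebras of a zig-zag must have their
  carriers in one fixed type; \<^typ>\<open>'a list \<Rightarrow> 'k\<close> is always large enough.  A zig-zag through
  arbitrary DGCAs may be replaced by one through a cofibrant resolution of \<open>A\<close>, a free graded
  commutative algebra that can be chosen with no more elements than \<open>A\<close> itself (unless \<open>A = 0\<close>), as
  \<open>A\<close> is infinite in characteristic zero.
\<close>

definition formal :: "'k ring \<Rightarrow> ('k, 'a) graded_alg \<Rightarrow> ('a \<Rightarrow> 'a) \<Rightarrow> bool" where
  "formal K A d \<longleftrightarrow>
     (\<exists>X Y :: ('k, 'a list \<Rightarrow> 'k) graded_alg \<times> (('a list \<Rightarrow> 'k) \<Rightarrow> ('a list \<Rightarrow> 'k)).
        dgca_zigzag_step K (A, d) X \<and>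
        (dgca_zigzag_step K)\<^sup>*\<^sup>* X Y \<and>
        dgca_zigzag_step K Y (cohomology A d, \<lambda>_. \<zero>\<^bsub>cohomology A d\<^esub>))"


section \<open>Poincare DGCAs and Hodge homotopies\<close>

text \<open>
  The pairing is given on homogeneous elements by the integral of the product if the degrees add up
  to \<open>n\<close>, and by \<open>0\<close> otherwise.  Its bilinear extension integrates the component of degree \<open>n\<close> of
  the product.
\<close>

definition coh_pairing ::
    "('k, 'a) graded_alg \<Rightarrow> ('a \<Rightarrow> 'a) \<Rightarrow> nat \<Rightarrow> ('a set \<Rightarrow> 'k) \<Rightarrow> 'a set \<Rightarrow> 'a set \<Rightarrow> 'k" where
  "coh_pairing A d n I X Y =
     I (component (cohomology A d) (int n) (X \<otimes>\<^bsub>cohomology A d\<^esub> Y))"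

definition pairing ::
    "('k, 'a) graded_alg \<Rightarrow> ('a \<Rightarrow> 'a) \<Rightarrow> nat \<Rightarrow> ('a set \<Rightarrow> 'k) \<Rightarrow> 'a \<Rightarrow> 'a \<Rightarrow> 'k" where
  "pairing A d n I x y = I (coh_class A d (component A (int n) (x \<otimes>\<^bsub>A\<^esub> y)))"

locale poincare_dgca = dgca K A d
  for K :: "'k ring" (structure) and A :: "('k, 'a) graded_alg" (structure) and d +
  fixes n :: nat and I :: "'a set \<Rightarrow> 'k"
  assumes grade_bounds: "k < 0 \<or> int n < k \<Longrightarrow> grade A k = {\<zero>\<^bsub>A\<^esub>}"
    and finite_dim: "finite_dimensional K (cohomology A d)"
    and I_closed: "X \<in> grade (cohomology A d) (int n) \<Longrightarrow> I X \<in> carrier K"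
    and I_add:
      "\<lbrakk>X \<in> grade (cohomology A d) (int n); Y \<in> grade (cohomology A d) (int n)\<rbrakk> \<Longrightarrow>
        I (X \<oplus>\<^bsub>cohomology A d\<^esub> Y) = I X \<oplus>\<^bsub>K\<^esub> I Y"
    and I_smult:
      "\<lbrakk>c \<in> carrier K; X \<in> grade (cohomology A d) (int n)\<rbrakk> \<Longrightarrow>
        I (c \<odot>\<^bsub>cohomology A d\<^esub> X) = c \<otimes>\<^bsub>K\<^esub> I X"
    and nondegenerate_left:
      "\<lbrakk>X \<in> carrier (cohomology A d);
        \<And>Y. Y \<in> carrier (cohomology A d) \<Longrightarrow> coh_pairing A d n I X Y = \<zero>\<^bsub>K\<^esub>\<rbrakk> \<Longrightarrow>
        X = \<zero>\<^bsub>cohomology A d\<^esub>"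
    and nondegenerate_right:
      "\<lbrakk>Y \<in> carrier (cohomology A d);
        \<And>X. X \<in> carrier (cohomology A d) \<Longrightarrow> coh_pairing A d n I X Y = \<zero>\<^bsub>K\<^esub>\<rbrakk> \<Longrightarrow>
        Y = \<zero>\<^bsub>cohomology A d\<^esub>"

text \<open>
  \<open>(r-1)\<close>-connectedness; \<open>H\<^sup>0 = K\<close> means that the unit map from \<open>K\<close> to \<open>H\<^sup>0\<close> is bijective.
\<close>

definition connected_dgca ::
    "'k ring \<Rightarrow> ('k, 'a) graded_alg \<Rightarrow> ('a \<Rightarrow> 'a) \<Rightarrow> nat \<Rightarrow> bool" where
  "connected_dgca K A d r \<longleftrightarrow>
     bij_betw (\<lambda>c. c \<odot>\<^bsub>cohomology A d\<^esub> \<one>\<^bsub>cohomology A d\<^esub>)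
       (carrier K) (grade (cohomology A d) 0) \<and>
     (\<forall>k. 1 \<le> k \<and> k \<le> int r - 1 \<longrightarrow> grade (cohomology A d) k = {\<zero>\<^bsub>cohomology A d\<^esub>})"

definition harmonic_proj ::
    "('k, 'a) graded_alg \<Rightarrow> ('a \<Rightarrow> 'a) \<Rightarrow> ('a \<Rightarrow> 'a) \<Rightarrow> 'a \<Rightarrow> 'a" where
  "harmonic_proj A d h x = x \<ominus>\<^bsub>A\<^esub> (d (h x) \<oplus>\<^bsub>A\<^esub> h (d x))"

definition hodge_homotopy ::
    "'k ring \<Rightarrow> ('k, 'a) graded_alg \<Rightarrow> ('a \<Rightarrow> 'a) \<Rightarrow> nat \<Rightarrow> ('a set \<Rightarrow> 'k) \<Rightarrow> ('a \<Rightarrow> 'a) \<Rightarrow> bool"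
  where
  "hodge_homotopy K A d n I h \<longleftrightarrow>
     linear_map K A A h \<and> (\<forall>k. h ` grade A k \<subseteq> grade A (k - 1)) \<and>
     (\<forall>x\<in>carrier A. h (h x) = \<zero>\<^bsub>A\<^esub>) \<and>
     (\<forall>x\<in>carrier A. h (d (h x)) = h x) \<and>
     (\<forall>x\<in>carrier A. d (h (d x)) = d x) \<and>
     (\<forall>x \<in> h ` carrier A. \<forall>y \<in> h ` carrier A. pairing A d n I x y = \<zero>\<^bsub>K\<^esub>) \<and>
     (\<forall>x \<in> harmonic_proj A d h ` carrier A. \<forall>y \<in> h ` carrier A. pairing A d n I x y = \<zero>\<^bsub>K\<^esub>)"

text \<open>
  The harmonic subspace as a graded vector space, with the unit of \<open>A\<close>.  The field \<open>mult\<close> is left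
  over from \<open>A\<close> and is not an operation on the subspace.
\<close>

definition harmonic_space ::
    "('k, 'a) graded_alg \<Rightarrow> ('a \<Rightarrow> 'a) \<Rightarrow> ('a \<Rightarrow> 'a) \<Rightarrow> ('k, 'a) graded_alg" where
  "harmonic_space A d h =
     A\<lparr>carrier := harmonic_proj A d h ` carrier A,
       grade := (\<lambda>k. harmonic_proj A d h ` grade A k)\<rparr>"


section \<open>C-infinity algebras\<close>

text \<open>
  A sequence of linear maps \<open>m\<^sub>k : V\<^sup>\<otimes>\<^sup>k \<rightarrow> W\<close>, \<open>k \<ge> 1\<close>, is encoded as one function \<open>m\<close> on
  nonempty lists: \<open>m\<^sub>k\<close> is its restriction to lists of length \<open>k\<close>, where it is multilinear.
\<close>

definition multilinear_maps ::
    "'k ring \<Rightarrow> ('k, 'a) graded_alg \<Rightarrow> ('k, 'b) graded_alg \<Rightarrow> ('a list \<Rightarrow> 'b) \<Rightarrow> bool" where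
  "multilinear_maps K V W m \<longleftrightarrow>
     (\<forall>us \<in> lists (carrier V). \<forall>vs \<in> lists (carrier V). linear_map K V W (\<lambda>x. m (us @ [x] @ vs)))"

text \<open>
  Lists of homogeneous elements carry the degrees along, as pairs of a degree and an element (the
  degree of \<open>0\<close> is not determined by the element).
\<close>

definition homog_list :: "('k, 'a) graded_alg \<Rightarrow> (int \<times> 'a) list \<Rightarrow> bool" where
  "homog_list V ps \<longleftrightarrow> (\<forall>(e, x) \<in> set ps. x \<in> grade V e)"

abbreviation elts :: "(int \<times> 'a) list \<Rightarrow> 'a list" where
  "elts ps \<equiv> map snd ps"

definition tdeg :: "(int \<times> 'a) list \<Rightarrow> int" where
  "tdeg ps = sum_list (map fst ps)"

text \<open>For every \<open>k\<close>, the \<open>k\<close>-ary map has degree \<open>c - k\<close>.\<close>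

definition has_degrees ::
    "('k, 'a) graded_alg \<Rightarrow> ('k, 'b) graded_alg \<Rightarrow> int \<Rightarrow> ('a list \<Rightarrow> 'b) \<Rightarrow> bool" where
  "has_degrees V W c m \<longleftrightarrow>
     (\<forall>ps. ps \<noteq> [] \<and> homog_list V ps \<longrightarrow> m (elts ps) \<in> grade W (tdeg ps + c - int (length ps)))"

text \<open>
  The sum \<open>\<Sum> (-1)\<^sup>r\<^sup>+\<^sup>s\<^sup>t f\<^sub>r\<^sub>+\<^sub>1\<^sub>+\<^sub>t (id\<^sup>\<otimes>\<^sup>r \<otimes> m\<^sub>s \<otimes> id\<^sup>\<otimes>\<^sup>t)\<close> over all \<open>r + s + t = k\<close> with \<open>s \<ge> 1\<close>, applied to
  \<open>k\<close> homogeneous elements; the last summand of the exponent is the Koszul sign of moving \<open>m\<^sub>s\<close>, of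
  degree \<open>2 - s\<close>, past the first \<open>r\<close> arguments.
\<close>

definition insertion_sum ::
    "('k, 'b) graded_alg \<Rightarrow> ('a list \<Rightarrow> 'b) \<Rightarrow> ('a list \<Rightarrow> 'a) \<Rightarrow> (int \<times> 'a) list \<Rightarrow> 'b" where
  "insertion_sum W f m ps =
     finsum W
       (\<lambda>(us, vs, ws).
          [par (int (length us) + int (length vs) * int (length ws)
                + (2 - int (length vs)) * tdeg us)] \<cdot>\<^bsub>W\<^esub>
          f (elts us @ [m (elts vs)] @ elts ws))
       {(us, vs, ws). us @ vs @ ws = ps \<and> vs \<noteq> []}"

definition stasheff :: "('k, 'a) graded_alg \<Rightarrow> ('a list \<Rightarrow> 'a) \<Rightarrow> bool" where
  "stasheff V m \<longleftrightarrow>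
     (\<forall>ps. ps \<noteq> [] \<and> homog_list V ps \<longrightarrow> insertion_sum V m m ps = \<zero>\<^bsub>V\<^esub>)"

text \<open>
  An \<open>(i, k-i)\<close>-shuffle \<open>\<sigma>\<close> moves the \<open>j\<close>-th tensor factor to position \<open>\<sigma> j\<close>, that is, it preserves
  the order among the first \<open>i\<close> factors and among the last \<open>k-i\<close> factors.
\<close>

definition shuffle_perms :: "nat \<Rightarrow> nat \<Rightarrow> (nat \<Rightarrow> nat) set" where
  "shuffle_perms i k =
     {\<sigma>. \<sigma> permutes {..<k} \<and> strict_mono_on {..<i} \<sigma> \<and> strict_mono_on {i..<k} \<sigma>}"

definition koszul_sign :: "(nat \<Rightarrow> nat) \<Rightarrow> int list \<Rightarrow> int" where
  "koszul_sign \<sigma> es =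
     (\<Prod>(a, b) \<in> {(a, b). a < b \<and> b < length es \<and> \<sigma> b < \<sigma> a}. par (es ! a * es ! b))"

definition vanishes_on_shuffles ::
    "('k, 'a) graded_alg \<Rightarrow> ('k, 'b) graded_alg \<Rightarrow> ('a list \<Rightarrow> 'b) \<Rightarrow> bool" where
  "vanishes_on_shuffles V W m \<longleftrightarrow>
     (\<forall>ps i. homog_list V ps \<and> 0 < i \<and> i < length ps \<longrightarrow>
        (\<Oplus>\<^bsub>W\<^esub> \<sigma> \<in> shuffle_perms i (length ps).
           [(sign \<sigma> * koszul_sign \<sigma> (map fst ps))] \<cdot>\<^bsub>W\<^esub>
           m (permute_list (inv_into UNIV \<sigma>) (elts ps))) = \<zero>\<^bsub>W\<^esub>)"

locale unital_cinf_algebra = graded_vector_space K V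
  for K :: "'k ring" (structure) and V :: "('k, 'a) graded_alg" (structure) +
  fixes m :: "'a list \<Rightarrow> 'a"
  assumes multilinear: "multilinear_maps K V V m"
    and degrees: "has_degrees V V 2 m"
    and stasheff: "stasheff V m"
    and shuffles: "vanishes_on_shuffles V V m"
    and unit_grade: "\<one>\<^bsub>V\<^esub> \<in> grade V 0"
    and unit_2:
      "x \<in> carrier V \<Longrightarrow> m [\<one>\<^bsub>V\<^esub>, x] = x"
      "x \<in> carrier V \<Longrightarrow> m [x, \<one>\<^bsub>V\<^esub>] = x"
    and unit_higher:
      "\<lbrakk>xs \<in> lists (carrier V); \<one>\<^bsub>V\<^esub> \<in> set xs; 3 \<le> length xs\<rbrakk> \<Longrightarrow> m xs = \<zero>\<^bsub>V\<^esub>"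

locale minimal_unital_cinf_algebra = unital_cinf_algebra +
  assumes m_1: "x \<in> carrier V \<Longrightarrow> m [x] = \<zero>\<^bsub>V\<^esub>"

text \<open>
  The right hand side of the morphism relations, the sum over all \<open>i\<^sub>1 + \<dots> + i\<^sub>q = k\<close> of
  \<open>\<plusminus> p\<^sub>q (f\<^bsub>i\<^sub>1\<^esub> \<otimes> \<dots> \<otimes> f\<^bsub>i\<^sub>q\<^esub>)\<close>: the first sum in the exponent is the usual sign
  \<open>(q-1)(i\<^sub>1-1) + (q-2)(i\<^sub>2-1) + \<dots> + (i\<^bsub>q-1\<^esub>-1)\<close>, the second one is the Koszul sign of moving the
  maps \<open>f\<^sub>i\<close>, of degree \<open>1 - i\<close>, past the preceding arguments.
\<close>

definition composition_sum ::
    "('k, 'b) graded_alg \<Rightarrow> ('b list \<Rightarrow> 'b) \<Rightarrow> ('a list \<Rightarrow> 'b) \<Rightarrow> (int \<times> 'a) list \<Rightarrow> 'b" where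
  "composition_sum W p f ps =
     (\<Oplus>\<^bsub>W\<^esub> pss \<in> {pss. concat pss = ps \<and> [] \<notin> set pss}.
        [par ((\<Sum>j<length pss. (int (length pss) - 1 - int j) * (int (length (pss ! j)) - 1))
              + (\<Sum>j<length pss. (1 - int (length (pss ! j))) * tdeg (concat (take j pss))))] \<cdot>\<^bsub>W\<^esub>
        p (map (\<lambda>qs. f (elts qs)) pss))"

locale unital_cinf_morphism =
    V: unital_cinf_algebra K V m + W: unital_cinf_algebra K W p
  for K :: "'k ring" and V :: "('k, 'a) graded_alg" and m
    and W :: "('k, 'b) graded_alg" and p +
  fixes f :: "'a list \<Rightarrow> 'b"
  assumes multilinear: "multilinear_maps K V W f"
    and degrees: "has_degrees V W 1 f"
    and morphism:
      "\<lbrakk>ps \<noteq> []; homog_list V ps\<rbrakk> \<Longrightarrow> insertion_sum W f m ps = composition_sum W p f ps"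
    and shuffles: "vanishes_on_shuffles V W f"
    and unit_1: "f [\<one>\<^bsub>V\<^esub>] = \<one>\<^bsub>W\<^esub>"
    and unit_higher:
      "\<lbrakk>xs \<in> lists (carrier V); \<one>\<^bsub>V\<^esub> \<in> set xs; 2 \<le> length xs\<rbrakk> \<Longrightarrow> f xs = \<zero>\<^bsub>W\<^esub>"

text \<open>
  One direction suffices: C-infinity quasi-isomorphisms over a field are invertible up to homotopy.
\<close>

definition cinf_quasi_isomorphic ::
    "'k ring \<Rightarrow> ('k, 'a) graded_alg \<Rightarrow> ('a list \<Rightarrow> 'a) \<Rightarrow>
     ('k, 'b) graded_alg \<Rightarrow> ('b list \<Rightarrow> 'b) \<Rightarrow> bool" where
  "cinf_quasi_isomorphic K V m W p \<longleftrightarrow>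
     (\<exists>f. unital_cinf_morphism K V m W p f \<and>
        iso_on_cohomology V (\<lambda>x. m [x]) W (\<lambda>y. p [y]) (\<lambda>x. f [x]))"

fun dgca_ops :: "('k, 'a) graded_alg \<Rightarrow> ('a \<Rightarrow> 'a) \<Rightarrow> 'a list \<Rightarrow> 'a" where
  "dgca_ops A d [x] = d x"
| "dgca_ops A d [x, y] = x \<otimes>\<^bsub>A\<^esub> y"
| "dgca_ops A d _ = \<zero>\<^bsub>A\<^esub>"

end

(* Homotopy transfer along the Hodge homotopy h yields f_k = -h p_k and m_k = pi p_k, where p_k is
   the signed sum of the products f_i f_j over i + j = k.  The morphism and Stasheff relations follow
   by induction on the arity, and p_k vanishes on shuffles because on the shuffle product of two
   words it reduces to a graded commutator.

   A unit among the arguments kills m_k for k >= 3, so only arguments of degree >= r matter; then the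
   value has degree >= k(r-1)+2 and pairs with harmonic elements of degree <= n-k(r-1)-2.  If this
   bound is less than r, only degree 0 is left, where the pairing is the integral of p_k.  It vanishes
   since for k >= 3 every product f_i f_j has a factor in the image of h, which is orthogonal to
   itself and to the harmonic elements.  By Poincare duality m_k = 0.

   If n <= 4r-2, let S be the sub-DGCA of A that is harmonic in degrees < 2r-1, the kernel of h in
   degree 2r-1 and everything in higher degrees.  For degree reasons h S is orthogonal to S, so
   the harmonic projection S -> H(A) is multiplicative and A <- S -> H(A) proves formality. *)

theory Submission
  imports Defs
begin

text \<open>Signs are the main obstacle. The recursion is carried out on suspended arguments, where
  every sign is an instance of one linear map, the grading involution \<open>eps\<close>. The
  relations then hold for arbitrary harmonic arguments, and a term-by-term comparison of exponents
  returns to the stated conventions. For shuffles, the sum over permutations becomes a recursive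
  signed shuffle product. Deconcatenation is multiplicative for it, so all mixed terms vanish by
  induction and only the commutator is left. The constants come from one count: if n <= (k + 1)(r -
  1) + 2, then a partner of m_k under the pairing has degree at most n - k(r - 1) - 2 <= r - 1; k =
  l - 1 gives the stated bound. The vanishing of the m_k concerns C-infinity structures, whereas
  \<open>formal\<close> asks for a zig-zag of DGCAs, so a strict intermediate algebra is built. Its
  threshold 2r - 1 is chosen because products of two elements of degree at least r have degree at
  least 2r, where no condition is imposed. Since \<open>formal\<close> fixes the type of
  intermediate carriers, this algebra is finally copied into that type.\<close>

section \<open>Finite sums\<close>

text \<open>The fold relation evaluates the summand only on members of the index set, so values
  outside the carrier do no harm. Free of carrier conditions, the rule can act as a congruence for
  recursive definitions: it tells the termination proof of \<open>\<Phi>\<close> that the recursive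
  calls range over \<open>splits\<close>.\<close>

lemma finsum_cong_on [fundef_cong]:
  assumes "S = T" "\<And>i. i \<in> T \<Longrightarrow> f i = g i"
  shows "finsum G f S = finsum G g T"
proof -
  have *: "(S, y) \<in> foldSetD D (monoid.mult H \<circ> f) e \<Longrightarrow> (\<And>i. i \<in> S \<Longrightarrow> f i = g i) \<Longrightarrow>
      (S, y) \<in> foldSetD D (monoid.mult H \<circ> g) e" for D H e S y f g
  proof (induction S y rule: foldSetD.induct)
    case emptyI then show ?case by (auto intro: foldSetD.emptyI)
  next
    case (insertI x S y)
    then have "(insert x S, (monoid.mult H \<circ> g) x y) \<in> foldSetD D (monoid.mult H \<circ> g) e"
      by (intro foldSetD.insertI) auto
    then show ?case using insertI by (auto simp: comp_def)
  qed
  have "(S, y) \<in> foldSetD D (monoid.mult H \<circ> f) e \<longleftrightarrow> (S, y) \<in> foldSetD D (monoid.mult H \<circ> g) e" for D H e y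
    using *[of S y D H f e g] *[of S y D H g e f] assms by auto
  note eq = this
  show ?thesis
    unfolding finsum_def finprod_def foldD_def eq using assms(1) by simp
qed

context abelian_monoid
begin

lemma finsum_bij:
  assumes "bij_betw p S T" "g \<in> T \<rightarrow> carrier G"
  shows "finsum G g T = (\<Oplus>i\<in>S. g (p i))"
  using assms finsum_reindex[of g p S] by (auto simp: bij_betw_def)

lemma finsum_witness:
  assumes "\<And>b. b \<in> T \<Longrightarrow> i (j b) = b" "\<And>b. b \<in> T \<Longrightarrow> j b \<in> S"
    "\<And>a. a \<in> S \<Longrightarrow> j (i a) = a" "\<And>a. a \<in> S \<Longrightarrow> i a \<in> T"
    "\<And>a. a \<in> S \<Longrightarrow> g (i a) = f a" "\<And>b. b \<in> T \<Longrightarrow> g b \<in> carrier G"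
  shows "finsum G f S = finsum G g T"
proof -
  have "bij_betw i S T"
    by (rule bij_betw_byWitness[where f' = j]) (use assms in auto)
  then have "finsum G g T = (\<Oplus>a\<in>S. g (i a))"
    by (rule finsum_bij) (use assms in auto)
  then show ?thesis using assms(5) by (simp cong: finsum_cong_on)
qed

lemma finsum_Sigma:
  assumes "finite S" "\<And>s. s \<in> S \<Longrightarrow> finite (T s)"
    "\<And>s t. s \<in> S \<Longrightarrow> t \<in> T s \<Longrightarrow> g s t \<in> carrier G"
  shows "(\<Oplus>s\<in>S. \<Oplus>t\<in>T s. g s t) = finsum G (\<lambda>(s,t). g s t) (Sigma S T)"
  using assms
proof (induction S rule: finite_induct)
  case empty then show ?case by simp
next
  case (insert s S)
  have eq: "Sigma (insert s S) T = Pair s ` T s \<union> Sigma S T" by auto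
  have "finsum G (\<lambda>(s,t). g s t) (Sigma (insert s S) T) =
     finsum G (\<lambda>(s,t). g s t) (Pair s ` T s) \<oplus> finsum G (\<lambda>(s,t). g s t) (Sigma S T)"
    unfolding eq using insert by (intro finsum_Un_disjoint) auto
  also have "finsum G (\<lambda>(s,t). g s t) (Pair s ` T s) = (\<Oplus>t\<in>T s. g s t)"
    using insert by (subst finsum_reindex) (auto simp: inj_on_def)
  also have "finsum G (\<lambda>(s,t). g s t) (Sigma S T) = (\<Oplus>s\<in>S. \<Oplus>t\<in>T s. g s t)"
    using insert by simp
  finally show ?case using insert by (subst finsum_insert) (auto intro!: finsum_closed)
qed

lemma finsum_all_zero: "(\<And>i. i \<in> S \<Longrightarrow> f i = \<zero>) \<Longrightarrow> finsum G f S = \<zero>"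
  by (simp cong: finsum_cong_on)

lemma finsum_mono_neutral:
  assumes "finite T" "S \<subseteq> T" "\<And>i. i \<in> T - S \<Longrightarrow> f i = \<zero>" "\<And>i. i \<in> S \<Longrightarrow> f i \<in> carrier G"
  shows "finsum G f T = finsum G f S"
proof -
  have "f i \<in> carrier G" if "i \<in> T" for i using that assms(3,4)[of i] by (cases "i \<in> S") auto
  then show ?thesis using assms by (intro add.finprod_mono_neutral_cong_right) auto
qed

lemma finsum_additive_hom:
  assumes "abelian_monoid H" "\<And>i. i \<in> S \<Longrightarrow> g i \<in> carrier G" "f \<in> carrier G \<rightarrow> carrier H"
    "\<And>x y. x \<in> carrier G \<Longrightarrow> y \<in> carrier G \<Longrightarrow> f (x \<oplus> y) = f x \<oplus>\<^bsub>H\<^esub> f y" "f \<zero> = \<zero>\<^bsub>H\<^esub>"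
  shows "f (finsum G g S) = finsum H (\<lambda>i. f (g i)) S"
proof -
  interpret H: abelian_monoid H by fact
  show ?thesis
  proof (cases "finite S")
    case True
    then show ?thesis using assms(2)
    proof (induction S rule: finite_induct)
      case empty then show ?case using assms by simp
    next
      case (insert s S)
      have "f (finsum G g (insert s S)) = f (g s \<oplus> finsum G g S)"
        using insert by (subst finsum_insert) auto
      also have "\<dots> = f (g s) \<oplus>\<^bsub>H\<^esub> finsum H (\<lambda>i. f (g i)) S"
        using insert assms by (subst assms(4)) (auto intro!: finsum_closed)
      finally show ?case using insert assms(3) by (subst H.finsum_insert) auto
    qed
  next
    \<comment> \<open>Sums over infinite index sets default to zero, so this case is the hypothesis
      that \<open>f\<close> preserves zero.\<close>
    case False then show ?thesis using assms by (simp add: H.finsum_infinite finsum_infinite)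
  qed
qed

end

lemma (in abelian_group) finsum_minus:
  assumes "\<And>i. i \<in> S \<Longrightarrow> f i \<in> carrier G"
  shows "\<ominus> (finsum G f S) = (\<Oplus>i\<in>S. \<ominus> f i)"
  by (rule finsum_additive_hom) (use assms in \<open>auto simp: minus_add abelian_monoid_axioms\<close>)

section \<open>Signs acting by integer multiples, and additive maps\<close>

lemma par_add: "par (a + b) = par a * par b"
  by (auto simp: par_def)

lemma par_0 [simp]: "par 0 = 1" and par_1 [simp]: "par 1 = -1"
  by (auto simp: par_def)

lemma par_eqI: "even (a - b) \<Longrightarrow> par a = par b"
  by (auto simp: par_def)

context abelian_group
begin

lemma int_pow_pm1: "x \<in> carrier G \<Longrightarrow> [(1::int)] \<cdot> x = x" "x \<in> carrier G \<Longrightarrow> [(-1::int)] \<cdot> x = \<ominus> x"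
  using group.int_pow_1[OF a_group, of x] group.int_pow_neg[OF a_group, of x 1]
  by (simp_all add: add_pow_def a_inv_def)

lemma par_pow: "x \<in> carrier G \<Longrightarrow> [par e] \<cdot> x = (if even e then x else \<ominus> x)"
  by (simp add: par_def int_pow_pm1)

lemma par_pow_closed [simp]: "x \<in> carrier G \<Longrightarrow> [par e] \<cdot> x \<in> carrier G"
  by (simp add: par_pow)

lemma par_pow_add [simp]: "x \<in> carrier G \<Longrightarrow> y \<in> carrier G \<Longrightarrow> [par e] \<cdot> (x \<oplus> y) = [par e] \<cdot> x \<oplus> [par e] \<cdot> y"
  by (simp add: par_pow minus_add a_comm)

lemma par_pow_par_pow: "x \<in> carrier G \<Longrightarrow> [par e] \<cdot> ([par f] \<cdot> x) = [par (e + f)] \<cdot> x"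
  by (auto simp add: par_pow)

lemma par_pow_minus: "x \<in> carrier G \<Longrightarrow> [par e] \<cdot> (\<ominus> x) = \<ominus> ([par e] \<cdot> x)"
  by (simp add: par_pow)

lemma par_pow_finsum:
  "(\<And>i. i \<in> S \<Longrightarrow> f i \<in> carrier G) \<Longrightarrow> [par e] \<cdot> (finsum G f S) = (\<Oplus>i\<in>S. [par e] \<cdot> f i)"
  by (rule finsum_additive_hom) (auto simp: abelian_monoid_axioms)

end

lemma linear_mapD:
  assumes "linear_map K V W f"
  shows "x \<in> carrier V \<Longrightarrow> f x \<in> carrier W"
    "x \<in> carrier V \<Longrightarrow> y \<in> carrier V \<Longrightarrow> f (x \<oplus>\<^bsub>V\<^esub> y) = f x \<oplus>\<^bsub>W\<^esub> f y"
    "c \<in> carrier K \<Longrightarrow> x \<in> carrier V \<Longrightarrow> f (c \<odot>\<^bsub>V\<^esub> x) = c \<odot>\<^bsub>W\<^esub> f x"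
  using assms unfolding linear_map_def by auto

lemma additive_map_zero_minus:
  assumes "abelian_group V" "abelian_group W" "f \<in> carrier V \<rightarrow> carrier W"
    "\<And>x y. x \<in> carrier V \<Longrightarrow> y \<in> carrier V \<Longrightarrow> f (x \<oplus>\<^bsub>V\<^esub> y) = f x \<oplus>\<^bsub>W\<^esub> f y"
  shows "f \<zero>\<^bsub>V\<^esub> = \<zero>\<^bsub>W\<^esub>" "x \<in> carrier V \<Longrightarrow> f (\<ominus>\<^bsub>V\<^esub> x) = \<ominus>\<^bsub>W\<^esub> f x"
proof -
  interpret V: abelian_group V by fact
  interpret W: abelian_group W by fact
  have "f \<zero>\<^bsub>V\<^esub> \<oplus>\<^bsub>W\<^esub> f \<zero>\<^bsub>V\<^esub> = f \<zero>\<^bsub>V\<^esub>" using assms(4)[of "\<zero>\<^bsub>V\<^esub>" "\<zero>\<^bsub>V\<^esub>"] by simp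
  moreover have c: "f \<zero>\<^bsub>V\<^esub> \<in> carrier W" using assms(3) by auto
  ultimately show z: "f \<zero>\<^bsub>V\<^esub> = \<zero>\<^bsub>W\<^esub>" by (metis W.add.l_cancel_one')
  show "f (\<ominus>\<^bsub>V\<^esub> x) = \<ominus>\<^bsub>W\<^esub> f x" if "x \<in> carrier V"
  proof -
    have "f (\<ominus>\<^bsub>V\<^esub> x) \<oplus>\<^bsub>W\<^esub> f x = \<zero>\<^bsub>W\<^esub>"
      using that assms(4)[of "\<ominus>\<^bsub>V\<^esub> x" x] z by (simp add: V.l_neg)
    then show ?thesis using that assms(3)
      by (intro W.minus_equality[symmetric]) auto
  qed
qed

section \<open>Graded vector spaces\<close>

text \<open>Reorders the parameters so that the space, and not the ground field, is the implicit
  structure: unindexed ring notation below refers to \<open>V\<close>.\<close>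

locale graded_space = graded_vector_space K V
  for V :: "('k, 'a) graded_alg" (structure) and K :: "'k ring"
begin

lemma grade_carrier: "x \<in> grade V k \<Longrightarrow> x \<in> carrier V"
  using grade_submodule[of k] submoduleE(1)[of "grade V k"] by blast

lemma grade_add: "x \<in> grade V k \<Longrightarrow> y \<in> grade V k \<Longrightarrow> x \<oplus> y \<in> grade V k"
  using grade_submodule[of k] submoduleE(5)[of "grade V k"] by blast

lemma grade_zero [simp]: "\<zero> \<in> grade V k"
  using grade_submodule[of k] subgroup.one_closed[of "grade V k" "add_monoid V"]
  by (simp add: submodule_def)

lemma grade_smult: "c \<in> carrier K \<Longrightarrow> x \<in> grade V k \<Longrightarrow> c \<odot> x \<in> grade V k"
  using grade_submodule[of k] submoduleE(4)[of "grade V k"] by blast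

lemma grade_minus: "x \<in> grade V k \<Longrightarrow> \<ominus> x \<in> grade V k"
  using grade_submodule[of k] subgroup.m_inv_closed[of "grade V k" "add_monoid V"]
  by (simp add: submodule_def a_inv_def)

lemma grade_par: "x \<in> grade V k \<Longrightarrow> [par e] \<cdot> x \<in> grade V k"
  by (simp add: par_pow grade_carrier grade_minus)

lemma grade_finsum: "(\<And>i. i \<in> S \<Longrightarrow> f i \<in> grade V k) \<Longrightarrow> finsum V f S \<in> grade V k"
proof (induction S rule: infinite_finite_induct)
  case (insert x S) then show ?case by (subst finsum_insert) (auto intro: grade_add grade_carrier)
qed (auto simp: finsum_infinite)

lemma minus_eq_smult: "x \<in> carrier V \<Longrightarrow> \<ominus> x = (\<ominus>\<^bsub>K\<^esub> \<one>\<^bsub>K\<^esub>) \<odot> x"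
  by (simp add: smult_l_minus)

lemma smult_par: "c \<in> carrier K \<Longrightarrow> x \<in> carrier V \<Longrightarrow> c \<odot> ([par e] \<cdot> x) = [par e] \<cdot> (c \<odot> x)"
  by (simp add: par_pow smult_r_minus)

lemma decomp_ex:
  assumes "x \<in> carrier V"
  shows "homog_decomp V x (\<lambda>k. component V k x)"
  using theI'[OF direct_sum[OF assms]] by (simp add: component_def)

lemma component_grade: "x \<in> carrier V \<Longrightarrow> component V k x \<in> grade V k"
  and finite_component: "x \<in> carrier V \<Longrightarrow> finite {k. component V k x \<noteq> \<zero>}"
  using decomp_ex[of x] by (auto simp: homog_decomp_def)

lemma component_closed [simp]: "x \<in> carrier V \<Longrightarrow> component V k x \<in> carrier V"
  using component_grade grade_carrier by blast

lemma component_sum: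
  assumes "x \<in> carrier V" "finite S" "\<And>k. k \<notin> S \<Longrightarrow> component V k x = \<zero>"
  shows "x = (\<Oplus>k\<in>S. component V k x)"
proof -
  have "x = (\<Oplus>k\<in>{k. component V k x \<noteq> \<zero>}. component V k x)"
    using decomp_ex[OF assms(1)] by (simp add: homog_decomp_def)
  also have "\<dots> = (\<Oplus>k\<in>S. component V k x)"
    by (rule finsum_mono_neutral[symmetric]) (use assms in auto)
  finally show ?thesis .
qed

text \<open>Here \<open>S\<close> is any finite set containing the support of \<open>g\<close>, so
  that exhibiting a decomposition does not require computing its exact support.\<close>

lemma component_unique:
  assumes "\<And>k. g k \<in> grade V k" "finite S" "\<And>k. k \<notin> S \<Longrightarrow> g k = \<zero>" "x = (\<Oplus>k\<in>S. g k)"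
  shows "component V k x = g k"
proof -
  have x: "x \<in> carrier V" unfolding assms(4) using assms(1) grade_carrier by (intro finsum_closed) auto
  have "x = (\<Oplus>k\<in>{k. g k \<noteq> \<zero>}. g k)"
    unfolding assms(4) using assms grade_carrier by (intro finsum_mono_neutral) auto
  moreover have "finite {k. g k \<noteq> \<zero>}" using assms(2,3) by (auto intro: finite_subset[of _ S])
  ultimately have "homog_decomp V x g" using assms(1) by (auto simp: homog_decomp_def)
  then have "(\<lambda>k. component V k x) = g" using direct_sum[OF x] decomp_ex[OF x] by blast
  then show ?thesis by metis
qed

lemma component_homog:
  assumes "x \<in> grade V k" shows "component V j x = (if j = k then x else \<zero>)"
  by (rule component_unique[where S = "{k}" and g = "\<lambda>j. if j = k then x else \<zero>"])
    (use assms grade_carrier in auto)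

lemma component_add:
  assumes x: "x \<in> carrier V" and y: "y \<in> carrier V"
  shows "component V k (x \<oplus> y) = component V k x \<oplus> component V k y"
proof (rule component_unique[where g = "\<lambda>k. component V k x \<oplus> component V k y"
      and S = "{k. component V k x \<noteq> \<zero>} \<union> {k. component V k y \<noteq> \<zero>}"])
  let ?S = "{k. component V k x \<noteq> \<zero>} \<union> {k. component V k y \<noteq> \<zero>}"
  show f: "finite ?S" using assms finite_component by auto
  have "x = (\<Oplus>k\<in>?S. component V k x)" "y = (\<Oplus>k\<in>?S. component V k y)"
    by (intro component_sum f; use assms in auto)+
  then show "x \<oplus> y = (\<Oplus>k\<in>?S. component V k x \<oplus> component V k y)"
    using assms by (subst finsum_addf) auto
qed (use assms in \<open>auto intro: grade_add component_grade\<close>)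

lemma component_smult:
  assumes c: "c \<in> carrier K" and x: "x \<in> carrier V"
  shows "component V k (c \<odot> x) = c \<odot> component V k x"
proof (rule component_unique[where g = "\<lambda>k. c \<odot> component V k x"
      and S = "{k. component V k x \<noteq> \<zero>}"])
  show f: "finite {k. component V k x \<noteq> \<zero>}" using assms finite_component by auto
  have "x = (\<Oplus>k\<in>{k. component V k x \<noteq> \<zero>}. component V k x)"
    by (intro component_sum f; use assms in auto)
  then have "c \<odot> x = c \<odot> (\<Oplus>k\<in>{k. component V k x \<noteq> \<zero>}. component V k x)" by simp
  also have "\<dots> = (\<Oplus>k\<in>{k. component V k x \<noteq> \<zero>}. c \<odot> component V k x)"
    by (rule finsum_additive_hom) (use assms in \<open>auto simp: abelian_monoid_axioms smult_r_distr\<close>)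
  finally show "c \<odot> x = (\<Oplus>k\<in>{k. component V k x \<noteq> \<zero>}. c \<odot> component V k x)" .
qed (use assms in \<open>auto intro: grade_smult component_grade\<close>)

lemma component_zero [simp]: "component V k \<zero> = \<zero>"
  by (simp add: component_homog[of _ k])

lemma grade_induct [consumes 1, case_names homog add]:
  assumes "x \<in> carrier V" and hom: "\<And>k x. x \<in> grade V k \<Longrightarrow> P x"
    and add: "\<And>x y. x \<in> carrier V \<Longrightarrow> y \<in> carrier V \<Longrightarrow> P x \<Longrightarrow> P y \<Longrightarrow> P (x \<oplus> y)"
  shows "P x"
proof -
  let ?S = "{k. component V k x \<noteq> \<zero>}"
  have "P (\<Oplus>k\<in>T. component V k x)" if "finite T" for T
    using that
  proof (induction T rule: finite_induct)
    \<comment> \<open>Zero is homogeneous (of every degree), which covers the empty sum.\<close>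
    case empty show ?case using hom[OF grade_zero] by simp
  next
    case (insert k T)
    have "P (component V k x \<oplus> (\<Oplus>k\<in>T. component V k x))"
      using insert assms(1) hom[OF component_grade] by (intro add) auto
    then show ?case using insert assms(1) by (subst finsum_insert) auto
  qed
  moreover have "x = (\<Oplus>k\<in>?S. component V k x)"
    using assms(1) finite_component by (intro component_sum) auto
  ultimately show ?thesis using finite_component[OF assms(1)] by metis
qed

text \<open>The grading involution, acting as (-1)^k in degree k. It replaces signs that depend on
  degrees by a linear map, so that for instance the Leibniz rule can be stated for elements that are
  not homogeneous.\<close>

definition eps :: "'a \<Rightarrow> 'a" where
  "eps x = (\<Oplus>k\<in>{k. component V k x \<noteq> \<zero>}. [par k] \<cdot> component V k x)"

lemma eps_sum:
  assumes "x \<in> carrier V" "finite S" "\<And>k. k \<notin> S \<Longrightarrow> component V k x = \<zero>"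
  shows "eps x = (\<Oplus>k\<in>S. [par k] \<cdot> component V k x)"
  unfolding eps_def by (rule finsum_mono_neutral[symmetric]) (use assms in auto)

lemma eps_homog:
  assumes "x \<in> grade V k" shows "eps x = [par k] \<cdot> x"
proof -
  have "eps x = (\<Oplus>j\<in>{k}. [par j] \<cdot> component V j x)"
    using assms grade_carrier by (intro eps_sum) (auto simp: component_homog)
  then show ?thesis using assms grade_carrier by (simp add: component_homog)
qed

lemma eps_closed [simp]: "x \<in> carrier V \<Longrightarrow> eps x \<in> carrier V"
  unfolding eps_def by (intro finsum_closed) auto

lemma eps_add [simp]:
  assumes x: "x \<in> carrier V" and y: "y \<in> carrier V"
  shows "eps (x \<oplus> y) = eps x \<oplus> eps y"
proof -
  let ?S = "{k. component V k x \<noteq> \<zero>} \<union> {k. component V k y \<noteq> \<zero>}"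
  have f: "finite ?S" using assms finite_component by auto
  have "eps (x \<oplus> y) = (\<Oplus>k\<in>?S. [par k] \<cdot> component V k (x \<oplus> y))"
    "eps x = (\<Oplus>k\<in>?S. [par k] \<cdot> component V k x)" "eps y = (\<Oplus>k\<in>?S. [par k] \<cdot> component V k y)"
    by (intro eps_sum f; use assms in \<open>auto simp: component_add\<close>)+
  then show ?thesis using assms by (simp add: component_add finsum_addf)
qed

lemma eps_smult [simp]:
  assumes c: "c \<in> carrier K" and x: "x \<in> carrier V"
  shows "eps (c \<odot> x) = c \<odot> eps x"
  using x
proof (induction x rule: grade_induct)
  case (homog k x) then show ?case using c
    by (simp add: eps_homog[of _ k] grade_smult smult_par grade_carrier)
next
  case (add x y) then show ?case using c by (simp add: smult_r_distr)
qed

lemma eps_linear: "linear_map K V V eps"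
  by (auto simp: linear_map_def)

lemma eps_grade: "x \<in> grade V k \<Longrightarrow> eps x \<in> grade V k"
  by (simp add: eps_homog grade_par)

lemma eps_zero [simp]: "eps \<zero> = \<zero>"
  by (simp add: eps_homog[of _ 0])

lemma eps_eps [simp]: "x \<in> carrier V \<Longrightarrow> eps (eps x) = x"
proof (induction x rule: grade_induct)
  case (homog k x) then show ?case
    by (simp add: eps_homog[of _ k] grade_par par_pow_par_pow grade_carrier par_pow grade_minus eps_homog[of "\<ominus> x" k])
qed auto

lemma eps_minus: "x \<in> carrier V \<Longrightarrow> eps (\<ominus> x) = \<ominus> (eps x)"
  by (rule additive_map_zero_minus(2)[of V V]) (auto simp: abelian_group_axioms)

lemma eps_finsum: "(\<And>i. i \<in> S \<Longrightarrow> f i \<in> carrier V) \<Longrightarrow> eps (finsum V f S) = (\<Oplus>i\<in>S. eps (f i))"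
  by (rule finsum_additive_hom) (auto simp: abelian_monoid_axioms)

text \<open>On an element of degree k the left side carries the sign (-1)^k, while
  \<open>eps (f x)\<close> carries (-1)^(k+e). For e = 1 and e = -1 this says that \<open>d\<close>
  and \<open>h\<close> anticommute with \<open>eps\<close>.\<close>

lemma shifting_eps:
  assumes f: "linear_map K V V f" and deg: "\<And>k x. x \<in> grade V k \<Longrightarrow> f x \<in> grade V (k + e)"
    and x: "x \<in> carrier V"
  shows "f (eps x) = [par e] \<cdot> (eps (f x))"
  using x
proof (induction x rule: grade_induct)
  case (homog k x)
  have c: "x \<in> carrier V" "f x \<in> carrier V" using homog grade_carrier linear_mapD(1)[OF f] by auto
  have m: "f (\<ominus> x) = \<ominus> (f x)"
    by (rule additive_map_zero_minus(2)[of V V])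
      (use c linear_mapD[OF f] in \<open>auto simp: abelian_group_axioms\<close>)
  have "f (eps x) = [par k] \<cdot> f x" using homog c by (simp add: eps_homog par_pow m)
  moreover have "eps (f x) = [par (k + e)] \<cdot> f x" using homog deg by (simp add: eps_homog)
  ultimately show ?case using c by (simp add: par_pow_par_pow par_pow)
next
  case (add x y)
  then show ?case using linear_mapD[OF f] by simp
qed

end

section \<open>Differential graded commutative algebras with signs expressed by the
  involution\<close>

locale graded_comm_alg = dgca K A d
  for A :: "('k, 'a) graded_alg" (structure) and K :: "'k ring" and d

sublocale graded_comm_alg \<subseteq> graded_space A K
  by (simp add: graded_space_def graded_vector_space_axioms)

context graded_comm_alg
begin

lemma d_closed [simp]: "x \<in> carrier A \<Longrightarrow> d x \<in> carrier A"
  and d_add: "x \<in> carrier A \<Longrightarrow> y \<in> carrier A \<Longrightarrow> d (x \<oplus> y) = d x \<oplus> d y"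
  and d_smult: "c \<in> carrier K \<Longrightarrow> x \<in> carrier A \<Longrightarrow> d (c \<odot> x) = c \<odot> d x"
  using linear_mapD[OF d_linear] by auto

lemma d_zero [simp]: "d \<zero> = \<zero>" and d_minus: "x \<in> carrier A \<Longrightarrow> d (\<ominus> x) = \<ominus> (d x)"
  by (rule additive_map_zero_minus[of A A]; auto simp: abelian_group_axioms d_add)+

lemma d_finsum: "(\<And>i. i \<in> S \<Longrightarrow> f i \<in> carrier A) \<Longrightarrow> d (finsum A f S) = (\<Oplus>i\<in>S. d (f i))"
  by (rule finsum_additive_hom) (auto simp: abelian_monoid_axioms d_add)

lemma eps_mult [simp]:
  assumes x: "x \<in> carrier A" and y: "y \<in> carrier A"
  shows "eps (x \<otimes> y) = eps x \<otimes> eps y"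
  using x
proof (induction x rule: grade_induct)
  case (homog i x)
  note xi = this
  show ?case using y
  proof (induction y rule: grade_induct)
    case (homog j y)
    then show ?case using xi mult_grade[OF xi homog] grade_carrier
      by (auto simp: eps_homog[of _ i] eps_homog[of _ j] eps_homog[of _ "i+j"] par_pow l_minus r_minus)
  next
    case (add y z) then show ?case using xi grade_carrier by (simp add: r_distr)
  qed
next
  case (add x z) then show ?case using y by (simp add: l_distr)
qed

lemma d_eps: "x \<in> carrier A \<Longrightarrow> d (eps x) = \<ominus> (eps (d x))"
  by (subst shifting_eps[where e = 1]) (auto simp: d_linear d_grade int_pow_pm1)

lemma eps_one [simp]: "eps \<one> = \<one>"
  by (simp add: eps_homog[OF one_grade] int_pow_pm1)

lemma leibniz_eps:
  assumes x: "x \<in> carrier A" and y: "y \<in> carrier A"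
  shows "d (x \<otimes> y) = d x \<otimes> y \<oplus> eps x \<otimes> d y"
  using x
proof (induction x rule: grade_induct)
  case (homog i x)
  then show ?case using y grade_carrier
    by (auto simp: leibniz eps_homog par_pow l_minus)
next
  case (add x z) then show ?case using y
    by (simp add: l_distr d_add) (use a_ac in \<open>simp add: a_ac\<close>)
qed

lemma one_carrier_d [simp]: "d \<one> = \<zero>"
proof -
  have "d \<one> = d \<one> \<oplus> d \<one>" using leibniz_eps[of \<one> \<one>] by simp
  then show ?thesis by (metis add.l_cancel_one' d_closed one_closed)
qed

end

text \<open>Sums, negatives and integer multiples refer to the carrier of the structure, so
  shrinking the carrier gives formally different terms. The inclusion is an additive map, and
  therefore the values agree.\<close>

lemma sub_abelian_group:
  assumes W: "abelian_group W" and V: "abelian_group V"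
    and sub: "carrier W \<subseteq> carrier V" and ops: "add W = add V" "zero W = zero V"
  shows sub_finsum: "\<And>S f. (\<And>i. i \<in> S \<Longrightarrow> f i \<in> carrier W) \<Longrightarrow> finsum W f S = finsum V f S"
    and sub_a_inv: "\<And>x. x \<in> carrier W \<Longrightarrow> \<ominus>\<^bsub>W\<^esub> x = \<ominus>\<^bsub>V\<^esub> x"
    and sub_par_pow: "\<And>x e. x \<in> carrier W \<Longrightarrow> [par e] \<cdot>\<^bsub>W\<^esub> x = [par e] \<cdot>\<^bsub>V\<^esub> x"
proof -
  interpret W: abelian_group W by fact
  interpret V: abelian_group V by fact
  show "finsum W f S = finsum V f S" if "\<And>i. i \<in> S \<Longrightarrow> f i \<in> carrier W" for f S
    using W.finsum_additive_hom[of V S f "\<lambda>x. x"] sub ops that V.abelian_monoid_axioms by auto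
  show inv: "\<ominus>\<^bsub>W\<^esub> x = \<ominus>\<^bsub>V\<^esub> x" if "x \<in> carrier W" for x
    using additive_map_zero_minus(2)[of W V "\<lambda>x. x" x] W V sub ops that by auto
  show "[par e] \<cdot>\<^bsub>W\<^esub> x = [par e] \<cdot>\<^bsub>V\<^esub> x" if "x \<in> carrier W" for x e
    using that sub inv by (auto simp: W.par_pow V.par_pow subset_iff)
qed

text \<open>A decomposition in the subspace is also one in \<open>V\<close>, which gives uniqueness;
  existence holds because the components taken in \<open>V\<close> stay in \<open>S\<close>.\<close>

lemma (in graded_space) graded_subspace:
  assumes S: "submodule S K V" and comp: "\<And>x k. x \<in> S \<Longrightarrow> component V k x \<in> S"
  shows "graded_vector_space K (V\<lparr>carrier := S, grade := \<lambda>k. S \<inter> grade V k\<rparr>)" (is "graded_vector_space K ?W")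
proof -
  have mod: "module K ?W"
    using submodule.submodule_is_module[OF S module_axioms]
    by (simp add: module_def abelian_group_def abelian_monoid_def abelian_group_axioms_def module_axioms_def)
  then interpret W: module K ?W .
  have SV: "S \<subseteq> carrier V" using submoduleE(1)[OF S] .
  have fs: "finsum ?W f T = finsum V f T" if "\<And>i. i \<in> T \<Longrightarrow> f i \<in> S" for f :: "'b \<Rightarrow> 'a" and T
    by (rule sub_finsum[OF W.abelian_group_axioms abelian_group_axioms]) (use SV that in auto)
  show ?thesis
  proof (intro graded_vector_space.intro graded_vector_space_axioms.intro mod K.field_axioms)
    fix k show "submodule (grade ?W k) K ?W"
    proof (rule W.submoduleI)
      show "\<ominus>\<^bsub>?W\<^esub> x \<in> grade ?W k" if "x \<in> grade ?W k" for x
        using that sub_a_inv[OF W.abelian_group_axioms abelian_group_axioms, of x] SV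
          submoduleE(3)[OF S] grade_minus by auto
    qed (use submoduleE[OF S] grade_add grade_smult W.zero_closed in auto)
  next
    fix x assume x: "x \<in> carrier ?W"
    then have xS: "x \<in> S" and xV: "x \<in> carrier V" using SV by auto
    show "\<exists>!g. homog_decomp ?W x g"
    proof (rule ex1I)
      show "homog_decomp ?W x (\<lambda>k. component V k x)"
        using decomp_ex[OF xV] comp[OF xS] by (auto simp: homog_decomp_def fs)
      fix g assume g: "homog_decomp ?W x g"
      then have "homog_decomp V x g" by (auto simp: homog_decomp_def fs)
      then show "g = (\<lambda>k. component V k x)" using direct_sum[OF xV] decomp_ex[OF xV] by blast
    qed
  qed
qed

section \<open>Contractions onto the harmonic subspace\<close>

text \<open>The part of a Hodge homotopy that does not mention the pairing; the whole transfer uses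
  only this. The condition \<open>h_one\<close> makes the unit harmonic.\<close>

locale contraction = graded_comm_alg A K d
  for A :: "('k, 'a) graded_alg" (structure) and K :: "'k ring" and d +
  fixes h :: "'a \<Rightarrow> 'a"
  assumes h_linear: "linear_map K A A h"
    and h_grade: "x \<in> grade A k \<Longrightarrow> h x \<in> grade A (k - 1)"
    and h_h [simp]: "x \<in> carrier A \<Longrightarrow> h (h x) = \<zero>"
    and h_d_h [simp]: "x \<in> carrier A \<Longrightarrow> h (d (h x)) = h x"
    and d_h_d [simp]: "x \<in> carrier A \<Longrightarrow> d (h (d x)) = d x"
    and h_one [simp]: "h \<one> = \<zero>"
begin

abbreviation pr :: "'a \<Rightarrow> 'a" where "pr \<equiv> harmonic_proj A d h"
abbreviation H :: "('k, 'a) graded_alg" where "H \<equiv> harmonic_space A d h"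

lemma h_closed [simp]: "x \<in> carrier A \<Longrightarrow> h x \<in> carrier A"
  and h_add: "x \<in> carrier A \<Longrightarrow> y \<in> carrier A \<Longrightarrow> h (x \<oplus> y) = h x \<oplus> h y"
  and h_smult: "c \<in> carrier K \<Longrightarrow> x \<in> carrier A \<Longrightarrow> h (c \<odot> x) = c \<odot> h x"
  using linear_mapD[OF h_linear] by auto

lemma h_zero [simp]: "h \<zero> = \<zero>" and h_minus: "x \<in> carrier A \<Longrightarrow> h (\<ominus> x) = \<ominus> (h x)"
  by (rule additive_map_zero_minus[of A A]; auto simp: abelian_group_axioms h_add)+

lemma h_finsum: "(\<And>i. i \<in> S \<Longrightarrow> f i \<in> carrier A) \<Longrightarrow> h (finsum A f S) = (\<Oplus>i\<in>S. h (f i))"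
  by (rule finsum_additive_hom) (auto simp: abelian_monoid_axioms h_add)

lemma h_par: "x \<in> carrier A \<Longrightarrow> h ([par e] \<cdot> x) = [par e] \<cdot> h x"
  by (simp add: par_pow h_minus)

lemma h_eps: "x \<in> carrier A \<Longrightarrow> h (eps x) = \<ominus> (eps (h x))"
  by (subst shifting_eps[where e = "-1"]) (use h_grade in \<open>auto simp: h_linear par_pow\<close>)

lemma pr_closed [simp]: "x \<in> carrier A \<Longrightarrow> pr x \<in> carrier A"
  by (simp add: harmonic_proj_def)

lemma pr_add: "x \<in> carrier A \<Longrightarrow> y \<in> carrier A \<Longrightarrow> pr (x \<oplus> y) = pr x \<oplus> pr y"
  by (simp add: harmonic_proj_def d_add h_add a_minus_def minus_add a_ac)

lemma pr_smult: "c \<in> carrier K \<Longrightarrow> x \<in> carrier A \<Longrightarrow> pr (c \<odot> x) = c \<odot> pr x"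
  by (simp add: harmonic_proj_def d_smult h_smult smult_r_distr smult_r_minus a_minus_def)

lemma pr_zero [simp]: "pr \<zero> = \<zero>" and pr_minus: "x \<in> carrier A \<Longrightarrow> pr (\<ominus> x) = \<ominus> (pr x)"
  by (rule additive_map_zero_minus[of A A]; auto simp: abelian_group_axioms pr_add)+

lemma pr_finsum: "(\<And>i. i \<in> S \<Longrightarrow> f i \<in> carrier A) \<Longrightarrow> pr (finsum A f S) = (\<Oplus>i\<in>S. pr (f i))"
  by (rule finsum_additive_hom) (auto simp: abelian_monoid_axioms pr_add)

lemma pr_par: "x \<in> carrier A \<Longrightarrow> pr ([par e] \<cdot> x) = [par e] \<cdot> pr x"
  by (simp add: par_pow pr_minus)

lemma pr_grade: "x \<in> grade A k \<Longrightarrow> pr x \<in> grade A k"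
  using d_grade[of "h x" "k - 1"] h_grade[of "d x" "k + 1"] h_grade[of x k] d_grade[of x k]
  by (auto simp: harmonic_proj_def a_minus_def intro: grade_add grade_minus)

lemma pr_h [simp]: "x \<in> carrier A \<Longrightarrow> pr (h x) = \<zero>"
  by (simp add: harmonic_proj_def a_minus_def r_neg)

lemma pr_d [simp]: "x \<in> carrier A \<Longrightarrow> pr (d x) = \<zero>"
  by (simp add: harmonic_proj_def a_minus_def r_neg d_d)

lemma h_pr [simp]: "x \<in> carrier A \<Longrightarrow> h (pr x) = \<zero>"
  by (simp add: harmonic_proj_def a_minus_def h_add h_minus r_neg)

lemma d_pr [simp]: "x \<in> carrier A \<Longrightarrow> d (pr x) = \<zero>"
  by (simp add: harmonic_proj_def a_minus_def d_add d_minus r_neg d_d)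

lemma pr_pr [simp]: "x \<in> carrier A \<Longrightarrow> pr (pr x) = pr x"
  by (subst harmonic_proj_def[of A d h "pr x"]) (simp add: a_minus_def)

lemma pr_eq: "x \<in> carrier A \<Longrightarrow> h x = \<zero> \<Longrightarrow> d x = \<zero> \<Longrightarrow> pr x = x"
  by (simp add: harmonic_proj_def a_minus_def)

lemma pr_decomp: "x \<in> carrier A \<Longrightarrow> x = pr x \<oplus> (d (h x) \<oplus> h (d x))"
  by (simp add: harmonic_proj_def a_minus_def a_assoc l_neg)

lemma pr_eps: "x \<in> carrier A \<Longrightarrow> pr (eps x) = eps (pr x)"
  by (simp add: harmonic_proj_def a_minus_def h_eps d_eps d_minus h_minus eps_minus)

lemma pr_one [simp]: "pr \<one> = \<one>"
  by (rule pr_eq) auto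

lemma H_ops [simp]: "zero H = \<zero>" "add H = add A" "smult H = smult A" "one H = \<one>"
  by (simp_all add: harmonic_space_def)

lemma H_carrier: "carrier H = {x \<in> carrier A. pr x = x}"
proof -
  have "x \<in> pr ` carrier A" if "x \<in> carrier A" "pr x = x" for x
    using that by (metis imageI)
  then show ?thesis by (auto simp: harmonic_space_def)
qed

lemma H_grade: "grade H k = carrier H \<inter> grade A k"
proof -
  have "x \<in> pr ` grade A k" if "x \<in> grade A k" "pr x = x" for x
    using that by (metis imageI)
  then show ?thesis unfolding H_carrier
    by (auto simp: harmonic_space_def pr_grade grade_carrier)
qed

lemma H_I: "x \<in> carrier A \<Longrightarrow> pr x = x \<Longrightarrow> x \<in> carrier H"
  by (simp add: H_carrier)

lemma H_D [simp]:
  assumes "x \<in> carrier H"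
  shows H_closed: "x \<in> carrier A" and H_pr: "pr x = x" and H_h: "h x = \<zero>" and H_d: "d x = \<zero>"
proof -
  show "x \<in> carrier A" "pr x = x" using assms by (auto simp: H_carrier)
  then show "h x = \<zero>" "d x = \<zero>" using h_pr[of x] d_pr[of x] by simp_all
qed

lemma pr_H [simp]: "x \<in> carrier A \<Longrightarrow> pr x \<in> carrier H"
  by (rule H_I) auto

lemma one_H [simp]: "\<one> \<in> carrier H" and zero_H [simp]: "\<zero> \<in> carrier H"
  by (auto intro!: H_I)

lemma add_H [simp]: "x \<in> carrier H \<Longrightarrow> y \<in> carrier H \<Longrightarrow> x \<oplus> y \<in> carrier H"
  and minus_H [simp]: "x \<in> carrier H \<Longrightarrow> \<ominus> x \<in> carrier H"
  and smult_H [simp]: "c \<in> carrier K \<Longrightarrow> x \<in> carrier H \<Longrightarrow> c \<odot> x \<in> carrier H"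
  and eps_H [simp]: "x \<in> carrier H \<Longrightarrow> eps x \<in> carrier H"
  by (auto intro!: H_I simp: pr_add pr_minus pr_smult pr_eps)

lemma component_pr: "x \<in> carrier A \<Longrightarrow> component A k (pr x) = pr (component A k x)"
proof (induction x rule: grade_induct)
  case (homog j x) then show ?case by (simp add: component_homog[of _ j] pr_grade)
next
  case (add x y) then show ?case by (simp add: pr_add component_add)
qed

text \<open>The projection preserves degrees and hence commutes with taking components, so the
  components of a harmonic element are harmonic.\<close>

lemma graded_vector_space_H: "graded_vector_space K H"
proof -
  have "submodule (carrier H) K A" by (rule submoduleI) auto
  moreover have "component A k x \<in> carrier H" if "x \<in> carrier H" for x k
    using that component_pr[of x k, symmetric] by (intro H_I) (simp_all only: H_closed H_pr component_closed)
  ultimately have "graded_vector_space K (A\<lparr>carrier := carrier H, grade := \<lambda>k. carrier H \<inter> grade A k\<rparr>)"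
    by (rule graded_subspace)
  moreover have "A\<lparr>carrier := carrier H, grade := \<lambda>k. carrier H \<inter> grade A k\<rparr> = H"
  proof -
    have *: "(\<lambda>k. carrier H \<inter> grade A k) = grade H" using H_grade by (simp add: fun_eq_iff)
    show ?thesis unfolding * by (simp add: harmonic_space_def del: H_D)
  qed
  ultimately show ?thesis by simp
qed

end

sublocale contraction \<subseteq> H: graded_space H K
  by (simp add: graded_space_def graded_vector_space_H)

context contraction
begin

lemma H_finsum: "(\<And>i. i \<in> S \<Longrightarrow> f i \<in> carrier H) \<Longrightarrow> finsum H f S = finsum A f S"
  and H_par: "x \<in> carrier H \<Longrightarrow> [par e] \<cdot>\<^bsub>H\<^esub> x = [par e] \<cdot> x"
proof -
  have *: "carrier H \<subseteq> carrier A" by auto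
  note sub = sub_abelian_group[OF H.abelian_group_axioms abelian_group_axioms * H_ops(2,1)]
  show "(\<And>i. i \<in> S \<Longrightarrow> f i \<in> carrier H) \<Longrightarrow> finsum H f S = finsum A f S" by (rule sub(1))
  show "x \<in> carrier H \<Longrightarrow> [par e] \<cdot>\<^bsub>H\<^esub> x = [par e] \<cdot> x" by (rule sub(3))
qed

lemma par_H [simp]: "x \<in> carrier H \<Longrightarrow> [par e] \<cdot> x \<in> carrier H"
  by (simp add: par_pow)

end

section \<open>Splittings of words\<close>

text \<open>Reduced deconcatenation: both pieces are nonempty, hence both are shorter than the
  word.\<close>

definition splits :: "'b list \<Rightarrow> ('b list \<times> 'b list) set" where
  "splits w = {(u, v). u @ v = w \<and> u \<noteq> [] \<and> v \<noteq> []}"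

definition insertions :: "'b list \<Rightarrow> ('b list \<times> 'b list \<times> 'b list) set" where
  "insertions w = {(us, vs, ws). us @ vs @ ws = w \<and> vs \<noteq> []}"

lemma finite_append2: "finite {(u, v). u @ v = w \<and> P u v}"
proof (rule finite_subset)
  show "{(u, v). u @ v = w \<and> P u v} \<subseteq> (\<lambda>i. (take i w, drop i w)) ` {..length w}"
  proof
    fix p assume "p \<in> {(u, v). u @ v = w \<and> P u v}"
    then show "p \<in> (\<lambda>i. (take i w, drop i w)) ` {..length w}"
      by (intro image_eqI[where x = "length (fst p)"]) auto
  qed
qed simp

lemma finite_splits [simp]: "finite (splits w)"
  unfolding splits_def by (rule finite_append2)

lemma finite_insertions [simp]: "finite (insertions w)"
proof (rule finite_subset)
  show "insertions w \<subseteq> (\<lambda>((u, v), i). (u, take i v, drop i v)) `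
      ({(u, v). u @ v = w \<and> True} \<times> {..length w})"
  proof
    fix p assume p: "p \<in> insertions w"
    obtain us vs ws where "p = (us, vs, ws)" by (cases p) auto
    with p show "p \<in> (\<lambda>((u, v), i). (u, take i v, drop i v)) ` ({(u, v). u @ v = w \<and> True} \<times> {..length w})"
      by (intro image_eqI[where x = "((us, vs @ ws), length vs)"]) (auto simp: insertions_def)
  qed
qed (intro finite_imageI finite_cartesian_product finite_append2 finite_atMost)

lemma splitsD:
  assumes "(u, v) \<in> splits w"
  shows "set u \<subseteq> set w" "set v \<subseteq> set w" "length u < length w" "length v < length w"
    "w = u @ v" "u \<noteq> []" "v \<noteq> []"
  using assms by (auto simp: splits_def)

lemma insertionsD:
  assumes "(us, vs, ws) \<in> insertions w"
  shows "set us \<subseteq> set w" "set vs \<subseteq> set w" "set ws \<subseteq> set w" "us @ vs @ ws = w"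
  using assms by (auto simp: insertions_def)

lemma insertions_Nil [simp]: "insertions [] = {}"
  by (auto simp: insertions_def)

lemma splits_single [simp]: "splits [x] = {}" and splits_Nil [simp]: "splits [] = {}"
  by (auto simp: splits_def append_eq_Cons_conv)

section \<open>Sums over deconcatenations and insertions\<close>

lemma (in abelian_group) add_cancel_middle:
  "x \<in> carrier G \<Longrightarrow> y \<in> carrier G \<Longrightarrow> x \<oplus> (y \<oplus> \<ominus> x) = y"
  using a_lcomm[of x y "\<ominus> x"] by (simp add: r_neg)

context abelian_monoid
begin

lemma finsum_addf_pair:
  assumes "\<And>u v. (u, v) \<in> S \<Longrightarrow> f u v \<in> carrier G" "\<And>u v. (u, v) \<in> S \<Longrightarrow> g u v \<in> carrier G"
  shows "finsum G (\<lambda>(u, v). f u v \<oplus> g u v) S = finsum G (\<lambda>(u, v). f u v) S \<oplus> finsum G (\<lambda>(u, v). g u v) S"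
  using finsum_addf[of "\<lambda>(u, v). f u v" S "\<lambda>(u, v). g u v"] assms
  by (auto simp: Pi_def case_prod_unfold)

text \<open>A cut is determined by the length of its first piece, which \<open>map f\<close>
  preserves; thus the index sets correspond even when \<open>f\<close> identifies letters.\<close>

lemma finsum_splits_map:
  assumes "\<And>u v. u @ v = w \<Longrightarrow> u \<noteq> [] \<Longrightarrow> v \<noteq> [] \<Longrightarrow> g (map f u) (map f v) \<in> carrier G"
  shows "finsum G (\<lambda>(u, v). g u v) (splits (map f w)) = finsum G (\<lambda>(u, v). g (map f u) (map f v)) (splits w)"
proof -
  have "bij_betw (\<lambda>(u, v). (map f u, map f v)) (splits w) (splits (map f w))"
  proof (rule bij_betwI')
    fix p q assume "p \<in> splits w" "q \<in> splits w"
    then show "((\<lambda>(u, v). (map f u, map f v)) p = (\<lambda>(u, v). (map f u, map f v)) q) = (p = q)"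
      by (auto simp: splits_def append_eq_append_conv_if dest!: map_eq_imp_length_eq split: if_splits)
  next
    fix q assume "q \<in> splits (map f w)"
    then obtain u v where q: "q = (u, v)" "map f w = u @ v" "u \<noteq> []" "v \<noteq> []" by (auto simp: splits_def)
    then obtain u' v' where "w = u' @ v'" "map f u' = u" "map f v' = v" by (auto simp: map_eq_append_conv)
    then show "\<exists>p\<in>splits w. q = (\<lambda>(u, v). (map f u, map f v)) p"
      using q by (intro bexI[where x = "(u', v')"]) (auto simp: splits_def)
  qed (auto simp: splits_def)
  moreover have "(\<lambda>(u, v). g u v) \<in> splits (map f w) \<rightarrow> carrier G"
    using assms by (auto simp: splits_def dest!: map_eq_append_conv[THEN iffD1, OF sym])
  ultimately show ?thesis
    by (subst finsum_bij) (auto simp: case_prod_unfold)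
qed

text \<open>The cut falls to the left or to the right of the marked letter \<open>y\<close>. The
  piece containing \<open>y\<close> is automatically nonempty, so properness of the cut only
  constrains the other piece.\<close>

lemma finsum_splits_insert:
  assumes "\<And>u v. (u, v) \<in> splits (X @ [y] @ Z) \<Longrightarrow> g u v \<in> carrier G"
  shows "finsum G (\<lambda>(u, v). g u v) (splits (X @ [y] @ Z)) =
     finsum G (\<lambda>(a, b). g a (b @ [y] @ Z)) {(a, b). a @ b = X \<and> a \<noteq> []} \<oplus>
     finsum G (\<lambda>(a, b). g (X @ [y] @ a) b) {(a, b). a @ b = Z \<and> b \<noteq> []}"
proof -
  let ?p = "\<lambda>(a, b). (a, b @ [y] @ Z)" and ?q = "\<lambda>(a, b). (X @ [y] @ a, b)"
  let ?S = "{(a, b). a @ b = X \<and> a \<noteq> []}" and ?T = "{(a, b). a @ b = Z \<and> b \<noteq> []}"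
  have eq: "splits (X @ [y] @ Z) = ?p ` ?S \<union> ?q ` ?T"
  proof (intro equalityI subsetI)
    fix s assume "s \<in> splits (X @ [y] @ Z)"
    then obtain u v where s: "s = (u, v)" "u @ v = X @ [y] @ Z" "u \<noteq> []" "v \<noteq> []"
      by (auto simp: splits_def)
    then obtain us where "u = X @ us \<and> us @ v = [y] @ Z \<or> X = u @ us \<and> v = us @ [y] @ Z"
      unfolding append_eq_append_conv2 by auto
    then consider us where "X = u @ us" "v = us @ [y] @ Z" | us where "u = X @ us" "us @ v = [y] @ Z" "us \<noteq> []"
      using that(1)[of us] that(1)[of "[]"] that(2)[of us] by (cases "us = []") auto
    then show "s \<in> ?p ` ?S \<union> ?q ` ?T"
    proof cases
      case 1 then show ?thesis using s by (auto intro!: image_eqI[where x = "(u, us)"])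
    next
      case 2
      then obtain us' where "us = y # us'" "us' @ v = Z" by (auto simp: append_eq_Cons_conv)
      then show ?thesis using s 2 by (auto intro!: image_eqI[where x = "(us', v)"])
    qed
  qed (auto simp: splits_def)
  have disj: "?p ` ?S \<inter> ?q ` ?T = {}"
  proof -
    have "length a \<le> length X" if "(a, b) \<in> ?p ` ?S" for a b using that by auto
    moreover have "length a > length X" if "(a, b) \<in> ?q ` ?T" for a b using that by auto
    ultimately show ?thesis by fastforce
  qed
  have cl: "(\<lambda>(u, v). g u v) \<in> ?p ` ?S \<rightarrow> carrier G" "(\<lambda>(u, v). g u v) \<in> ?q ` ?T \<rightarrow> carrier G"
    using assms unfolding eq by (auto simp: Pi_def)
  have "inj_on ?p ?S" "inj_on ?q ?T" by (auto simp: inj_on_def)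
  moreover have "finite ?S" "finite ?T" by (rule finite_append2)+
  ultimately show ?thesis
    unfolding eq using cl disj
    by (subst finsum_Un_disjoint) (auto simp: finsum_reindex case_prod_unfold)
qed

text \<open>With \<open>finsum_insertions_right\<close>, this is the coderivation property of
  insertions: choosing a block and then cutting to the left of it amounts to cutting first and then
  choosing the block in the right piece.\<close>

lemma finsum_insertions_left:
  assumes "\<And>a b c e. a @ b @ c @ e = w \<Longrightarrow> g a b c e \<in> carrier G"
  shows "finsum G (\<lambda>(us, vs, ws). finsum G (\<lambda>(a, b). g a b vs ws) {(a, b). a @ b = us \<and> a \<noteq> []}) (insertions w) =
     finsum G (\<lambda>(u, v). finsum G (\<lambda>(us, vs, ws). g u us vs ws) (insertions v)) (splits w)"
proof -
  have "finsum G (\<lambda>t. finsum G (\<lambda>p. g (fst p) (snd p) (fst (snd t)) (snd (snd t))) {(a, b). a @ b = fst t \<and> a \<noteq> []}) (insertions w) =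
     finsum G (\<lambda>(t, p). g (fst p) (snd p) (fst (snd t)) (snd (snd t))) (Sigma (insertions w) (\<lambda>t. {(a, b). a @ b = fst t \<and> a \<noteq> []}))"
    by (rule finsum_Sigma) (use assms in \<open>auto simp: finite_append2 dest!: insertionsD(4)\<close>)
  also have "\<dots> = finsum G (\<lambda>(s, t). g (fst s) (fst t) (fst (snd t)) (snd (snd t))) (Sigma (splits w) (\<lambda>s. insertions (snd s)))"
    by (rule finsum_witness[where j = "\<lambda>((u, v), (us, vs, ws)). ((u @ us, vs, ws), (u, us))"
          and i = "\<lambda>((us, vs, ws), (a, b)). ((a, b @ vs @ ws), (b, vs, ws))"])
      (use assms in \<open>auto simp: insertions_def splits_def\<close>)
  also have "\<dots> = finsum G (\<lambda>s. finsum G (\<lambda>t. g (fst s) (fst t) (fst (snd t)) (snd (snd t))) (insertions (snd s))) (splits w)"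
    by (rule finsum_Sigma[symmetric]) (use assms in \<open>auto dest!: insertionsD(4) splitsD(5)\<close>)
  finally show ?thesis by (simp add: case_prod_unfold)
qed

lemma finsum_insertions_right:
  assumes "\<And>a b c e. a @ b @ c @ e = w \<Longrightarrow> g a b c e \<in> carrier G"
  shows "finsum G (\<lambda>(us, vs, ws). finsum G (\<lambda>(a, b). g us vs a b) {(a, b). a @ b = ws \<and> b \<noteq> []}) (insertions w) =
     finsum G (\<lambda>(u, v). finsum G (\<lambda>(us, vs, ws). g us vs ws v) (insertions u)) (splits w)"
proof -
  have "finsum G (\<lambda>t. finsum G (\<lambda>p. g (fst t) (fst (snd t)) (fst p) (snd p)) {(a, b). a @ b = snd (snd t) \<and> b \<noteq> []}) (insertions w) =
     finsum G (\<lambda>(t, p). g (fst t) (fst (snd t)) (fst p) (snd p)) (Sigma (insertions w) (\<lambda>t. {(a, b). a @ b = snd (snd t) \<and> b \<noteq> []}))"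
    by (rule finsum_Sigma) (use assms in \<open>auto simp: finite_append2 dest!: insertionsD(4)\<close>)
  also have "\<dots> = finsum G (\<lambda>(s, t). g (fst t) (fst (snd t)) (snd (snd t)) (snd s)) (Sigma (splits w) (\<lambda>s. insertions (fst s)))"
    by (rule finsum_witness[where j = "\<lambda>((u, v), (us, vs, ws)). ((us, vs, ws @ v), (ws, v))"
          and i = "\<lambda>((us, vs, ws), (a, b)). ((us @ vs @ a, b), (us, vs, a))"])
      (use assms in \<open>auto simp: insertions_def splits_def\<close>)
  also have "\<dots> = finsum G (\<lambda>s. finsum G (\<lambda>t. g (fst t) (fst (snd t)) (snd (snd t)) (snd s)) (insertions (fst s))) (splits w)"
    by (rule finsum_Sigma[symmetric]) (use assms in \<open>auto dest!: insertionsD(4) splitsD(5)\<close>)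
  finally show ?thesis by (simp add: case_prod_unfold)
qed

text \<open>Coassociativity of deconcatenation: both iterated sums run over the cuts into three
  nonempty pieces.\<close>

lemma finsum_splits_assoc:
  assumes "\<And>a b c. a @ b @ c = w \<Longrightarrow> g a b c \<in> carrier G"
  shows "finsum G (\<lambda>(u, v). finsum G (\<lambda>(a, b). g a b v) (splits u)) (splits w) =
     finsum G (\<lambda>(u, v). finsum G (\<lambda>(a, b). g u a b) (splits v)) (splits w)"
proof -
  have "finsum G (\<lambda>t. finsum G (\<lambda>p. g (fst p) (snd p) (snd t)) (splits (fst t))) (splits w) =
     finsum G (\<lambda>(t, p). g (fst p) (snd p) (snd t)) (Sigma (splits w) (\<lambda>t. splits (fst t)))"
    by (rule finsum_Sigma) (use assms in \<open>auto dest!: splitsD(5)\<close>)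
  also have "\<dots> = finsum G (\<lambda>(t, p). g (fst t) (fst p) (snd p)) (Sigma (splits w) (\<lambda>t. splits (snd t)))"
    by (rule finsum_witness[where i = "\<lambda>((u, v), (a, b)). ((a, b @ v), (b, v))"
          and j = "\<lambda>((u, v), (a, b)). ((u @ a, b), (u, a))"])
      (use assms in \<open>auto simp: splits_def\<close>)
  also have "\<dots> = finsum G (\<lambda>t. finsum G (\<lambda>p. g (fst t) (fst p) (snd p)) (splits (snd t))) (splits w)"
    by (rule finsum_Sigma[symmetric]) (use assms in \<open>auto dest!: splitsD(5)\<close>)
  finally show ?thesis by (simp add: case_prod_unfold)
qed

end

section \<open>Homotopy transfer\<close>

context contraction
begin

text \<open>\<open>\<Phi>\<close>, \<open>\<Theta>\<close> and \<open>\<mu>\<close> are the maps \<open>f\<close>, \<open>p\<close> and \<open>m\<close> of the homotopy transfer with suspended arguments.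
  In this convention the Koszul signs reduce to the grading involution \<open>eps\<close>, which also makes sense
  for arguments that are not homogeneous.\<close>

function \<Phi> :: "'a list \<Rightarrow> 'a" where
  "\<Phi> [] = \<zero>"
| "\<Phi> [x] = x"
| "\<Phi> (x # y # zs) = \<ominus> (h (finsum A (\<lambda>(u, v). eps (\<Phi> u) \<otimes> \<Phi> v) (splits (x # y # zs))))"
  by pat_completeness auto
termination
  by (relation "measure length") (auto dest: splitsD)

declare \<Phi>.simps(3) [simp del]

definition \<Theta> :: "'a list \<Rightarrow> 'a" where
  "\<Theta> w = finsum A (\<lambda>(u, v). eps (\<Phi> u) \<otimes> \<Phi> v) (splits w)"

definition \<mu> :: "'a list \<Rightarrow> 'a" where
  "\<mu> w = pr (\<Theta> w)"

text \<open>The projection of the tensor coalgebra onto words of length one. By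
  \<open>\<Phi>_eq\<close> the transferred map is this projection corrected by \<open>h\<close>,
  which treats words of length one and longer words by one formula.\<close>

definition single :: "'a list \<Rightarrow> 'a" where
  "single w = (case w of [x] \<Rightarrow> x | _ \<Rightarrow> \<zero>)"

text \<open>In degree e this is (-1)^(e-1), the Koszul sign of an operator of odd degree passing the
  suspension of an element of degree e.\<close>

definition neg_eps :: "'a \<Rightarrow> 'a" where
  "neg_eps x = \<ominus> (eps x)"

lemma \<Phi>_long: "2 \<le> length w \<Longrightarrow> \<Phi> w = \<ominus> (h (\<Theta> w))"
  by (cases w rule: \<Phi>.cases) (auto simp: \<Theta>_def \<Phi>.simps(3))

lemma \<Phi>_closed [simp]: "set w \<subseteq> carrier A \<Longrightarrow> \<Phi> w \<in> carrier A"
proof (induction w rule: length_induct)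
  case (1 w)
  have "\<Theta> w \<in> carrier A" unfolding \<Theta>_def
  proof (intro finsum_closed Pi_I, clarify)
    fix u v assume "(u, v) \<in> splits w"
    then have "\<Phi> u \<in> carrier A" "\<Phi> v \<in> carrier A" using 1 splitsD[of u v w] by blast+
    then show "eps (\<Phi> u) \<otimes> \<Phi> v \<in> carrier A" by simp
  qed
  then show ?case using 1(2) by (cases w rule: \<Phi>.cases) (auto simp: \<Phi>_long)
qed

lemma \<Phi>_splits [simp]:
  assumes "(u, v) \<in> splits w" "set w \<subseteq> carrier A"
  shows "\<Phi> u \<in> carrier A" "\<Phi> v \<in> carrier A"
  using assms by (auto dest: splitsD intro!: \<Phi>_closed)

lemma \<Theta>_closed [simp]: "set w \<subseteq> carrier A \<Longrightarrow> \<Theta> w \<in> carrier A"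
  unfolding \<Theta>_def by (intro finsum_closed) auto

lemma \<mu>_closed [simp]: "set w \<subseteq> carrier A \<Longrightarrow> \<mu> w \<in> carrier A"
  and \<mu>_H [simp]: "set w \<subseteq> carrier A \<Longrightarrow> \<mu> w \<in> carrier H"
  by (simp_all add: \<mu>_def)

lemma \<Theta>_short [simp]: "\<Theta> [] = \<zero>" "\<Theta> [x] = \<zero>"
  by (simp_all add: \<Theta>_def)

lemma \<mu>_short [simp]: "\<mu> [] = \<zero>" "\<mu> [x] = \<zero>"
  by (simp_all add: \<mu>_def)

lemma \<Phi>_eq: "set w \<subseteq> carrier A \<Longrightarrow> \<Phi> w = single w \<ominus> h (\<Theta> w)"
  by (cases w rule: \<Phi>.cases) (auto simp: \<Phi>_long single_def a_minus_def)

lemma single_closed: "set w \<subseteq> carrier A \<Longrightarrow> single w \<in> carrier A"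
  by (auto simp: single_def split: list.splits)

lemma neg_eps_closed [simp]: "x \<in> carrier A \<Longrightarrow> neg_eps x \<in> carrier A"
  and neg_eps_H [simp]: "x \<in> carrier H \<Longrightarrow> neg_eps x \<in> carrier H"
  by (simp_all add: neg_eps_def)

lemma map_neg_eps_closed [simp]: "set w \<subseteq> carrier A \<Longrightarrow> neg_eps ` set w \<subseteq> carrier A"
  "set w \<subseteq> carrier H \<Longrightarrow> neg_eps ` set w \<subseteq> carrier H"
  by auto

lemma H_sub_A [simp]: "set w \<subseteq> carrier H \<Longrightarrow> set w \<subseteq> carrier A"
  by auto

text \<open>On suspended words \<open>\<Phi>\<close> has degree 0 and so commutes with the suspended
  sign; the degree of \<open>\<Theta>\<close> differs by one, which turns \<open>neg_eps\<close>
  into \<open>eps\<close>. In the induction the two minus signs of a product cancel, and a new one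
  appears because \<open>h\<close> anticommutes with \<open>eps\<close>.\<close>

lemma \<Phi>_neg_eps: "set w \<subseteq> carrier A \<Longrightarrow> \<Phi> (map neg_eps w) = \<ominus> (eps (\<Phi> w))"
  and \<Theta>_neg_eps: "set w \<subseteq> carrier A \<Longrightarrow> \<Theta> (map neg_eps w) = eps (\<Theta> w)"
proof (induction w rule: length_induct)
  case (1 w)
  have th: "\<Theta> (map neg_eps w) = eps (\<Theta> w)" if w: "set w \<subseteq> carrier A"
  proof -
    have "\<Theta> (map neg_eps w) = finsum A (\<lambda>(u, v). eps (\<Phi> (map neg_eps u)) \<otimes> \<Phi> (map neg_eps v)) (splits w)"
      unfolding \<Theta>_def by (rule finsum_splits_map) (use w in auto)
    also have "\<dots> = finsum A (\<lambda>(u, v). eps (eps (\<Phi> u) \<otimes> \<Phi> v)) (splits w)"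
    proof (intro finsum_cong_on refl, clarify)
      fix u v assume uv: "(u, v) \<in> splits w"
      have "set u \<subseteq> carrier A" "set v \<subseteq> carrier A" "length u < length w" "length v < length w"
        using splitsD[OF uv] w by auto
      then have "\<Phi> (map neg_eps u) = \<ominus> (eps (\<Phi> u))" "\<Phi> (map neg_eps v) = \<ominus> (eps (\<Phi> v))"
        using 1 by auto
      moreover have "\<Phi> u \<in> carrier A" "\<Phi> v \<in> carrier A" using uv w by auto
      ultimately show "eps (\<Phi> (map neg_eps u)) \<otimes> \<Phi> (map neg_eps v) = eps (eps (\<Phi> u) \<otimes> \<Phi> v)"
        by (simp add: eps_minus l_minus r_minus)
    qed
    also have "\<dots> = eps (\<Theta> w)"
      unfolding \<Theta>_def by (subst eps_finsum) (use w in \<open>auto simp: case_prod_unfold\<close>)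
    finally show ?thesis .
  qed
  { case 1
    show ?case
    proof (cases w rule: \<Phi>.cases)
      case (3 x y zs)
      then show ?thesis using 1 th by (simp add: \<Phi>_long h_eps eps_minus)
    qed (use 1 in \<open>auto simp: neg_eps_def\<close>) }
  { case 2 then show ?case by (rule th) }
qed

text \<open>Precomposition with the coderivation of the bar construction that extends \<open>\<mu>\<close>; it has degree \<open>1\<close>,
  whence \<open>neg_eps\<close> on the suspended arguments that it moves past.\<close>

definition cobar :: "('a list \<Rightarrow> 'a) \<Rightarrow> 'a list \<Rightarrow> 'a" where
  "cobar g w = finsum A (\<lambda>(us, vs, ws). g (map neg_eps us @ [\<mu> vs] @ ws)) (insertions w)"

lemma insertion_closed [simp]:
  assumes "(us, vs, ws) \<in> insertions w" "set w \<subseteq> carrier A"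
  shows "set (map neg_eps us @ [\<mu> vs] @ ws) \<subseteq> carrier A"
proof -
  have "set us \<subseteq> carrier A" "set vs \<subseteq> carrier A" "set ws \<subseteq> carrier A"
    using insertionsD[OF assms(1)] assms(2) by auto
  then show ?thesis by auto
qed

lemma cobar_closed [simp]:
  assumes "\<And>w. set w \<subseteq> carrier A \<Longrightarrow> g w \<in> carrier A" "set w \<subseteq> carrier A"
  shows "cobar g w \<in> carrier A"
  unfolding cobar_def
  by (intro finsum_closed Pi_I, clarify, rule assms(1), rule insertion_closed[OF _ assms(2)])

text \<open>By \<open>\<Phi>_eq\<close> the left side is the contribution of \<open>single\<close>
  minus \<open>h\<close> of that of \<open>\<Theta>\<close>. An insertion yields a word of length
  one only if the block is all of \<open>w\<close>, so the first contribution is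
  \<open>\<mu> w\<close>.\<close>

lemma cobar_\<Phi>:
  assumes w: "set w \<subseteq> carrier A" and ne: "w \<noteq> []"
  shows "cobar \<Phi> w = \<mu> w \<ominus> h (cobar \<Theta> w)"
proof -
  let ?J = "\<lambda>(us, vs, ws). map neg_eps us @ [\<mu> vs] @ ws"
  have J: "set (?J t) \<subseteq> carrier A" if "t \<in> insertions w" for t
    
  proof -
    obtain us vs ws where t: "t = (us, vs, ws)" by (cases t) auto
    show ?thesis using insertion_closed[OF that[unfolded t] w] by (simp only: t prod.case)
  qed
  have s: "single (?J t) \<in> carrier A" if "t \<in> insertions w" for t
    using J[OF that] by (rule single_closed)
  have "cobar \<Phi> w = finsum A (\<lambda>t. single (?J t) \<oplus> \<ominus> (h (\<Theta> (?J t)))) (insertions w)"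
    unfolding cobar_def
  proof (intro finsum_cong_on refl, clarify)
    fix us vs ws assume "(us, vs, ws) \<in> insertions w"
    from \<Phi>_eq[OF insertion_closed[OF this w]] show
      "\<Phi> (map neg_eps us @ [\<mu> vs] @ ws) = single (map neg_eps us @ [\<mu> vs] @ ws) \<oplus>
         \<ominus> (h (\<Theta> (map neg_eps us @ [\<mu> vs] @ ws)))"
      by (simp add: a_minus_def)
  qed
  also have "\<dots> = finsum A (\<lambda>t. single (?J t)) (insertions w) \<oplus> finsum A (\<lambda>t. \<ominus> (h (\<Theta> (?J t)))) (insertions w)"
    using s J by (intro finsum_addf) auto
  also have "finsum A (\<lambda>t. single (?J t)) (insertions w) = finsum A (\<lambda>t. single (?J t)) {([], w, [])}"
  proof (rule finsum_mono_neutral)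
    show "single (?J t) = \<zero>" if "t \<in> insertions w - {([], w, [])}" for t
      using that by (auto simp: insertions_def single_def append_eq_Cons_conv split: list.splits)
  next
    have m: "([], w, []) \<in> insertions w" using ne by (simp add: insertions_def)
    then show "{([], w, [])} \<subseteq> insertions w" by simp
    show "single (?J t) \<in> carrier A" if "t \<in> {([], w, [])}" for t using that m s[of t] by blast
  qed simp
  also have "\<dots> = \<mu> w" using w by (simp add: single_def)
  also have "finsum A (\<lambda>t. \<ominus> (h (\<Theta> (?J t)))) (insertions w) = \<ominus> (h (cobar \<Theta> w))"
    using J unfolding cobar_def by (simp add: h_finsum finsum_minus case_prod_unfold cong: finsum_cong_on)
  finally show ?thesis by (simp add: a_minus_def)
qed

text \<open>The block lies in one of the two factors of each product. If it lies in the right one,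
  all letters of the left factor carry \<open>neg_eps\<close>; by \<open>\<Phi>_neg_eps\<close> this
  becomes a second \<open>eps\<close> that cancels the one in \<open>\<Theta>\<close> and leaves the
  minus sign.\<close>

lemma cobar_\<Theta>:
  assumes w: "set w \<subseteq> carrier A"
  shows "cobar \<Theta> w = finsum A (\<lambda>(u, v). \<ominus> (\<Phi> u \<otimes> cobar \<Phi> v) \<oplus> eps (cobar \<Phi> u) \<otimes> \<Phi> v) (splits w)"
proof -
  let ?g1 = "\<lambda>a b vs ws. eps (\<Phi> (map neg_eps a)) \<otimes> \<Phi> (map neg_eps b @ [\<mu> vs] @ ws)"
  let ?g2 = "\<lambda>us vs a b. eps (\<Phi> (map neg_eps us @ [\<mu> vs] @ a)) \<otimes> \<Phi> b"
  have g1: "?g1 a b c e \<in> carrier A" if "a @ b @ c @ e = w" for a b c e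
  proof -
    have "set a \<subseteq> carrier A" "set b \<subseteq> carrier A" "set c \<subseteq> carrier A" "set e \<subseteq> carrier A" using that w by auto
    then show ?thesis by (auto intro!: m_closed eps_closed \<Phi>_closed)
  qed
  have g2: "?g2 a b c e \<in> carrier A" if "a @ b @ c @ e = w" for a b c e
  proof -
    have "set a \<subseteq> carrier A" "set b \<subseteq> carrier A" "set c \<subseteq> carrier A" "set e \<subseteq> carrier A" using that w by auto
    then show ?thesis by (auto intro!: m_closed eps_closed \<Phi>_closed)
  qed
  have split: "\<Theta> (map neg_eps us @ [\<mu> vs] @ ws) =
      finsum A (\<lambda>(a, b). ?g1 a b vs ws) {(a, b). a @ b = us \<and> a \<noteq> []} \<oplus>
      finsum A (\<lambda>(a, b). ?g2 us vs a b) {(a, b). a @ b = ws \<and> b \<noteq> []}"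
    if t: "(us, vs, ws) \<in> insertions w" for us vs ws
  proof -
    have "\<Theta> (map neg_eps us @ [\<mu> vs] @ ws) =
      finsum A (\<lambda>(a, b). eps (\<Phi> a) \<otimes> \<Phi> (b @ [\<mu> vs] @ ws)) {(a, b). a @ b = map neg_eps us \<and> a \<noteq> []} \<oplus>
      finsum A (\<lambda>(a, b). ?g2 us vs a b) {(a, b). a @ b = ws \<and> b \<noteq> []}"
      unfolding \<Theta>_def
      by (rule finsum_splits_insert) (use insertion_closed[OF t w] in \<open>auto simp del: set_append\<close>)
    also have "finsum A (\<lambda>(a, b). eps (\<Phi> a) \<otimes> \<Phi> (b @ [\<mu> vs] @ ws)) {(a, b). a @ b = map neg_eps us \<and> a \<noteq> []} =
       finsum A (\<lambda>(a, b). ?g1 a b vs ws) {(a, b). a @ b = us \<and> a \<noteq> []}"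
    \<comment> \<open>The inverse recovers the cut of \<open>us\<close> from the length of the first
      piece, since mapping preserves lengths.\<close>
    proof (rule finsum_witness[symmetric, where i = "\<lambda>(a, b). (map neg_eps a, map neg_eps b)"
            and j = "\<lambda>(a, b). (take (length a) us, drop (length a) us)"], goal_cases)
      case (1 s)
      then show ?case by (auto simp: take_map[symmetric] drop_map[symmetric] dest!: sym[where t = "map _ _"])
    next
      case (2 s)
      then show ?case using arg_cong[of "fst s @ snd s" "map neg_eps us" length] by auto
    next
      case (6 s)
      then have "fst s @ snd s = map neg_eps us" by auto
      from arg_cong[OF this, of set] have "set (fst s) \<subseteq> carrier A" "set (snd s) \<subseteq> carrier A"
        using insertion_closed[OF t w] by auto
      then show ?case using insertion_closed[OF t w] by (auto simp: case_prod_unfold intro!: m_closed eps_closed \<Phi>_closed)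
    qed auto
    finally show ?thesis .
  qed
  have i1: "finsum A (\<lambda>(a, b). ?g1 a b vs ws) {(a, b). a @ b = us \<and> a \<noteq> []} \<in> carrier A"
    and i2: "finsum A (\<lambda>(a, b). ?g2 us vs a b) {(a, b). a @ b = ws \<and> b \<noteq> []} \<in> carrier A"
    if t: "(us, vs, ws) \<in> insertions w" for us vs ws
    using insertionsD[OF t] by (auto intro!: finsum_closed g1 g2 simp del: map_append append.simps)
  have "cobar \<Theta> w = finsum A (\<lambda>(us, vs, ws). finsum A (\<lambda>(a, b). ?g1 a b vs ws) {(a, b). a @ b = us \<and> a \<noteq> []}) (insertions w) \<oplus>
      finsum A (\<lambda>(us, vs, ws). finsum A (\<lambda>(a, b). ?g2 us vs a b) {(a, b). a @ b = ws \<and> b \<noteq> []}) (insertions w)"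
  proof -
    have "cobar \<Theta> w = finsum A (\<lambda>t. (case t of (us, vs, ws) \<Rightarrow> finsum A (\<lambda>(a, b). ?g1 a b vs ws) {(a, b). a @ b = us \<and> a \<noteq> []}) \<oplus>
       (case t of (us, vs, ws) \<Rightarrow> finsum A (\<lambda>(a, b). ?g2 us vs a b) {(a, b). a @ b = ws \<and> b \<noteq> []})) (insertions w)"
      unfolding cobar_def 
    proof (rule finsum_cong_on[OF refl])
      fix t assume "t \<in> insertions w"
      moreover obtain us vs ws where "t = (us, vs, ws)" by (cases t) auto
      ultimately show "(case t of (us, vs, ws) \<Rightarrow> \<Theta> (map neg_eps us @ [\<mu> vs] @ ws)) =
         (case t of (us, vs, ws) \<Rightarrow> finsum A (\<lambda>(a, b). ?g1 a b vs ws) {(a, b). a @ b = us \<and> a \<noteq> []}) \<oplus>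
         (case t of (us, vs, ws) \<Rightarrow> finsum A (\<lambda>(a, b). ?g2 us vs a b) {(a, b). a @ b = ws \<and> b \<noteq> []})"
        using split[of us vs ws] by (simp only: prod.case)
    qed
    then show ?thesis
      by (subst (asm) finsum_addf) (use i1 i2 in \<open>auto simp only: Pi_def prod.case mem_Collect_eq split_paired_all\<close>)
  qed
  also have "finsum A (\<lambda>(us, vs, ws). finsum A (\<lambda>(a, b). ?g1 a b vs ws) {(a, b). a @ b = us \<and> a \<noteq> []}) (insertions w) =
     finsum A (\<lambda>(u, v). finsum A (\<lambda>(us, vs, ws). ?g1 u us vs ws) (insertions v)) (splits w)"
    by (rule finsum_insertions_left) (rule g1)
  also have "\<dots> = finsum A (\<lambda>(u, v). \<ominus> (\<Phi> u \<otimes> cobar \<Phi> v)) (splits w)"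
  proof (intro finsum_cong_on refl, clarify)
    fix u v assume uv: "(u, v) \<in> splits w"
    have c: "set u \<subseteq> carrier A" "set v \<subseteq> carrier A" using splitsD[OF uv] w by auto
    have "finsum A (\<lambda>(us, vs, ws). ?g1 u us vs ws) (insertions v) = eps (\<Phi> (map neg_eps u)) \<otimes> cobar \<Phi> v"
      unfolding cobar_def using insertion_closed[OF _ c(2)] c
      by (subst finsum_rdistr) (auto simp: Pi_def case_prod_unfold intro!: \<Phi>_closed)
    then show "finsum A (\<lambda>(us, vs, ws). ?g1 u us vs ws) (insertions v) = \<ominus> (\<Phi> u \<otimes> cobar \<Phi> v)"
      using c by (simp add: \<Phi>_neg_eps eps_minus l_minus)
  qed
  also have "finsum A (\<lambda>(us, vs, ws). finsum A (\<lambda>(a, b). ?g2 us vs a b) {(a, b). a @ b = ws \<and> b \<noteq> []}) (insertions w) =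
     finsum A (\<lambda>(u, v). finsum A (\<lambda>(us, vs, ws). ?g2 us vs ws v) (insertions u)) (splits w)"
    by (rule finsum_insertions_right) (rule g2)
  also have "\<dots> = finsum A (\<lambda>(u, v). eps (cobar \<Phi> u) \<otimes> \<Phi> v) (splits w)"
  proof (intro finsum_cong_on refl, clarify)
    fix u v assume uv: "(u, v) \<in> splits w"
    have c: "set u \<subseteq> carrier A" "set v \<subseteq> carrier A" using splitsD[OF uv] w by auto
    show "finsum A (\<lambda>(us, vs, ws). ?g2 us vs ws v) (insertions u) = eps (cobar \<Phi> u) \<otimes> \<Phi> v"
      unfolding cobar_def using insertion_closed[OF _ c(1)] c
      by (subst eps_finsum, force intro!: \<Phi>_closed, subst finsum_ldistr) (auto simp: Pi_def case_prod_unfold intro!: \<Phi>_closed)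
  qed
  finally show ?thesis
  proof (subst finsum_addf_pair, goal_cases)
    case (1 u v)
    then have "set u \<subseteq> carrier A" "set v \<subseteq> carrier A" using splitsD[of u v w] w by auto
    then show ?case by simp
  next
    case (2 u v)
    then have "set u \<subseteq> carrier A" "set v \<subseteq> carrier A" using splitsD[of u v w] w by auto
    then show ?case by simp
  qed
qed

text \<open>Both statements are proved together by induction on the length. For
  \<open>d_\<Theta>\<close> the Leibniz rule and the morphism relation on the two shorter pieces
  leave only threefold products, which cancel by associativity. The morphism relation for
  \<open>w\<close> then follows from the decomposition of \<open>\<Theta> w\<close> by the homotopy
  and from \<open>cobar_\<Phi>\<close>.\<close>

lemma \<Phi>_morphism: "set w \<subseteq> carrier H \<Longrightarrow> d (\<Phi> w) \<oplus> \<Theta> w = cobar \<Phi> w"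
  and d_\<Theta>: "set w \<subseteq> carrier H \<Longrightarrow> d (\<Theta> w) = \<ominus> (cobar \<Theta> w)"
proof (induction w rule: length_induct)
  case (1 w)
  have dT: "d (\<Theta> w) = \<ominus> (cobar \<Theta> w)" if wH: "set w \<subseteq> carrier H"
  proof -
    have w: "set w \<subseteq> carrier A" using wH by auto
    \<comment> \<open>Substituting the induction hypothesis for the two \<open>cobar \<Phi>\<close>
      terms cancels every product that contains a differential; only the terms with
      \<open>\<Theta>\<close> of one piece survive.\<close>
    have *: "d (eps (\<Phi> u) \<otimes> \<Phi> v) \<oplus> (\<ominus> (\<Phi> u \<otimes> cobar \<Phi> v) \<oplus> eps (cobar \<Phi> u) \<otimes> \<Phi> v) =
         eps (\<Theta> u) \<otimes> \<Phi> v \<oplus> \<ominus> (\<Phi> u \<otimes> \<Theta> v)" if uv: "(u, v) \<in> splits w" for u v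
    proof -
      have s: "set u \<subseteq> carrier A" "set v \<subseteq> carrier A" "set u \<subseteq> carrier H" "set v \<subseteq> carrier H"
        "length u < length w" "length v < length w"
        using splitsD[OF uv] wH by auto
      have IH: "d (\<Phi> u) \<oplus> \<Theta> u = cobar \<Phi> u" "d (\<Phi> v) \<oplus> \<Theta> v = cobar \<Phi> v" using 1 s by auto
      have c: "\<Phi> u \<in> carrier A" "\<Phi> v \<in> carrier A" "\<Theta> u \<in> carrier A" "\<Theta> v \<in> carrier A" using s by auto
      show ?thesis using c unfolding IH[symmetric]
        by (simp add: leibniz_eps d_eps l_distr r_distr l_minus r_minus minus_add a_ac r_neg1 r_neg2 r_neg l_neg)
    qed
    have cl: "\<ominus> (\<Phi> u \<otimes> cobar \<Phi> v) \<oplus> eps (cobar \<Phi> u) \<otimes> \<Phi> v \<in> carrier A" "\<Theta> u \<in> carrier A" "\<Theta> v \<in> carrier A"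
      if uv: "(u, v) \<in> splits w" for u v
    proof -
      have "set u \<subseteq> carrier A" "set v \<subseteq> carrier A" using splitsD[OF uv] w by auto
      then show "\<ominus> (\<Phi> u \<otimes> cobar \<Phi> v) \<oplus> eps (cobar \<Phi> u) \<otimes> \<Phi> v \<in> carrier A" "\<Theta> u \<in> carrier A" "\<Theta> v \<in> carrier A"
        by simp_all
    qed
    have "d (\<Theta> w) = finsum A (\<lambda>(u, v). d (eps (\<Phi> u) \<otimes> \<Phi> v)) (splits w)"
      unfolding \<Theta>_def by (subst d_finsum) (use w in \<open>auto simp: case_prod_unfold\<close>)
    then have "d (\<Theta> w) \<oplus> cobar \<Theta> w =
       finsum A (\<lambda>(u, v). d (eps (\<Phi> u) \<otimes> \<Phi> v) \<oplus> (\<ominus> (\<Phi> u \<otimes> cobar \<Phi> v) \<oplus> eps (cobar \<Phi> u) \<otimes> \<Phi> v)) (splits w)"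
      unfolding cobar_\<Theta>[OF w] using w cl by (subst finsum_addf_pair) auto
    also have "\<dots> = finsum A (\<lambda>(u, v). eps (\<Theta> u) \<otimes> \<Phi> v \<oplus> \<ominus> (\<Phi> u \<otimes> \<Theta> v)) (splits w)"
      by (intro finsum_cong_on refl, clarify) (rule *)
    also have "\<dots> = finsum A (\<lambda>(u, v). eps (\<Theta> u) \<otimes> \<Phi> v) (splits w) \<oplus> \<ominus> (finsum A (\<lambda>(u, v). \<Phi> u \<otimes> \<Theta> v) (splits w))"
      using w cl by (subst finsum_addf_pair, force, force, subst finsum_minus) (auto simp: case_prod_unfold)
    also have "finsum A (\<lambda>(u, v). eps (\<Theta> u) \<otimes> \<Phi> v) (splits w) =
       finsum A (\<lambda>(u, v). finsum A (\<lambda>(a, b). \<Phi> a \<otimes> (eps (\<Phi> b) \<otimes> \<Phi> v)) (splits u)) (splits w)"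
    proof (intro finsum_cong_on refl, clarify)
      fix u v assume uv: "(u, v) \<in> splits w"
      have s: "set u \<subseteq> carrier A" "set v \<subseteq> carrier A" using splitsD[OF uv] w by auto
      have "eps (\<Theta> u) \<otimes> \<Phi> v = finsum A (\<lambda>(a, b). (\<Phi> a \<otimes> eps (\<Phi> b)) \<otimes> \<Phi> v) (splits u)"
        unfolding \<Theta>_def using s
        by (subst eps_finsum, force, subst finsum_ldistr)
           (auto simp: Pi_def case_prod_unfold intro!: finsum_cong_on)
      also have "\<dots> = finsum A (\<lambda>(a, b). \<Phi> a \<otimes> (eps (\<Phi> b) \<otimes> \<Phi> v)) (splits u)"
        using s by (auto simp: m_assoc intro!: finsum_cong_on)
      finally show "eps (\<Theta> u) \<otimes> \<Phi> v = finsum A (\<lambda>(a, b). \<Phi> a \<otimes> (eps (\<Phi> b) \<otimes> \<Phi> v)) (splits u)" .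
    qed
    also have "finsum A (\<lambda>(u, v). \<Phi> u \<otimes> \<Theta> v) (splits w) =
       finsum A (\<lambda>(u, v). finsum A (\<lambda>(a, b). \<Phi> u \<otimes> (eps (\<Phi> a) \<otimes> \<Phi> b)) (splits v)) (splits w)"
    proof (intro finsum_cong_on refl, clarify)
      fix u v assume uv: "(u, v) \<in> splits w"
      have s: "set u \<subseteq> carrier A" "set v \<subseteq> carrier A" using splitsD[OF uv] w by auto
      show "\<Phi> u \<otimes> \<Theta> v = finsum A (\<lambda>(a, b). \<Phi> u \<otimes> (eps (\<Phi> a) \<otimes> \<Phi> b)) (splits v)"
        unfolding \<Theta>_def using s
        by (subst finsum_rdistr) (auto simp: Pi_def case_prod_unfold)
    qed
    \<comment> \<open>The same threefold products, once with the left piece cut again and once with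
      the right piece; the difference of the two sums is therefore zero.\<close>
    also have "finsum A (\<lambda>(u, v). finsum A (\<lambda>(a, b). \<Phi> a \<otimes> (eps (\<Phi> b) \<otimes> \<Phi> v)) (splits u)) (splits w) =
       finsum A (\<lambda>(u, v). finsum A (\<lambda>(a, b). \<Phi> u \<otimes> (eps (\<Phi> a) \<otimes> \<Phi> b)) (splits v)) (splits w)"
    proof (rule finsum_splits_assoc)
      fix a b c assume "a @ b @ c = w"
      then have "set a \<subseteq> carrier A" "set b \<subseteq> carrier A" "set c \<subseteq> carrier A" using w by auto
      then show "\<Phi> a \<otimes> (eps (\<Phi> b) \<otimes> \<Phi> c) \<in> carrier A" by simp
    qed
    finally have "d (\<Theta> w) \<oplus> cobar \<Theta> w = \<zero>"
    proof -
      have "finsum A (\<lambda>(u, v). finsum A (\<lambda>(a, b). \<Phi> u \<otimes> (eps (\<Phi> a) \<otimes> \<Phi> b)) (splits v)) (splits w) \<in> carrier A"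
      proof (intro finsum_closed Pi_I, clarify, intro finsum_closed Pi_I, clarify)
        fix u v a b assume uv: "(u, v) \<in> splits w" and ab: "(a, b) \<in> splits v"
        have "set u \<subseteq> carrier A" "set a \<subseteq> carrier A" "set b \<subseteq> carrier A"
          using splitsD[OF uv] splitsD[OF ab] w by auto
        then show "\<Phi> u \<otimes> (eps (\<Phi> a) \<otimes> \<Phi> b) \<in> carrier A" by simp
      qed
      moreover assume "d (\<Theta> w) \<oplus> cobar \<Theta> w =
        finsum A (\<lambda>(u, v). finsum A (\<lambda>(a, b). \<Phi> u \<otimes> (eps (\<Phi> a) \<otimes> \<Phi> b)) (splits v)) (splits w) \<oplus>
        \<ominus> finsum A (\<lambda>(u, v). finsum A (\<lambda>(a, b). \<Phi> u \<otimes> (eps (\<Phi> a) \<otimes> \<Phi> b)) (splits v)) (splits w)"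
      ultimately show ?thesis by (simp add: r_neg)
    qed
    then show ?thesis using w by (intro minus_equality[symmetric]) auto
  qed
  { case 1
    have w: "set w \<subseteq> carrier A" using 1 by auto
    \<comment> \<open>This is where the arguments must be harmonic: the linear part of
      \<open>\<Phi>\<close> takes closed values on them.\<close>
    have "d (single w) = \<zero>" using 1 by (auto simp: single_def split: list.splits)
    then have "d (\<Phi> w) \<oplus> \<Theta> w = \<ominus> (d (h (\<Theta> w))) \<oplus> \<Theta> w"
      using w single_closed[OF w] by (simp add: \<Phi>_eq[OF w] a_minus_def d_add d_minus)
    \<comment> \<open>The homotopy decomposition \<open>\<Theta> w = \<mu> w + d (h (\<Theta> w)) +
      h (d (\<Theta> w))\<close>.\<close>
    also have "\<dots> = \<mu> w \<oplus> h (d (\<Theta> w))"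
      using w by (simp add: \<mu>_def harmonic_proj_def a_minus_def minus_add a_ac add_cancel_middle)
    also have "\<dots> = \<mu> w \<ominus> h (cobar \<Theta> w)" using w dT[OF 1] by (simp add: h_minus a_minus_def)
    also have "\<dots> = cobar \<Phi> w"
      using cobar_\<Phi>[OF w] w by (cases "w = []") (auto simp: cobar_def a_minus_def)
    finally show ?case . }
  { case 2 then show ?case by (rule dT) }
qed

text \<open>The suspended Stasheff relation. It is the projection of \<open>d_\<Theta>\<close>: up
  to sign \<open>cobar \<Theta> w\<close> is exact, and \<open>pr\<close> kills exact
  elements.\<close>

lemma cobar_\<mu>:
  assumes wH: "set w \<subseteq> carrier H"
  shows "cobar \<mu> w = \<zero>"
proof -
  have w: "set w \<subseteq> carrier A" using wH by auto
  have "cobar \<mu> w = pr (cobar \<Theta> w)"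
    unfolding cobar_def \<mu>_def[abs_def]
    using insertion_closed[OF _ w] by (subst pr_finsum) (auto simp: case_prod_unfold \<mu>_def)
  also have "cobar \<Theta> w = \<ominus> (d (\<Theta> w))" using d_\<Theta>[OF wH] w by simp
  finally show ?thesis using w by (simp add: pr_minus)
qed

end

section \<open>Multilinearity, degrees and units\<close>

lemma linear_map_comp:
  "linear_map K U V f \<Longrightarrow> linear_map K V W g \<Longrightarrow> linear_map K U W (\<lambda>x. g (f x))"
  unfolding linear_map_def by (auto simp: Pi_iff)

lemma linear_map_cong:
  assumes f: "linear_map K U V f" and "module K U" and eq: "\<And>x. x \<in> carrier U \<Longrightarrow> f x = g x"
  shows "linear_map K U V g"
proof -
  interpret module K U by fact
  have "g x \<in> carrier V" if "x \<in> carrier U" for x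
    using linear_mapD(1)[OF f that] eq[OF that] by simp
  moreover have "g (x \<oplus>\<^bsub>U\<^esub> y) = g x \<oplus>\<^bsub>V\<^esub> g y" if "x \<in> carrier U" "y \<in> carrier U" for x y
    using linear_mapD(2)[OF f that] that by (simp add: eq[symmetric])
  moreover have "g (c \<odot>\<^bsub>U\<^esub> x) = c \<odot>\<^bsub>V\<^esub> g x" if "c \<in> carrier K" "x \<in> carrier U" for c x
    using linear_mapD(3)[OF f that] that by (simp add: eq[symmetric])
  ultimately show ?thesis unfolding linear_map_def by blast
qed

context graded_space
begin

lemma linear_map_id: "linear_map K V V (\<lambda>x. x)"
  by (simp add: linear_map_def)

lemma linear_map_minus: "linear_map K V V (\<lambda>x. \<ominus> x)"
  by (simp add: linear_map_def minus_add smult_r_minus a_comm)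

lemma linear_map_add:
  "linear_map K U V f \<Longrightarrow> linear_map K U V g \<Longrightarrow> linear_map K U V (\<lambda>x. f x \<oplus> g x)"
  unfolding linear_map_def by (auto simp: Pi_iff smult_r_distr a_ac)

lemma linear_map_zero: "linear_map K U V (\<lambda>x. \<zero>)"
  by (simp add: linear_map_def)

lemma linear_map_finsum:
  assumes "module K U" "\<And>i. i \<in> S \<Longrightarrow> linear_map K U V (f i)"
  shows "linear_map K U V (\<lambda>x. \<Oplus>i\<in>S. f i x)"
  using assms(2)
proof (induction S rule: infinite_finite_induct)
  case (insert i S)
  have *: "(\<Oplus>i\<in>insert i S. f i x) = f i x \<oplus> (\<Oplus>i\<in>S. f i x)" if "x \<in> carrier U" for x
    using insert that linear_mapD(1)
    by (subst finsum_insert) (auto simp: Pi_def dest: linear_mapD(1)[where x = x])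
  have "linear_map K U V (\<lambda>x. f i x \<oplus> (\<Oplus>i\<in>S. f i x))"
    using insert by (intro linear_map_add) auto
  then show ?case by (rule linear_map_cong) (use assms(1) * in auto)
qed (simp_all add: linear_map_zero finsum_infinite)

lemma linear_map_par:
  assumes "linear_map K V W f" "abelian_group W" "x \<in> carrier V"
  shows "f ([par e] \<cdot> x) = [par e] \<cdot>\<^bsub>W\<^esub> f x"
proof -
  interpret W: abelian_group W by fact
  have "f (\<ominus> x) = \<ominus>\<^bsub>W\<^esub> f x"
    by (rule additive_map_zero_minus(2)[of V W])
      (use assms linear_mapD[OF assms(1)] in \<open>auto simp: abelian_group_axioms\<close>)
  then show ?thesis using assms linear_mapD(1)[OF assms(1)] by (simp add: par_pow W.par_pow)
qed

end

context graded_comm_alg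
begin

lemma linear_map_mult_left:
  "linear_map K U A f \<Longrightarrow> c \<in> carrier A \<Longrightarrow> linear_map K U A (\<lambda>x. c \<otimes> f x)"
  unfolding linear_map_def by (auto simp: Pi_iff r_distr smult_mult_right)

lemma linear_map_mult_right:
  "linear_map K U A f \<Longrightarrow> c \<in> carrier A \<Longrightarrow> linear_map K U A (\<lambda>x. f x \<otimes> c)"
  unfolding linear_map_def by (auto simp: Pi_iff l_distr smult_mult_left)

end

lemma homog_list_append [simp]: "homog_list V (us @ vs) \<longleftrightarrow> homog_list V us \<and> homog_list V vs"
  by (auto simp: homog_list_def)

lemma homog_list_Cons [simp]: "homog_list V ((e, x) # ps) \<longleftrightarrow> x \<in> grade V e \<and> homog_list V ps"
  by (auto simp: homog_list_def)

lemma homog_list_Nil [simp]: "homog_list V []"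
  by (auto simp: homog_list_def)

lemma tdeg_append [simp]: "tdeg (us @ vs) = tdeg us + tdeg vs"
  and tdeg_Cons [simp]: "tdeg (p # us) = fst p + tdeg us" and tdeg_Nil [simp]: "tdeg [] = 0"
  by (simp_all add: tdeg_def)

lemma (in graded_space) homog_list_carrier: "homog_list V ps \<Longrightarrow> set (elts ps) \<subseteq> carrier V"
  by (auto simp: homog_list_def grade_carrier)

context contraction
begin

lemma linear_H: "linear_map K A W f \<Longrightarrow> linear_map K H W f"
  unfolding linear_map_def by (auto simp: Pi_iff)

lemma homog_list_H: "homog_list H ps \<Longrightarrow> homog_list A ps"
  by (auto simp: homog_list_def H_grade)

text \<open>After separating the cuts on either side of the variable letter, each product contains
  the variable in exactly one factor, which is linear by induction.\<close>

lemma multilinear_\<Phi>: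
  "set us \<subseteq> carrier A \<Longrightarrow> set vs \<subseteq> carrier A \<Longrightarrow> linear_map K A A (\<lambda>x. \<Phi> (us @ [x] @ vs))"
  and multilinear_\<Theta>:
  "set us \<subseteq> carrier A \<Longrightarrow> set vs \<subseteq> carrier A \<Longrightarrow> linear_map K A A (\<lambda>x. \<Theta> (us @ [x] @ vs))"
proof (induction "length us + length vs" arbitrary: us vs rule: less_induct)
  case less
  have th: "linear_map K A A (\<lambda>x. \<Theta> (us @ [x] @ vs))" if us: "set us \<subseteq> carrier A" and vs: "set vs \<subseteq> carrier A"
  proof -
    have 1: "linear_map K A A (\<lambda>x. eps (\<Phi> a) \<otimes> \<Phi> (b @ [x] @ vs))" if "us = a @ b" "a \<noteq> []" for a b
    proof (rule linear_map_mult_left)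
      show "linear_map K A A (\<lambda>x. \<Phi> (b @ [x] @ vs))" by (rule less(1)) (use that us vs in auto)
      show "eps (\<Phi> a) \<in> carrier A" using that us by (intro eps_closed \<Phi>_closed) auto
    qed
    have 2: "linear_map K A A (\<lambda>x. eps (\<Phi> (us @ [x] @ a)) \<otimes> \<Phi> b)" if "vs = a @ b" "b \<noteq> []" for a b
    proof (rule linear_map_mult_right)
      have "linear_map K A A (\<lambda>x. \<Phi> (us @ [x] @ a))" by (rule less(1)) (use that us vs in auto)
      then show "linear_map K A A (\<lambda>x. eps (\<Phi> (us @ [x] @ a)))" by (rule linear_map_comp) (rule eps_linear)
      show "\<Phi> b \<in> carrier A" using that vs by (intro \<Phi>_closed) auto
    qed
    have "linear_map K A A (\<lambda>x. (\<Oplus>p\<in>{(a, b). a @ b = us \<and> a \<noteq> []}. eps (\<Phi> (fst p)) \<otimes> \<Phi> (snd p @ [x] @ vs)) \<oplus>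
      (\<Oplus>p\<in>{(a, b). a @ b = vs \<and> b \<noteq> []}. eps (\<Phi> (us @ [x] @ fst p)) \<otimes> \<Phi> (snd p)))"
      by (intro linear_map_add linear_map_finsum module_axioms) (use 1 2 in auto)
    then show ?thesis
    proof (rule linear_map_cong[OF _ module_axioms])
      fix x assume x: "x \<in> carrier A"
      show "(\<Oplus>p\<in>{(a, b). a @ b = us \<and> a \<noteq> []}. eps (\<Phi> (fst p)) \<otimes> \<Phi> (snd p @ [x] @ vs)) \<oplus>
        (\<Oplus>p\<in>{(a, b). a @ b = vs \<and> b \<noteq> []}. eps (\<Phi> (us @ [x] @ fst p)) \<otimes> \<Phi> (snd p)) = \<Theta> (us @ [x] @ vs)"
        unfolding \<Theta>_def using us vs x
        by (subst finsum_splits_insert) (auto simp: case_prod_unfold intro!: m_closed eps_closed \<Phi>_splits)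
    qed
  qed
  { case 1
    show ?case
    proof (cases "us = [] \<and> vs = []")
      case True then show ?thesis by (simp add: linear_map_id)
    next
      case False
      have "linear_map K A A (\<lambda>x. \<ominus> (h (\<Theta> (us @ [x] @ vs))))"
        by (rule linear_map_comp[OF _ linear_map_minus], rule linear_map_comp[OF _ h_linear], rule th) fact+
      moreover have "2 \<le> length (us @ [x] @ vs)" for x using False by (cases us; cases vs) auto
      ultimately show ?thesis by (simp add: \<Phi>_long)
    qed }
  { case 2 then show ?case by (rule th) }
qed

lemma pr_linear: "linear_map K A A pr"
  by (simp add: linear_map_def pr_add pr_smult)

lemma multilinear_\<mu>:
  "set us \<subseteq> carrier A \<Longrightarrow> set vs \<subseteq> carrier A \<Longrightarrow> linear_map K A A (\<lambda>x. \<mu> (us @ [x] @ vs))"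
  unfolding \<mu>_def by (rule linear_map_comp[OF multilinear_\<Theta> pr_linear])

lemma \<Theta>_homog:
  assumes "homog_list A ps"
  shows "\<Theta> (elts ps) = finsum A (\<lambda>(us, vs). eps (\<Phi> (elts us)) \<otimes> \<Phi> (elts vs)) (splits ps)"
  unfolding \<Theta>_def
proof (rule finsum_splits_map)
  fix us vs assume "us @ vs = ps"
  then have "set (elts us) \<subseteq> carrier A" "set (elts vs) \<subseteq> carrier A"
    using homog_list_carrier[OF assms] \<open>us @ vs = ps\<close>[symmetric] by (simp_all add: image_Un)
  then show "eps (\<Phi> (elts us)) \<otimes> \<Phi> (elts vs) \<in> carrier A" by simp
qed

lemma \<Phi>_grade: "homog_list A ps \<Longrightarrow> \<Phi> (elts ps) \<in> grade A (tdeg ps + 1 - int (length ps))"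
  and \<Theta>_grade: "homog_list A ps \<Longrightarrow> \<Theta> (elts ps) \<in> grade A (tdeg ps + 2 - int (length ps))"
proof (induction ps rule: length_induct)
  case (1 ps)
  have th: "\<Theta> (elts ps) \<in> grade A (tdeg ps + 2 - int (length ps))" if ps: "homog_list A ps"
    unfolding \<Theta>_homog[OF ps]
  proof (rule grade_finsum, clarify)
    fix us vs assume uv: "(us, vs) \<in> splits ps"
    have s: "length us < length ps" "length vs < length ps" "homog_list A us" "homog_list A vs" "ps = us @ vs"
      using splitsD[OF uv] ps by auto
    then have "eps (\<Phi> (elts us)) \<in> grade A (tdeg us + 1 - int (length us))"
      "\<Phi> (elts vs) \<in> grade A (tdeg vs + 1 - int (length vs))"
      using 1 by (auto intro: eps_grade)
    from mult_grade[OF this] show "eps (\<Phi> (elts us)) \<otimes> \<Phi> (elts vs) \<in> grade A (tdeg ps + 2 - int (length ps))"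
      using s(5) by (simp add: algebra_simps)
  qed
  { case 1
    show ?case
    proof -
      consider "ps = []" | p where "ps = [p]" | "2 \<le> length ps" by (cases ps; cases "tl ps") auto
      then show ?thesis
      proof cases
        case 2 then show ?thesis using 1 by (cases p) auto
      next
        case 3
      have "h (\<Theta> (elts ps)) \<in> grade A (tdeg ps + 2 - int (length ps) - 1)" by (rule h_grade[OF th[OF 1]])
      moreover have "\<Phi> (elts ps) = \<ominus> (h (\<Theta> (elts ps)))" using 3 by (intro \<Phi>_long) auto
      ultimately show ?thesis using grade_minus by (simp add: algebra_simps)
      qed auto
    qed }
  { case 2 then show ?case by (rule th) }
qed

lemma \<mu>_grade: "homog_list A ps \<Longrightarrow> \<mu> (elts ps) \<in> grade A (tdeg ps + 2 - int (length ps))"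
  unfolding \<mu>_def by (intro pr_grade \<Theta>_grade)

lemma h_\<Phi>: "set w \<subseteq> carrier H \<Longrightarrow> h (\<Phi> w) = \<zero>"
  by (cases w rule: \<Phi>.cases) (auto simp: \<Phi>_long h_minus)

lemma pr_\<Phi>: "set w \<subseteq> carrier H \<Longrightarrow> 2 \<le> length w \<Longrightarrow> pr (\<Phi> w) = \<zero>"
  by (auto simp: \<Phi>_long pr_minus)

text \<open>If the unit sits in a factor of length at least two, that factor vanishes by induction.
  Otherwise one factor is the unit itself, and the product is the other factor up to
  \<open>eps\<close>. All values of \<open>\<Phi>\<close> on harmonic words are killed by
  \<open>h\<close>; with at least three letters the other factor has length at least two, so it is a
  value of \<open>h\<close> and is killed by \<open>pr\<close> as well.\<close>

lemma \<Phi>_unit: "set w \<subseteq> carrier H \<Longrightarrow> \<one> \<in> set w \<Longrightarrow> 2 \<le> length w \<Longrightarrow> \<Phi> w = \<zero>"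
  and \<mu>_unit: "set w \<subseteq> carrier H \<Longrightarrow> \<one> \<in> set w \<Longrightarrow> 3 \<le> length w \<Longrightarrow> \<mu> w = \<zero>"
proof (induction w rule: length_induct)
  case (1 w)
  have trm: "h (eps (\<Phi> u) \<otimes> \<Phi> v) = \<zero> \<and> (3 \<le> length w \<longrightarrow> pr (eps (\<Phi> u) \<otimes> \<Phi> v) = \<zero>)"
    if w: "set w \<subseteq> carrier H" "\<one> \<in> set w" and uv: "(u, v) \<in> splits w" for u v
  proof -
    have s: "set u \<subseteq> carrier H" "set v \<subseteq> carrier H" "length u < length w" "length v < length w"
      "w = u @ v" "u \<noteq> []" "v \<noteq> []"
      using splitsD[OF uv] w by auto
    have c: "\<Phi> u \<in> carrier A" "\<Phi> v \<in> carrier A" using s by auto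
    consider "\<one> \<in> set u" "2 \<le> length u" | "\<one> \<in> set v" "2 \<le> length v" | "u = [\<one>]" | "v = [\<one>]"
      using s w by (cases u rule: \<Phi>.cases; cases v rule: \<Phi>.cases) auto
    then show ?thesis
    proof cases
      case 1 then have "\<Phi> u = \<zero>" using \<open>\<forall>ys. _\<close> s by blast
      then show ?thesis using c by simp
    next
      case 2 then have "\<Phi> v = \<zero>" using \<open>\<forall>ys. _\<close> s by blast
      then show ?thesis using c by simp
    next
      case 3 then show ?thesis using c s h_\<Phi>[of v] pr_\<Phi>[of v] by auto
    next
      case 4 then show ?thesis using c s h_\<Phi>[of u] pr_\<Phi>[of u] by (auto simp: h_eps pr_eps)
    qed
  qed
  { case 1
    have "h (\<Theta> w) = \<zero>" unfolding \<Theta>_def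
      using 1 trm by (subst h_finsum) (auto simp: case_prod_unfold intro!: finsum_all_zero)
    then show ?case using 1 by (simp add: \<Phi>_long) }
  { case 2
    then show ?case unfolding \<Theta>_def \<mu>_def
      using trm by (subst pr_finsum) (auto simp: case_prod_unfold intro!: finsum_all_zero) }
qed

lemma \<mu>_pair: "x \<in> carrier A \<Longrightarrow> y \<in> carrier A \<Longrightarrow> \<mu> [x, y] = pr (eps x \<otimes> y)"
proof -
  assume "x \<in> carrier A" "y \<in> carrier A"
  moreover have "splits [x, y] = {([x], [y])}" by (auto simp: splits_def append_eq_Cons_conv)
  ultimately show ?thesis by (simp add: \<mu>_def \<Theta>_def)
qed

section \<open>Decalage\<close>

text \<open>Passes between the suspended and the unsuspended sign convention: on homogeneous arguments of
  degrees \<open>e\<^sub>1, \<dots>, e\<^sub>k\<close> it produces the sign with exponent \<open>(k-1) e\<^sub>1 + (k-2) e\<^sub>2 + \<dots> + e\<^bsub>k-1\<^esub>\<close>.\<close>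

fun decalage :: "'a list \<Rightarrow> 'a list" where
  "decalage [] = []"
| "decalage (x # xs) = (eps ^^ length xs) x # decalage xs"

end

fun dec_sign :: "int list \<Rightarrow> int" where
  "dec_sign [] = 0"
| "dec_sign (e # es) = int (length es) * e + dec_sign es"

lemma dec_sign_append: "dec_sign (es @ fs) = dec_sign es + int (length fs) * sum_list es + dec_sign fs"
  by (induction es) (auto simp: algebra_simps)

context contraction
begin

lemma eps_pow_closed [simp]: "x \<in> carrier A \<Longrightarrow> (eps ^^ n) x \<in> carrier A"
  and eps_pow_H [simp]: "x \<in> carrier H \<Longrightarrow> (eps ^^ n) x \<in> carrier H"
  by (induction n) auto

lemma eps_pow_linear: "linear_map K A A (eps ^^ n)"
proof (induction n)
  case 0 then show ?case by (simp add: linear_map_id id_def)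
next
  case (Suc n) then show ?case using linear_map_comp[OF Suc eps_linear] by (simp add: comp_def)
qed

lemma eps_pow_homog: "x \<in> grade A e \<Longrightarrow> (eps ^^ n) x = [par (int n * e)] \<cdot> x"
proof (induction n)
  case 0 then show ?case using grade_carrier by (simp add: int_pow_pm1)
next
  case (Suc n)
  then show ?case using grade_par[of x e "int n * e"] grade_carrier[of x e]
    by (simp add: eps_homog[of _ e] par_pow_par_pow algebra_simps)
qed

lemma eps_pow_one [simp]: "(eps ^^ n) \<one> = \<one>"
  by (induction n) auto

lemma decalage_append: "decalage (us @ vs) = map (eps ^^ length vs) (decalage us) @ decalage vs"
proof (induction us)
  case (Cons x us)
  have "(eps ^^ (length us + length vs)) x = (eps ^^ length vs) ((eps ^^ length us) x)"
    by (subst add.commute) (simp add: funpow_add)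
  with Cons show ?case by simp
qed simp

lemma length_decalage [simp]: "length (decalage xs) = length xs"
  by (induction xs) auto

lemma decalage_closed [simp]: "set xs \<subseteq> carrier A \<Longrightarrow> set (decalage xs) \<subseteq> carrier A"
  and decalage_H [simp]: "set xs \<subseteq> carrier H \<Longrightarrow> set (decalage xs) \<subseteq> carrier H"
  by (induction xs) auto

lemma decalage_unit: "\<one> \<in> set xs \<Longrightarrow> \<one> \<in> set (decalage xs)"
  by (induction xs) auto

text \<open>The transferred morphism, and in \<open>m_min\<close> the transferred operations, in the
  unsuspended sign convention used by \<open>insertion_sum\<close> and
  \<open>composition_sum\<close>.\<close>

definition f_min :: "'a list \<Rightarrow> 'a" where "f_min xs = \<Phi> (decalage xs)"

definition m_min :: "'a list \<Rightarrow> 'a" where "m_min xs = \<mu> (decalage xs)"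

definition multilin :: "('a list \<Rightarrow> 'a) \<Rightarrow> bool" where
  "multilin g \<longleftrightarrow> (\<forall>us vs. set us \<subseteq> carrier A \<longrightarrow> set vs \<subseteq> carrier A \<longrightarrow> linear_map K A A (\<lambda>x. g (us @ [x] @ vs)))"

lemma multilin_\<Phi>: "multilin \<Phi>" and multilin_\<mu>: "multilin \<mu>"
  using multilinear_\<Phi> multilinear_\<mu> by (auto simp: multilin_def)

lemma multilinD:
  "multilin g \<Longrightarrow> set us \<subseteq> carrier A \<Longrightarrow> set vs \<subseteq> carrier A \<Longrightarrow> linear_map K A A (\<lambda>x. g (us @ [x] @ vs))"
  unfolding multilin_def by blast

lemma multilin_decalage:
  assumes g: "multilin g" and us: "set us \<subseteq> carrier A" and vs: "set vs \<subseteq> carrier A"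
  shows "linear_map K A A (\<lambda>x. g (decalage (us @ [x] @ vs)))"
proof -
  have "linear_map K A A (\<lambda>x. g (map (eps ^^ Suc (length vs)) (decalage us) @ [x] @ decalage vs))"
    using eps_pow_closed[of _ "Suc (length vs)"] decalage_closed[OF us] decalage_closed[OF vs]
    by (intro multilinD[OF g]) (auto simp del: funpow.simps)
  from linear_map_comp[OF eps_pow_linear[of "length vs"] this] show ?thesis
    by (simp add: decalage_append)
qed

lemma multilin_par:
  assumes "multilin g" "set us \<subseteq> carrier A" "set vs \<subseteq> carrier A" "x \<in> carrier A"
  shows "g (us @ [[par e] \<cdot> x] @ vs) = [par e] \<cdot> g (us @ [x] @ vs)"
  using assms linear_map_par[of A "\<lambda>x. g (us @ [x] @ vs)" x e] multilinD[OF assms(1-3)]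
  by (simp add: abelian_group_axioms)

lemma multilin_closed:
  assumes "multilin g" "set us \<subseteq> carrier A" "us \<noteq> []" shows "g us \<in> carrier A"
proof -
  obtain x vs where "us = [] @ [x] @ vs" using assms(3) by (cases us) auto
  then show ?thesis
    using assms linear_mapD(1)[OF multilinD[OF assms(1), of "[]" vs], of x] by auto
qed

lemma multilin_signs:
  assumes g: "multilin g"
    and "\<And>e x. (e, x) \<in> set ps \<Longrightarrow> x \<in> grade A e \<Longrightarrow> f x = [par (s e)] \<cdot> x"
    and "homog_list A ps" "set us \<subseteq> carrier A" "set vs \<subseteq> carrier A" "us @ ps' @ vs \<noteq> []" "ps' = map snd ps"
  shows "g (us @ map f (elts ps) @ vs) = [par (\<Sum>p\<leftarrow>ps. s (fst p))] \<cdot> g (us @ elts ps @ vs)"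
  using assms(2-)
proof (induction ps arbitrary: us ps')
  case Nil
  then show ?case using multilin_closed[OF g, of "us @ vs"] by (simp add: int_pow_pm1)
next
  case (Cons p ps)
  obtain e x where p: "p = (e, x)" by (cases p)
  have x: "x \<in> grade A e" "x \<in> carrier A" and c: "set (elts ps) \<subseteq> carrier A"
    using Cons.prems(2) p homog_list_carrier grade_carrier by auto
  have fx: "f x = [par (s e)] \<cdot> x" and fc: "f x \<in> carrier A" using Cons.prems(1)[of e x] x p by auto
  have "g (us @ map f (elts (p # ps)) @ vs) = g ((us @ [f x]) @ map f (elts ps) @ vs)" by (simp add: p)
  also have "\<dots> = [par (\<Sum>p\<leftarrow>ps. s (fst p))] \<cdot> g ((us @ [f x]) @ elts ps @ vs)"
    using Cons.prems x fc p by (intro Cons.IH[of _ "elts ps"]) (auto simp: par_pow_closed)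
  also have "g ((us @ [f x]) @ elts ps @ vs) = [par (s e)] \<cdot> g (us @ [x] @ (elts ps @ vs))"
    unfolding fx using multilin_par[OF g, of us "elts ps @ vs" x "s e"] Cons.prems c x by simp
  finally show ?case
    using multilin_closed[OF g, of "us @ [x] @ elts ps @ vs"] Cons.prems c x
    by (simp add: p par_pow_par_pow add.commute)
qed

lemma multilin_decalage_homog:
  assumes g: "multilin g" "homog_list A ps" "set us \<subseteq> carrier A" "us @ elts ps \<noteq> []"
  shows "g (us @ decalage (elts ps)) = [par (dec_sign (map fst ps))] \<cdot> g (us @ elts ps)"
  using assms(2-)
proof (induction ps arbitrary: us)
  case Nil
  then show ?case using multilin_closed[OF g(1), of us] by (simp add: int_pow_pm1)
next
  case (Cons p ps)
  obtain e x where p: "p = (e, x)" by (cases p)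
  have x: "x \<in> grade A e" "x \<in> carrier A" and c: "set (elts ps) \<subseteq> carrier A" and ps: "homog_list A ps"
    using Cons.prems(1) p homog_list_carrier grade_carrier by auto
  have "g (us @ decalage (elts (p # ps))) = g ((us @ [(eps ^^ length ps) x]) @ decalage (elts ps))" by (simp add: p)
  also have "\<dots> = [par (dec_sign (map fst ps))] \<cdot> g (us @ [(eps ^^ length ps) x] @ elts ps)"
    using Cons.prems x ps by (subst Cons.IH) auto
  also have "g (us @ [(eps ^^ length ps) x] @ elts ps) = [par (int (length ps) * e)] \<cdot> g (us @ [x] @ elts ps)"
    unfolding eps_pow_homog[OF x(1)] using multilin_par[OF g(1)] Cons.prems c x by simp
  finally show ?case
    using multilin_closed[OF g(1), of "us @ [x] @ elts ps"] Cons.prems c x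
    by (simp add: p par_pow_par_pow add.commute)
qed

lemma f_min_homog:
  "homog_list A ps \<Longrightarrow> ps \<noteq> [] \<Longrightarrow> f_min (elts ps) = [par (dec_sign (map fst ps))] \<cdot> \<Phi> (elts ps)"
  and m_min_homog:
  "homog_list A ps \<Longrightarrow> ps \<noteq> [] \<Longrightarrow> m_min (elts ps) = [par (dec_sign (map fst ps))] \<cdot> \<mu> (elts ps)"
  unfolding f_min_def m_min_def
  using multilin_decalage_homog[OF multilin_\<Phi>, of ps "[]"] multilin_decalage_homog[OF multilin_\<mu>, of ps "[]"] by auto

end

text \<open>Turns a comparison of two signs into a polynomial identity exhibiting half the
  difference of the exponents.\<close>

lemma par_eqI2: "a - b = 2 * c \<Longrightarrow> par a = par b"
  by (rule par_eqI) simp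

lemma (in abelian_monoid) finsum_insertions_map:
  assumes "\<And>us vs ws. us @ vs @ ws = w \<Longrightarrow> vs \<noteq> [] \<Longrightarrow> g (map f us) (map f vs) (map f ws) \<in> carrier G"
  shows "finsum G (\<lambda>(us, vs, ws). g us vs ws) (insertions (map f w)) =
    finsum G (\<lambda>(us, vs, ws). g (map f us) (map f vs) (map f ws)) (insertions w)"
proof -
  let ?m = "\<lambda>(us, vs, ws). (map f us, map f vs, map f ws)"
  have "bij_betw ?m (insertions w) (insertions (map f w))"
  proof (rule bij_betwI')
    fix p q assume pq: "p \<in> insertions w" "q \<in> insertions w"
    obtain us vs ws us' vs' ws' where e: "p = (us, vs, ws)" "q = (us', vs', ws')" by (cases p; cases q) auto
    have "p = q" if "?m p = ?m q"
    proof -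
      have l: "length us = length us'" "length vs = length vs'"
        using that e by (auto dest: map_eq_imp_length_eq)
      have "us @ vs @ ws = us' @ vs' @ ws'" using pq e by (auto simp: insertions_def)
      then show ?thesis using l e by simp
    qed
    then show "(?m p = ?m q) = (p = q)" by blast
  next
    fix q assume "q \<in> insertions (map f w)"
    then obtain u v x where q: "q = (u, v, x)" "map f w = u @ v @ x" "v \<noteq> []" by (auto simp: insertions_def)
    then obtain u' v' x' where "w = u' @ v' @ x'" "map f u' = u" "map f v' = v" "map f x' = x"
      by (auto simp: map_eq_append_conv append_eq_map_conv)
    then show "\<exists>p\<in>insertions w. q = ?m p"
      using q by (intro bexI[where x = "(u', v', x')"]) (auto simp: insertions_def)
  qed (auto simp: insertions_def)
  moreover have "(\<lambda>(us, vs, ws). g us vs ws) \<in> insertions (map f w) \<rightarrow> carrier G"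
  proof (intro Pi_I, clarify)
    fix u v x assume "(u, v, x) \<in> insertions (map f w)"
    then have q: "map f w = u @ v @ x" "v \<noteq> []" by (auto simp: insertions_def)
    then obtain u' v' x' where "w = u' @ v' @ x'" "map f u' = u" "map f v' = v" "map f x' = x"
      by (auto simp: map_eq_append_conv append_eq_map_conv)
    then show "g u v x \<in> carrier G" using assms[of u' v' x'] q by auto
  qed
  ultimately show ?thesis
    by (subst finsum_bij) (auto simp: case_prod_unfold)
qed

text \<open>The blocks are nonempty factors of \<open>ps\<close>, of which there are finitely many,
  and there are at most \<open>length ps\<close> of them.\<close>

lemma finite_compositions: "finite {pss. concat pss = ps \<and> [] \<notin> set pss}"
proof (rule finite_subset)
  let ?B = "(\<lambda>(us, vs, ws). vs) ` insertions ps"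
  show "{pss. concat pss = ps \<and> [] \<notin> set pss} \<subseteq> {pss. set pss \<subseteq> ?B \<and> length pss \<le> length ps}"
  proof clarify
    fix pss :: "'b list list" assume ne: "[] \<notin> set pss"
    have "length pss \<le> length (concat pss)" using ne
    proof (induction pss)
      case (Cons qs pss) then show ?case by (cases qs) auto
    qed simp
    moreover have "qs \<in> (\<lambda>(us, vs, ws). vs) ` insertions (concat pss)" if "qs \<in> set pss" for qs
    proof -
      obtain xss yss where "pss = xss @ qs # yss" using split_list[OF \<open>qs \<in> set pss\<close>] by blast
      then have "(concat xss, qs, concat yss) \<in> insertions (concat pss)"
        using that ne by (auto simp: insertions_def)
      then show ?thesis by force
    qed
    ultimately show "set pss \<subseteq> (\<lambda>(us, vs, ws). vs) ` insertions (concat pss) \<and> length pss \<le> length (concat pss)" by auto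
  qed
  show "finite {pss. set pss \<subseteq> ?B \<and> length pss \<le> length ps}"
    by (intro finite_lists_length_le finite_imageI finite_insertions)
qed

section \<open>The relations in the unsuspended sign convention\<close>

context contraction
begin

lemma neg_eps_homog: "x \<in> grade A e \<Longrightarrow> neg_eps x = [par (e - 1)] \<cdot> x"
  using grade_carrier by (auto simp: neg_eps_def eps_homog par_pow)

lemma sum_list_fst_minus_1: "(\<Sum>p\<leftarrow>ps. fst p - 1) = tdeg ps - int (length ps)"
  by (induction ps) auto

lemma m_min_grade:
  assumes "homog_list A ps" "ps \<noteq> []"
  shows "m_min (elts ps) \<in> grade A (tdeg ps + 2 - int (length ps))"
  using m_min_homog[OF assms] \<mu>_grade[OF assms(1)] grade_par by simp

lemma f_min_grade:
  assumes "homog_list A ps" "ps \<noteq> []"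
  shows "f_min (elts ps) \<in> grade A (tdeg ps + 1 - int (length ps))"
  using f_min_homog[OF assms] \<Phi>_grade[OF assms(1)] grade_par by simp

text \<open>Three signs occur in a term: the explicit one, that of decalage on the inner block, and
  that of decalage on the outer word, whose marked letter has the degree of the inner value. Modulo
  2 they add up to the decalage exponent of all of \<open>ps\<close> plus the exponent that
  \<open>neg_eps\<close> contributes on \<open>us\<close>. The lemma is applied to
  \<open>\<Phi>\<close> for the morphism relation and to \<open>\<mu>\<close> for the Stasheff
  relation.\<close>

lemma insertion_sum_cobar:
  assumes g: "multilin g" and ps: "homog_list A ps"
  shows "insertion_sum A (\<lambda>xs. g (decalage xs)) m_min ps = [par (dec_sign (map fst ps))] \<cdot> cobar g (elts ps)"
proof -
  have c: "set (elts ps) \<subseteq> carrier A" using homog_list_carrier[OF ps] .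
  have trm: "[par (int (length us) + int (length vs) * int (length ws) + (2 - int (length vs)) * tdeg us)] \<cdot>
        g (decalage (elts us @ [m_min (elts vs)] @ elts ws)) =
      [par (dec_sign (map fst ps))] \<cdot> g (map neg_eps (elts us) @ [\<mu> (elts vs)] @ elts ws)"
    "g (map neg_eps (elts us) @ [\<mu> (elts vs)] @ elts ws) \<in> carrier A"
    if t: "us @ vs @ ws = ps" "vs \<noteq> []" for us vs ws
  proof -
    have hl: "homog_list A us" "homog_list A vs" "homog_list A ws" using ps t by auto
    note cl = homog_list_carrier[OF hl(1)] homog_list_carrier[OF hl(2)] homog_list_carrier[OF hl(3)]
    let ?e = "tdeg vs + 2 - int (length vs)"
    let ?y = "\<mu> (elts vs)" and ?y' = "m_min (elts vs)"
    have y: "?y' \<in> grade A ?e" "?y' \<in> carrier A" "?y \<in> carrier A" "?y' = [par (dec_sign (map fst vs))] \<cdot> ?y"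
      using m_min_grade[OF hl(2) t(2)] grade_carrier \<mu>_closed[OF cl(2)] m_min_homog[OF hl(2) t(2)] by auto
    have gc: "g (elts us @ [?y] @ elts ws) \<in> carrier A"
      using cl y by (intro multilin_closed[OF g]) auto
    have "g (decalage (elts us @ [?y'] @ elts ws)) = g ([] @ decalage (elts (us @ (?e, ?y') # ws)))" by simp
    also have "\<dots> = [par (dec_sign (map fst (us @ (?e, ?y') # ws)))] \<cdot> g ([] @ elts (us @ (?e, ?y') # ws))"
      using hl y by (intro multilin_decalage_homog[OF g]) auto
    also have "g ([] @ elts (us @ (?e, ?y') # ws)) = g (elts us @ [[par (dec_sign (map fst vs))] \<cdot> ?y] @ elts ws)"
      using y(4) by simp
    also have "\<dots> = [par (dec_sign (map fst vs))] \<cdot> g (elts us @ [?y] @ elts ws)"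
      by (rule multilin_par[OF g cl(1,3) y(3)])
    finally have L: "g (decalage (elts us @ [?y'] @ elts ws)) =
       [par (dec_sign (map fst (us @ (?e, ?y') # ws)) + dec_sign (map fst vs))] \<cdot> g (elts us @ [?y] @ elts ws)"
      using gc by (simp add: par_pow_par_pow)
    have "g ([] @ map neg_eps (elts us) @ ([?y] @ elts ws)) =
        [par (\<Sum>p\<leftarrow>us. fst p - 1)] \<cdot> g ([] @ elts us @ ([?y] @ elts ws))"
      using cl y hl by (intro multilin_signs[OF g, where s = "\<lambda>e. e - 1"]) (auto simp: neg_eps_homog)
    then have R: "g (map neg_eps (elts us) @ [?y] @ elts ws) =
       [par (tdeg us - int (length us))] \<cdot> g (elts us @ [?y] @ elts ws)" by (simp add: sum_list_fst_minus_1)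
    show "g (map neg_eps (elts us) @ [?y] @ elts ws) \<in> carrier A" unfolding R using gc by simp
    have td: "tdeg qs = sum_list (map fst qs)" for qs :: "(int \<times> 'a) list" by (simp add: tdeg_def)
    \<comment> \<open>The right side doubles what is left after the decalage exponents are expanded
      along \<open>us @ vs @ ws\<close>.\<close>
    have "(int (length us) + int (length vs) * int (length ws) + (2 - int (length vs)) * tdeg us +
         (dec_sign (map fst (us @ (?e, ?y') # ws)) + dec_sign (map fst vs))) -
       (dec_sign (map fst ps) + (tdeg us - int (length us))) =
       2 * (int (length us) + tdeg us - int (length vs) * tdeg us + int (length ws))"
      unfolding t(1)[symmetric] by (simp add: dec_sign_append td algebra_simps)
    then have "par (int (length us) + int (length vs) * int (length ws) + (2 - int (length vs)) * tdeg us +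
         (dec_sign (map fst (us @ (?e, ?y') # ws)) + dec_sign (map fst vs))) =
       par (dec_sign (map fst ps) + (tdeg us - int (length us)))" by (rule par_eqI2)
    then show "[par (int (length us) + int (length vs) * int (length ws) + (2 - int (length vs)) * tdeg us)] \<cdot>
        g (decalage (elts us @ [m_min (elts vs)] @ elts ws)) =
      [par (dec_sign (map fst ps))] \<cdot> g (map neg_eps (elts us) @ [?y] @ elts ws)"
      unfolding L R using gc by (simp add: par_pow_par_pow)
  qed
  have "insertion_sum A (\<lambda>xs. g (decalage xs)) m_min ps =
     finsum A (\<lambda>(us, vs, ws). [par (dec_sign (map fst ps))] \<cdot> g (map neg_eps (elts us) @ [\<mu> (elts vs)] @ elts ws)) (insertions ps)"
    unfolding insertion_sum_def insertions_def[symmetric]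
    by (intro finsum_cong_on refl, clarify, rule trm(1)) (auto simp: insertions_def)
  also have "\<dots> = [par (dec_sign (map fst ps))] \<cdot> finsum A (\<lambda>(us, vs, ws). g (map neg_eps (elts us) @ [\<mu> (elts vs)] @ elts ws)) (insertions ps)"
  proof (subst par_pow_finsum)
    fix t assume "t \<in> insertions ps"
    moreover obtain us vs ws where t: "t = (us, vs, ws)" by (cases t)
    ultimately show "(case t of (us, vs, ws) \<Rightarrow> g (map neg_eps (elts us) @ [\<mu> (elts vs)] @ elts ws)) \<in> carrier A"
      using trm(2)[of us vs ws] by (simp add: insertions_def)
  qed (simp add: case_prod_unfold)
  also have "finsum A (\<lambda>(us, vs, ws). g (map neg_eps (elts us) @ [\<mu> (elts vs)] @ elts ws)) (insertions ps) = cobar g (elts ps)"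
    unfolding cobar_def by (rule finsum_insertions_map[symmetric]) (use trm(2) in auto)
  finally show ?thesis .
qed

text \<open>The terms of \<open>composition_sum\<close> with exactly two blocks, for the product of
  \<open>A\<close>. For two blocks of lengths i and j the exponent there reduces to i - 1 plus (1 -
  j) times the degree of the first block; since it involves degrees, the argument is a labelled
  word.\<close>

definition p_min :: "(int \<times> 'a) list \<Rightarrow> 'a" where
  "p_min ps = finsum A (\<lambda>(us, vs). [par (int (length us) - 1 + (1 - int (length vs)) * tdeg us)] \<cdot>
     (f_min (elts us) \<otimes> f_min (elts vs))) (splits ps)"

lemma f_min_closed [simp]: "set xs \<subseteq> carrier A \<Longrightarrow> f_min xs \<in> carrier A"
  by (simp add: f_min_def)

lemma m_min_H [simp]: "set xs \<subseteq> carrier A \<Longrightarrow> m_min xs \<in> carrier H"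
  by (simp add: m_min_def)

text \<open>The sign of the suspended product is \<open>eps\<close> on the first factor, whose
  degree is known from \<open>\<Phi>_grade\<close>. Together with the decalage signs of the two
  pieces it matches the explicit sign modulo 2.\<close>

lemma p_min_\<Theta>:
  assumes ps: "homog_list A ps"
  shows "p_min ps = [par (dec_sign (map fst ps))] \<cdot> \<Theta> (elts ps)"
proof -
  have trm: "[par (int (length us) - 1 + (1 - int (length vs)) * tdeg us)] \<cdot> (f_min (elts us) \<otimes> f_min (elts vs)) =
     [par (dec_sign (map fst ps))] \<cdot> (eps (\<Phi> (elts us)) \<otimes> \<Phi> (elts vs))"
    "eps (\<Phi> (elts us)) \<otimes> \<Phi> (elts vs) \<in> carrier A" if t: "(us, vs) \<in> splits ps" for us vs
  proof -
    note s = splitsD[OF t]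
    have hl: "homog_list A us" "homog_list A vs" using ps s by auto
    note cl = homog_list_carrier[OF hl(1)] homog_list_carrier[OF hl(2)]
    have c: "\<Phi> (elts us) \<in> carrier A" "\<Phi> (elts vs) \<in> carrier A" using cl by auto
    then show "eps (\<Phi> (elts us)) \<otimes> \<Phi> (elts vs) \<in> carrier A" by simp
    have td: "tdeg qs = sum_list (map fst qs)" for qs :: "(int \<times> 'a) list" by (simp add: tdeg_def)
    have mm: "([par a] \<cdot> x) \<otimes> ([par b] \<cdot> y) = [par (a + b)] \<cdot> (x \<otimes> y)" if "x \<in> carrier A" "y \<in> carrier A" for a b x y
      using that by (auto simp: par_pow l_minus r_minus)
    have "int (length us) - 1 + (1 - int (length vs)) * tdeg us + (dec_sign (map fst us) + dec_sign (map fst vs)) -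
       (dec_sign (map fst ps) + (tdeg us + 1 - int (length us))) = 2 * (int (length us) - 1 - int (length vs) * tdeg us)"
      unfolding s(5) by (simp add: dec_sign_append td algebra_simps)
    then have sg: "par (int (length us) - 1 + (1 - int (length vs)) * tdeg us + (dec_sign (map fst us) + dec_sign (map fst vs))) =
       par (dec_sign (map fst ps) + (tdeg us + 1 - int (length us)))" by (rule par_eqI2)
    have "eps (\<Phi> (elts us)) \<otimes> \<Phi> (elts vs) = [par (tdeg us + 1 - int (length us))] \<cdot> (\<Phi> (elts us) \<otimes> \<Phi> (elts vs))"
      unfolding eps_homog[OF \<Phi>_grade[OF hl(1)]] using mm[OF c, of _ 0] c by (simp add: int_pow_pm1)
    then show "[par (int (length us) - 1 + (1 - int (length vs)) * tdeg us)] \<cdot> (f_min (elts us) \<otimes> f_min (elts vs)) =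
     [par (dec_sign (map fst ps))] \<cdot> (eps (\<Phi> (elts us)) \<otimes> \<Phi> (elts vs))"
      unfolding f_min_homog[OF hl(1) s(6)] f_min_homog[OF hl(2) s(7)]
      using c sg by (simp add: mm par_pow_par_pow)
  qed
  have "p_min ps = finsum A (\<lambda>p. [par (dec_sign (map fst ps))] \<cdot> (eps (\<Phi> (elts (fst p))) \<otimes> \<Phi> (elts (snd p)))) (splits ps)"
    unfolding p_min_def case_prod_unfold by (intro finsum_cong_on refl trm(1)) auto
  also have "\<dots> = [par (dec_sign (map fst ps))] \<cdot> \<Theta> (elts ps)"
    unfolding \<Theta>_homog[OF ps] case_prod_unfold by (rule par_pow_finsum[symmetric]) (use trm(2) in auto)
  finally show ?thesis .
qed

lemma p_min_closed: "homog_list A ps \<Longrightarrow> p_min ps \<in> carrier A"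
  using \<Theta>_closed[OF homog_list_carrier, of ps] by (simp add: p_min_\<Theta>)

lemma m_min_p_min: "homog_list A ps \<Longrightarrow> ps \<noteq> [] \<Longrightarrow> m_min (elts ps) = pr (p_min ps)"
  using \<Theta>_closed[OF homog_list_carrier, of ps] by (simp add: m_min_homog p_min_\<Theta> pr_par \<mu>_def)

lemma f_min_p_min:
  assumes ps: "homog_list A ps" and "2 \<le> length ps"
  shows "f_min (elts ps) = \<ominus> (h (p_min ps))"
proof -
  have "ps \<noteq> []" using assms(2) by auto
  then show ?thesis
    using assms \<Theta>_closed[OF homog_list_carrier[OF ps]]
    by (simp add: f_min_homog p_min_\<Theta> h_par \<Phi>_long par_pow_minus)
qed

text \<open>A DGCA has no operations of arity three or more, so only the compositions with one
  block, giving the differential, and with two blocks, giving \<open>p_min\<close>,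
  contribute.\<close>

lemma composition_sum_f_min:
  assumes ps: "homog_list A ps" "ps \<noteq> []"
  shows "composition_sum A (dgca_ops A d) f_min ps = d (f_min (elts ps)) \<oplus> p_min ps"
proof -
  let ?S = "{pss. concat pss = ps \<and> [] \<notin> set pss}"
  let ?D = "(\<lambda>(us, vs). [us, vs]) ` splits ps"
  define t where "t = (\<lambda>pss. [par ((\<Sum>j<length pss. (int (length pss) - 1 - int j) * (int (length (pss ! j)) - 1))
              + (\<Sum>j<length pss. (1 - int (length (pss ! j))) * tdeg (concat (take j pss))))] \<cdot>
        dgca_ops A d (map (\<lambda>qs. f_min (elts qs)) pss))"
  have sub: "{[ps]} \<union> ?D \<subseteq> ?S" using ps(2) by (auto simp: splits_def)
  have t1: "t [ps] = d (f_min (elts ps))"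
    using homog_list_carrier[OF ps(1)] by (simp add: t_def int_pow_pm1)
  have t2: "t [us, vs] = [par (int (length us) - 1 + (1 - int (length vs)) * tdeg us)] \<cdot> (f_min (elts us) \<otimes> f_min (elts vs))"
    for us vs by (simp add: t_def lessThan_Suc)
  have t2c: "t [us, vs] \<in> carrier A" if "(us, vs) \<in> splits ps" for us vs
  proof -
    have "homog_list A us" "homog_list A vs" using splitsD[OF that] ps by auto
    then show ?thesis unfolding t2 using homog_list_carrier by (intro par_pow_closed m_closed f_min_closed)
  qed
  have t3: "t pss = \<zero>" if "pss \<in> ?S - ({[ps]} \<union> ?D)" for pss
  proof -
    have "pss \<noteq> []" using that ps(2) by auto
    then consider qs where "pss = [qs]" | us vs where "pss = [us, vs]" | us vs ws wss where "pss = us # vs # ws # wss"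
      by (cases pss rule: remdups_adj.cases; cases "tl (tl pss)") auto
    then show ?thesis
    proof cases
      case 2 then show ?thesis using that by (auto simp: splits_def)
    next
      case 3 then show ?thesis by (simp add: t_def)
    qed (use that in auto)
  qed
  have "composition_sum A (dgca_ops A d) f_min ps = finsum A t ?S"
    by (simp add: composition_sum_def t_def)
  also have "\<dots> = finsum A t ({[ps]} \<union> ?D)"
    by (rule finsum_mono_neutral[OF finite_compositions sub t3])
      (use t1 t2c homog_list_carrier[OF ps(1)] in auto)
  also have "\<dots> = finsum A t {[ps]} \<oplus> finsum A t ?D"
    using t1 t2c homog_list_carrier[OF ps(1)] by (intro finsum_Un_disjoint) auto
  also have "finsum A t ?D = finsum A (\<lambda>p. t [fst p, snd p]) (splits ps)"
    using t2c by (subst finsum_reindex) (auto simp: inj_on_def case_prod_unfold)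
  also have "\<dots> = p_min ps" unfolding p_min_def t2 by (simp add: case_prod_unfold)
  also have "finsum A t {[ps]} = d (f_min (elts ps))" using t1 homog_list_carrier[OF ps(1)] by simp
  finally show ?thesis .
qed

lemma f_min_morphism:
  assumes ps: "homog_list H ps" "ps \<noteq> []"
  shows "insertion_sum A f_min m_min ps = composition_sum A (dgca_ops A d) f_min ps"
proof -
  have psA: "homog_list A ps" using homog_list_H ps(1) .
  have c: "set (elts ps) \<subseteq> carrier H" using H.homog_list_carrier[OF ps(1)] .
  have cA: "\<Phi> (elts ps) \<in> carrier A" "\<Theta> (elts ps) \<in> carrier A"
    by (rule \<Phi>_closed[OF homog_list_carrier[OF psA]], rule \<Theta>_closed[OF homog_list_carrier[OF psA]])
  have "insertion_sum A f_min m_min ps = [par (dec_sign (map fst ps))] \<cdot> cobar \<Phi> (elts ps)"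
    using insertion_sum_cobar[OF multilin_\<Phi> psA] by (simp add: f_min_def[abs_def])
  also have "\<dots> = [par (dec_sign (map fst ps))] \<cdot> (d (\<Phi> (elts ps)) \<oplus> \<Theta> (elts ps))"
    using \<Phi>_morphism[OF c] by simp
  also have "\<dots> = d (f_min (elts ps)) \<oplus> p_min ps"
    unfolding f_min_homog[OF psA ps(2)] p_min_\<Theta>[OF psA] using cA by (simp add: par_pow d_minus minus_add a_comm)
  finally show ?thesis using composition_sum_f_min[OF psA ps(2)] by simp
qed

lemma stasheff_m_min: "stasheff H m_min"
  unfolding stasheff_def
proof (intro allI impI, elim conjE)
  fix ps assume ps: "ps \<noteq> []" "homog_list H ps"
  have psA: "homog_list A ps" using homog_list_H ps(2) .
  have c: "set (elts ps) \<subseteq> carrier H" using H.homog_list_carrier[OF ps(2)] .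
  let ?s = "\<lambda>(us :: (int \<times> 'a) list, vs :: (int \<times> 'a) list, ws :: (int \<times> 'a) list).
     int (length us) + int (length vs) * int (length ws) + (2 - int (length vs)) * tdeg us"
  let ?t = "\<lambda>(us, vs, ws). m_min (elts us @ [m_min (elts vs)] @ elts ws)"
  have tH: "?t t \<in> carrier H" if "t \<in> insertions ps" for t
  proof -
    obtain us vs ws where t: "t = (us, vs, ws)" by (cases t)
    have "homog_list A us" "homog_list A vs" "homog_list A ws" using that t psA by (auto simp: insertions_def)
    note cl = this[THEN homog_list_carrier]
    have "m_min (elts us @ [m_min (elts vs)] @ elts ws) \<in> carrier H"
      using cl H_closed[OF m_min_H[OF cl(2)]] by (intro m_min_H) simp
    then show ?thesis by (simp only: t prod.case)
  qed
  have "insertion_sum H m_min m_min ps = finsum H (\<lambda>t. [par (?s t)] \<cdot>\<^bsub>H\<^esub> ?t t) (insertions ps)"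
    unfolding insertion_sum_def insertions_def by (simp add: case_prod_unfold)
  also have "\<dots> = finsum H (\<lambda>t. [par (?s t)] \<cdot> ?t t) (insertions ps)"
    using tH by (intro finsum_cong_on refl H_par)
  also have "\<dots> = finsum A (\<lambda>t. [par (?s t)] \<cdot> ?t t) (insertions ps)"
    using tH by (intro H_finsum par_H)
  also have "\<dots> = insertion_sum A m_min m_min ps"
    unfolding insertion_sum_def insertions_def by (simp add: case_prod_unfold)
  also have "\<dots> = [par (dec_sign (map fst ps))] \<cdot> cobar \<mu> (elts ps)"
    using insertion_sum_cobar[OF multilin_\<mu> psA] by (simp add: m_min_def[abs_def])
  finally show "insertion_sum H m_min m_min ps = \<zero>\<^bsub>H\<^esub>"
    using cobar_\<mu>[OF c] by simp
qed

section \<open>Linearity, degrees and unit laws of the transferred structure\<close>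

lemma multilinear_maps_m_min: "multilinear_maps K H H m_min"
  unfolding multilinear_maps_def
proof (intro ballI)
  fix us vs assume "us \<in> lists (carrier H)" "vs \<in> lists (carrier H)"
  then have c: "set us \<subseteq> carrier A" "set vs \<subseteq> carrier A" by (auto simp: in_lists_conv_set)
  have lin: "linear_map K H A (\<lambda>x. m_min (us @ [x] @ vs))"
    unfolding m_min_def by (rule linear_H[OF multilin_decalage[OF multilin_\<mu> c]])
  moreover have "m_min (us @ [x] @ vs) \<in> carrier H" if "x \<in> carrier H" for x
    using c that by (intro m_min_H) auto
  ultimately show "linear_map K H H (\<lambda>x. m_min (us @ [x] @ vs))"
    by (auto simp: linear_map_def)
qed

lemma multilinear_maps_f_min: "multilinear_maps K H A f_min"
  unfolding multilinear_maps_def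
proof (intro ballI)
  fix us vs assume "us \<in> lists (carrier H)" "vs \<in> lists (carrier H)"
  then have c: "set us \<subseteq> carrier A" "set vs \<subseteq> carrier A" by (auto simp: in_lists_conv_set)
  show "linear_map K H A (\<lambda>x. f_min (us @ [x] @ vs))"
    unfolding f_min_def by (rule linear_H[OF multilin_decalage[OF multilin_\<Phi> c]])
qed

lemma has_degrees_m_min: "has_degrees H H 2 m_min"
  unfolding has_degrees_def
proof (intro allI impI, elim conjE)
  fix ps assume "ps \<noteq> []" "homog_list H ps"
  then show "m_min (elts ps) \<in> grade H (tdeg ps + 2 - int (length ps))"
    using m_min_grade[OF homog_list_H] homog_list_carrier[OF homog_list_H] by (simp add: H_grade)
qed

lemma has_degrees_f_min: "has_degrees H A 1 f_min"
  unfolding has_degrees_def using f_min_grade[OF homog_list_H] by blast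

lemma m_min_unit: "set xs \<subseteq> carrier H \<Longrightarrow> \<one> \<in> set xs \<Longrightarrow> 3 \<le> length xs \<Longrightarrow> m_min xs = \<zero>"
  unfolding m_min_def by (rule \<mu>_unit) (auto intro: decalage_unit)

lemma f_min_unit: "set xs \<subseteq> carrier H \<Longrightarrow> \<one> \<in> set xs \<Longrightarrow> 2 \<le> length xs \<Longrightarrow> f_min xs = \<zero>"
  unfolding f_min_def by (rule \<Phi>_unit) (auto intro: decalage_unit)

lemma m_min_single [simp]: "m_min [x] = \<zero>" and f_min_single [simp]: "f_min [x] = x"
  by (simp_all add: m_min_def f_min_def)

lemma m_min_pair: "x \<in> carrier A \<Longrightarrow> y \<in> carrier A \<Longrightarrow> m_min [x, y] = pr (x \<otimes> y)"
  by (simp add: m_min_def \<mu>_pair)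

end

section \<open>Shuffles\<close>

text \<open>Exponent of the sign for exchanging two words in a signed shuffle: the Koszul exponent
  of their total degrees plus the exponent of the sign of the block permutation.\<close>

definition cross :: "(int \<times> 'b) list \<Rightarrow> (int \<times> 'b) list \<Rightarrow> int" where
  "cross u v = tdeg u * tdeg v + int (length u) * int (length v)"

text \<open>The cycle that moves position i to position i + m and shifts the m positions in between
  down by one.\<close>

definition cyc :: "nat \<Rightarrow> nat \<Rightarrow> nat \<Rightarrow> nat" where
  "cyc i m x = (if x = i then i + m else if i < x \<and> x \<le> i + m then x - 1 else x)"

lemma cyc_0: "cyc i 0 = id"
  by (auto simp: cyc_def fun_eq_iff)

lemma cyc_Suc: "cyc i (Suc m) = transpose (i + m) (Suc (i + m)) \<circ> cyc i m"
  by (auto simp: cyc_def fun_eq_iff transpose_def)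

lemma cyc_permutes: "i + m < k \<Longrightarrow> cyc i m permutes {..<k}"
proof (induction m)
  case (Suc m)
  then show ?case unfolding cyc_Suc
    by (intro permutes_compose permutes_swap_id) auto
qed (simp add: cyc_0 permutes_id)

lemma sign_cyc: "sign (cyc i m) = (-1) ^ m"
proof (induction m)
  case (Suc m)
  have "permutation (cyc i m)"
    by (rule permutes_imp_permutation[OF _ cyc_permutes[of i m "Suc (i + m)"]]) auto
  with Suc show ?case unfolding cyc_Suc
    by (subst sign_compose) (auto simp: permutation_swap_id sign_swap_id)
qed (simp add: cyc_0 sign_id)

section \<open>Shuffle permutations and their signs, taken apart at the last letter\<close>

lemma finite_shuffle_perms [simp]: "finite (shuffle_perms i k)"
  by (rule finite_subset[OF _ finite_permutations[of "{..<k}"]]) (auto simp: shuffle_perms_def)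

text \<open>Strict monotonicity gives \<open>x \<le> \<sigma> x\<close> for all x below k. As a
  permutation preserves the sum of all positions, no inequality can be strict.\<close>

lemma strict_mono_permutes_id:
  fixes k :: nat
  assumes p: "\<sigma> permutes {..<k}" and m: "strict_mono_on {..<k} \<sigma>"
  shows "\<sigma> = id"
proof -
  have le: "x \<le> \<sigma> x" if "x < k" for x
    using that
  proof (induct x)
    case (Suc x)
    then have "\<sigma> x < \<sigma> (Suc x)" using m by (auto simp: strict_mono_on_def)
    then show ?case using Suc by simp
  qed simp
  have "\<sigma> x = x" if "x < k" for x
  proof (rule ccontr)
    assume "\<sigma> x \<noteq> x"
    then have "(\<Sum>x<k. x) < (\<Sum>x<k. \<sigma> x)"
      using le[OF that] that by (intro sum_strict_mono_ex1) (auto intro: le intro!: bexI[of _ x])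
    moreover have "(\<Sum>x<k. x) = (\<Sum>x<k. \<sigma> x)" using sum.permute[OF p, of "\<lambda>x. x"] by (simp add: comp_def)
    ultimately show False by simp
  qed
  moreover have "\<sigma> x = x" if "\<not> x < k" for x using p that by (simp add: permutes_def)
  ultimately show ?thesis by (auto simp: fun_eq_iff)
qed

lemma shuffle_perms_0: "shuffle_perms 0 k = {id}" and shuffle_perms_all: "shuffle_perms k k = {id}"
  using strict_mono_permutes_id[of _ k]
  by (auto simp: shuffle_perms_def permutes_id strict_mono_on_def lessThan_atLeast0)

lemma koszul_sign_id [simp]: "koszul_sign id es = 1"
  unfolding koszul_sign_def by (rule prod.neutral) auto

text \<open>A shuffle is increasing on each block, so only the last letter of a block, at index i or
  at index i + j + 1, can be sent to the last position.\<close>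

lemma shuffle_perms_last_cases:
  assumes s: "\<sigma> \<in> shuffle_perms (Suc i) (Suc (Suc (i + j)))"
  shows "\<sigma> (Suc (i + j)) = Suc (i + j) \<or> \<sigma> i = Suc (i + j)"
proof -
  let ?k = "Suc (i + j)"
  have p: "\<sigma> permutes {..<Suc ?k}" and m1: "strict_mono_on {..<Suc i} \<sigma>" and m2: "strict_mono_on {Suc i..<Suc ?k} \<sigma>"
    using s by (auto simp: shuffle_perms_def)
  obtain x where x: "\<sigma> x = ?k" using permutes_surj[OF p] by (metis surj_def)
  then have xk: "x < Suc ?k" using permutes_in_image[OF p, of x] by simp
  have lt: "\<sigma> y < Suc ?k" if "y < Suc ?k" for y using permutes_in_image[OF p, of y] that by simp
  consider "x < i" | "x = i" | "i < x" "x < ?k" | "x = ?k" using xk by linarith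
  then show ?thesis
  proof cases
    case 1
    then have "\<sigma> x < \<sigma> i" using m1 by (auto simp: strict_mono_on_def)
    then show ?thesis using lt[of i] x by simp
  next
    case 3
    then have "\<sigma> x < \<sigma> ?k" using m2 by (auto simp: strict_mono_on_def)
    then show ?thesis using lt[of ?k] x by simp
  qed (use x in auto)
qed

lemma shuffle_perms_fix_last:
  "{\<sigma> \<in> shuffle_perms (Suc i) (Suc (Suc (i + j))). \<sigma> (Suc (i + j)) = Suc (i + j)} = shuffle_perms (Suc i) (Suc (i + j))"
proof -
  let ?k = "Suc (i + j)"
  have eq: "\<sigma> permutes {..<Suc ?k} \<and> \<sigma> ?k = ?k \<longleftrightarrow> \<sigma> permutes {..<?k}" for \<sigma>
  proof
    assume a: "\<sigma> permutes {..<Suc ?k} \<and> \<sigma> ?k = ?k"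
    show "\<sigma> permutes {..<?k}"
      by (rule permutes_superset[of _ "{..<Suc ?k}"]) (use a in \<open>auto simp: less_Suc_eq\<close>)
  next
    assume a: "\<sigma> permutes {..<?k}"
    then show "\<sigma> permutes {..<Suc ?k} \<and> \<sigma> ?k = ?k"
      by (auto intro: permutes_subset simp: permutes_not_in)
  qed
  have mono: "strict_mono_on {Suc i..<Suc ?k} \<sigma> \<longleftrightarrow> strict_mono_on {Suc i..<?k} \<sigma>" if "\<sigma> permutes {..<?k}" for \<sigma>
  proof -
    have "\<sigma> ?k = ?k" using that by (simp add: permutes_not_in)
    moreover have "\<sigma> x < ?k" if "x < ?k" for x using permutes_in_image[OF \<open>\<sigma> permutes {..<?k}\<close>, of x] that by simp
    ultimately show ?thesis by (auto simp: strict_mono_on_def less_Suc_eq)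
  qed
  show ?thesis using eq mono by (auto simp: shuffle_perms_def)
qed

lemma cyc_inj: "inj (cyc i m)"
  using permutes_inj[OF cyc_permutes[of i m "Suc (i + m)"]] by simp

lemma cyc_mono: "x \<noteq> i \<Longrightarrow> y \<noteq> i \<Longrightarrow> x < y \<Longrightarrow> cyc i m x < cyc i m y"
  by (auto simp: cyc_def)

lemma cyc_mono_iff: "x \<noteq> i \<Longrightarrow> y \<noteq> i \<Longrightarrow> cyc i m x < cyc i m y \<longleftrightarrow> x < y"
  using cyc_mono[of x i y m] cyc_mono[of y i x m] by (cases x y rule: linorder_cases) auto

text \<open>If the last letter of the first block goes to the end, the shuffle factors as follows:
  first move this letter past the whole second block, which has j + 1 letters, and then shuffle the
  remaining letters while the last position stays fixed.\<close>

lemma shuffle_perms_move_last: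
  "bij_betw (\<lambda>\<sigma>. \<sigma> \<circ> cyc i (Suc j)) (shuffle_perms i (Suc (i + j)))
     {\<sigma> \<in> shuffle_perms (Suc i) (Suc (Suc (i + j))). \<sigma> i = Suc (i + j)}"
proof -
  let ?k = "Suc (i + j)" and ?c = "cyc i (Suc j)"
  have cp: "?c permutes {..<Suc ?k}" by (rule cyc_permutes) simp
  have ci: "?c i = ?k" by (simp add: cyc_def)
  show ?thesis
  proof (rule bij_betw_byWitness[where f' = "\<lambda>\<sigma>. \<sigma> \<circ> inv_into UNIV ?c"])
    show "\<forall>\<sigma>\<in>shuffle_perms i ?k. (\<sigma> \<circ> ?c) \<circ> inv_into UNIV ?c = \<sigma>"
      by (simp add: comp_assoc permutes_inv_o(1)[OF cp])
    show "\<forall>\<sigma>\<in>{\<sigma> \<in> shuffle_perms (Suc i) (Suc ?k). \<sigma> i = ?k}. (\<sigma> \<circ> inv_into UNIV ?c) \<circ> ?c = \<sigma>"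
      by (simp add: comp_assoc permutes_inv_o(2)[OF cp])
    show "(\<lambda>\<sigma>. \<sigma> \<circ> ?c) ` shuffle_perms i ?k \<subseteq> {\<sigma> \<in> shuffle_perms (Suc i) (Suc ?k). \<sigma> i = ?k}"
    proof clarify
      fix \<sigma> assume s: "\<sigma> \<in> shuffle_perms i ?k"
      then have p: "\<sigma> permutes {..<?k}" and m1: "strict_mono_on {..<i} \<sigma>" and m2: "strict_mono_on {i..<?k} \<sigma>"
        by (auto simp: shuffle_perms_def)
      have k: "\<sigma> ?k = ?k" using p by (simp add: permutes_not_in)
      have lt: "\<sigma> x < ?k" if "x < ?k" for x using permutes_in_image[OF p, of x] that by simp
      have "\<sigma> \<circ> ?c permutes {..<Suc ?k}"
        using p cp by (intro permutes_compose) (auto intro: permutes_subset)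
      moreover have "strict_mono_on {..<Suc i} (\<sigma> \<circ> ?c)"
        using m1 k lt by (auto simp: strict_mono_on_def cyc_def less_Suc_eq)
      moreover have "strict_mono_on {Suc i..<Suc ?k} (\<sigma> \<circ> ?c)"
      proof (rule strict_mono_onI)
        fix r s assume "r \<in> {Suc i..<Suc ?k}" "s \<in> {Suc i..<Suc ?k}" "r < s"
        then show "(\<sigma> \<circ> ?c) r < (\<sigma> \<circ> ?c) s"
          using strict_mono_onD[OF m2, of "r - 1" "s - 1"] by (auto simp: cyc_def)
      qed
      ultimately show "\<sigma> \<circ> ?c \<in> shuffle_perms (Suc i) (Suc ?k) \<and> (\<sigma> \<circ> ?c) i = ?k"
        using ci k by (simp add: shuffle_perms_def)
    qed
    show "(\<lambda>\<sigma>. \<sigma> \<circ> inv_into UNIV ?c) ` {\<sigma> \<in> shuffle_perms (Suc i) (Suc ?k). \<sigma> i = ?k} \<subseteq> shuffle_perms i ?k"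
    proof clarify
      fix \<sigma> assume s: "\<sigma> \<in> shuffle_perms (Suc i) (Suc ?k)" and si: "\<sigma> i = ?k"
      then have p: "\<sigma> permutes {..<Suc ?k}" and m1: "strict_mono_on {..<Suc i} \<sigma>" and m2: "strict_mono_on {Suc i..<Suc ?k} \<sigma>"
        by (auto simp: shuffle_perms_def)
      have ic: "inv_into UNIV ?c x = (if x < i then x else if x < ?k then Suc x else if x = ?k then i else x)" for x
        by (rule inv_f_eq[OF cyc_inj]) (auto simp: cyc_def)
      have "\<sigma> \<circ> inv_into UNIV ?c permutes {..<Suc ?k}"
        by (intro permutes_compose permutes_inv cp p)
      then have "\<sigma> \<circ> inv_into UNIV ?c permutes {..<?k}"
        by (rule permutes_superset) (auto simp: less_Suc_eq ic si)
      moreover have "strict_mono_on {..<i} (\<sigma> \<circ> inv_into UNIV ?c)"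
        using m1 by (auto simp: strict_mono_on_def ic)
      moreover have "strict_mono_on {i..<?k} (\<sigma> \<circ> inv_into UNIV ?c)"
        using m2 by (auto simp: strict_mono_on_def ic)
      ultimately show "\<sigma> \<circ> inv_into UNIV ?c \<in> shuffle_perms i ?k" by (simp add: shuffle_perms_def)
    qed
  qed
qed

lemma koszul_sign_fix_last:
  assumes p: "\<sigma> permutes {..<length es}"
  shows "koszul_sign \<sigma> (es @ [e]) = koszul_sign \<sigma> es"
proof -
  have lt: "\<sigma> x < length es" if "x < length es" for x using permutes_in_image[OF p, of x] that by simp
  have k: "\<sigma> (length es) = length es" using p by (simp add: permutes_not_in)
  have "{(a, b). a < b \<and> b < length (es @ [e]) \<and> \<sigma> b < \<sigma> a} = {(a, b). a < b \<and> b < length es \<and> \<sigma> b < \<sigma> a}"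
  proof -
    have "\<not> \<sigma> (length es) < \<sigma> a" if "a < length es" for a using lt[OF that] k by simp
    then show ?thesis by (auto simp: less_Suc_eq)
  qed
  then show ?thesis unfolding koszul_sign_def
    by (rule prod.cong) (clarsimp simp: nth_append)
qed

lemma prod_par: "finite S \<Longrightarrow> (\<Prod>x\<in>S. par (f x)) = par (\<Sum>x\<in>S. f x)"
  by (induction S rule: finite_induct) (auto simp: par_add)

text \<open>The inversions fall into two classes. The letter \<open>e\<close>, sent to the last
  position, is inverted with every letter of \<open>fs\<close>, which gives the first factor.
  Inversions not involving it correspond under the cycle, which is increasing on the other
  positions, to the inversions of \<open>\<sigma>\<close>.\<close>

lemma koszul_sign_move_last:
  assumes p: "\<sigma> permutes {..<length (es @ fs)}"
  shows "koszul_sign (\<sigma> \<circ> cyc (length es) (length fs)) (es @ e # fs) = par (e * sum_list fs) * koszul_sign \<sigma> (es @ fs)"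
proof -
  let ?i = "length es" and ?k = "length (es @ fs)" and ?c = "cyc (length es) (length fs)"
  let ?\<tau> = "\<sigma> \<circ> ?c" and ?l = "es @ e # fs"
  have lt: "\<sigma> x < ?k" if "x < ?k" for x using permutes_in_image[OF p, of x] that by simp
  have k: "\<sigma> ?k = ?k" using p by (rule permutes_not_in) simp
  have ti: "?\<tau> ?i = ?k" using k by (simp add: cyc_def)
  have cl: "?c x < ?k" if "x \<noteq> ?i" "x < Suc ?k" for x using that by (auto simp: cyc_def)
  let ?I = "{(a, b). a < b \<and> b < length ?l \<and> ?\<tau> b < ?\<tau> a}"
  let ?I1 = "Pair ?i ` {Suc ?i..<Suc ?k}" and ?I2 = "{(a, b). a \<noteq> ?i \<and> b \<noteq> ?i \<and> a < b \<and> b < length ?l \<and> ?\<tau> b < ?\<tau> a}"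
  have I: "?I = ?I1 \<union> ?I2"
  proof (intro equalityI subrelI)
    fix a b assume ab: "(a, b) \<in> ?I"
    have "b \<noteq> ?i"
    proof
      assume "b = ?i"
      moreover have "?\<tau> a < ?k" using ab \<open>b = ?i\<close> cl[of a] lt[of "?c a"] by auto
      ultimately show False using ab ti by auto
    qed
    then show "(a, b) \<in> ?I1 \<union> ?I2" using ab by auto
  next
    fix a b assume "(a, b) \<in> ?I1 \<union> ?I2"
    moreover have "?\<tau> b < ?k" if "?i < b" "b < Suc ?k" using that cl[of b] lt[of "?c b"] by auto
    ultimately show "(a, b) \<in> ?I" using ti by (auto simp del: comp_apply)
  qed
  have fin: "finite ?I2" by (rule finite_subset[of _ "{..<length ?l} \<times> {..<length ?l}"]) auto
  have "koszul_sign ?\<tau> ?l = (\<Prod>(a, b)\<in>?I1. par (?l ! a * ?l ! b)) * (\<Prod>(a, b)\<in>?I2. par (?l ! a * ?l ! b))"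
    unfolding koszul_sign_def I by (rule prod.union_disjoint) (use fin in auto)
  also have "(\<Prod>(a, b)\<in>?I1. par (?l ! a * ?l ! b)) = (\<Prod>b\<in>{Suc ?i..<Suc ?k}. par (e * ?l ! b))"
    by (subst prod.reindex) (auto simp: inj_on_def)
  also have "\<dots> = (\<Prod>b\<in>{..<length fs}. par (e * fs ! b))"
    by (rule prod.reindex_bij_witness[where i = "\<lambda>b. Suc ?i + b" and j = "\<lambda>b. b - Suc ?i"])
      (auto simp: nth_append)
  also have "\<dots> = par (e * sum_list fs)"
    by (simp add: prod_par sum_distrib_left[symmetric] sum_list_sum_nth lessThan_atLeast0)
  also have "(\<Prod>(a, b)\<in>?I2. par (?l ! a * ?l ! b)) = koszul_sign \<sigma> (es @ fs)"
    unfolding koszul_sign_def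
  proof (rule prod.reindex_bij_witness[where i = "\<lambda>(a, b). (inv_into UNIV ?c a, inv_into UNIV ?c b)" and j = "\<lambda>(a, b). (?c a, ?c b)"], goal_cases)
    case (1 q)
    then show ?case using inv_f_f[OF cyc_inj] by auto
  next
    case (2 q)
    then show ?case using cl by (auto simp: cyc_mono_iff)
  next
    case (3 q)
    then show ?case using permutes_inverses(1)[OF cyc_permutes[of ?i "length fs" "Suc (?i + length fs)"]] by auto
  next
    case (4 q)
    obtain a b where q: "q = (a, b)" by (cases q)
    have ic: "inv_into UNIV ?c x = (if x < ?i then x else Suc x)" if "x < ?k" for x
      by (rule inv_f_eq[OF cyc_inj]) (use that in \<open>auto simp: cyc_def\<close>)
    have "?c x = x" if "x < ?i" for x using that by (simp add: cyc_def)
    moreover have "?c (Suc x) = x" if "\<not> x < ?i" "x < ?k" for x using that by (simp add: cyc_def)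
    ultimately show ?case using 4 q by (auto simp: ic)
  next
    case (5 q)
    have "(es @ fs) ! ?c a = ?l ! a" if "a \<noteq> ?i" "a < Suc ?k" for a
      using that by (auto simp: cyc_def nth_append)
    then show ?case using 5 by auto
  qed
  finally show ?thesis .
qed


section \<open>The signed shuffle product of words and deconcatenation\<close>

context abelian_group
begin

text \<open>The signed sum of \<open>g\<close> over the shuffles of two words, built up from the first letter.  A shuffle
  permutation is taken apart at the last letter, so \<open>shuffle_sum\<close> is applied to reversed words below.\<close>

fun shuffle_sum :: "((int \<times> 'c) list \<Rightarrow> 'a) \<Rightarrow> (int \<times> 'c) list \<Rightarrow> (int \<times> 'c) list \<Rightarrow> 'a" where
  "shuffle_sum g [] v = g v"
| "shuffle_sum g (a # u) [] = g (a # u)"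
| "shuffle_sum g (a # u) (b # v) = shuffle_sum (\<lambda>w. g (a # w)) u (b # v) \<oplus> [par (cross (a # u) [b])] \<cdot> shuffle_sum (\<lambda>w. g (b # w)) (a # u) v"

lemma shuffle_sum_Nil_right [simp]: "shuffle_sum g u [] = g u"
  by (cases u) auto

lemma shuffle_sum_cong:
  "(\<And>w. mset w = mset u + mset v \<Longrightarrow> g w = g' w) \<Longrightarrow> shuffle_sum g u v = shuffle_sum g' u v"
proof (induction g u v arbitrary: g' rule: shuffle_sum.induct)
  case (3 g a u b v)
  have "shuffle_sum (\<lambda>w. g (a # w)) u (b # v) = shuffle_sum (\<lambda>w. g' (a # w)) u (b # v)"
    "shuffle_sum (\<lambda>w. g (b # w)) (a # u) v = shuffle_sum (\<lambda>w. g' (b # w)) (a # u) v"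
    by (rule 3(1) 3(2), rule 3(3), simp)+
  then show ?case by simp
qed auto

lemma shuffle_sum_closed: "(\<And>w. mset w = mset u + mset v \<Longrightarrow> g w \<in> carrier G) \<Longrightarrow> shuffle_sum g u v \<in> carrier G"
proof (induction g u v rule: shuffle_sum.induct)
  case (3 g a u b v)
  have "shuffle_sum (\<lambda>w. g (a # w)) u (b # v) \<in> carrier G" "shuffle_sum (\<lambda>w. g (b # w)) (a # u) v \<in> carrier G"
    by (rule 3(1) 3(2), rule 3(3), simp)+
  then show ?case by simp
qed auto

lemma shuffle_sum_closed' [simp]: "(\<And>w. g w \<in> carrier G) \<Longrightarrow> shuffle_sum g u v \<in> carrier G"
  by (rule shuffle_sum_closed)

lemma shuffle_sum_add:
  "(\<And>w. f w \<in> carrier G) \<Longrightarrow> (\<And>w. g w \<in> carrier G) \<Longrightarrow>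
    shuffle_sum (\<lambda>w. f w \<oplus> g w) u v = shuffle_sum f u v \<oplus> shuffle_sum g u v"
proof (induction f u v arbitrary: g rule: shuffle_sum.induct)
  case (3 f a u b v)
  show ?case using 3(1)[of "\<lambda>w. g (a # w)"] 3(2)[of "\<lambda>w. g (b # w)"] 3(3,4) by (simp add: a_ac)
qed auto

end

lemma shuffle_sum_additive_hom:
  assumes G: "abelian_group G" and W: "abelian_group W" and f: "f \<in> carrier G \<rightarrow> carrier W"
    and add: "\<And>x y. x \<in> carrier G \<Longrightarrow> y \<in> carrier G \<Longrightarrow> f (x \<oplus>\<^bsub>G\<^esub> y) = f x \<oplus>\<^bsub>W\<^esub> f y"
    and g: "\<And>w. g w \<in> carrier G"
  shows "abelian_group.shuffle_sum W (\<lambda>w. f (g w)) u v = f (abelian_group.shuffle_sum G g u v)"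
proof -
  interpret G: abelian_group G by fact
  interpret W: abelian_group W by fact
  have fp: "f ([par e] \<cdot>\<^bsub>G\<^esub> x) = [par e] \<cdot>\<^bsub>W\<^esub> f x" if "x \<in> carrier G" for e x
    using that funcset_mem[OF f that] additive_map_zero_minus(2)[OF G W f add, of x] by (simp add: G.par_pow W.par_pow)
  show ?thesis using g
  proof (induction g u v rule: G.shuffle_sum.induct)
    case (3 g a u b v)
    then show ?case by (simp add: fp add)
  qed auto
qed

text \<open>The unreduced coproduct: unlike \<open>splits\<close> it admits empty pieces, and it is
  for these cuts that compatibility with the shuffle product is stated.\<close>

definition fsplits :: "'b list \<Rightarrow> ('b list \<times> 'b list) set" where
  "fsplits w = {(u, v). u @ v = w}"

lemma finite_fsplits [simp]: "finite (fsplits w)"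
  using finite_append2[of w "\<lambda>_ _. True"] by (simp add: fsplits_def)

lemma fsplits_Nil: "fsplits [] = {([], [])}"
  by (auto simp: fsplits_def)

lemma fsplits_Cons: "fsplits (a # w) = insert ([], a # w) ((\<lambda>(u, v). (a # u, v)) ` fsplits w)"
  by (auto simp: fsplits_def append_eq_Cons_conv)

lemma (in abelian_monoid) finsum_fsplits_Cons:
  assumes "\<And>u v. g u v \<in> carrier G"
  shows "finsum G (\<lambda>(u, v). g u v) (fsplits (a # w)) = g [] (a # w) \<oplus> finsum G (\<lambda>(u, v). g (a # u) v) (fsplits w)"
proof -
  have "inj_on (\<lambda>(u, v). (a # u, v)) (fsplits w)" by (auto simp: inj_on_def)
  then show ?thesis unfolding fsplits_Cons using assms
    by (subst finsum_insert) (auto simp: finsum_reindex case_prod_unfold)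
qed

context abelian_group
begin

text \<open>One term in the product of two coproducts. Regrouping u1 u2 v1 v2 as u1 v1 u2 v2 moves
  v1 past u2, whence the sign.\<close>

definition deconc_term ::
  "((int \<times> 'c) list \<Rightarrow> (int \<times> 'c) list \<Rightarrow> 'a) \<Rightarrow> (int \<times> 'c) list \<Rightarrow> (int \<times> 'c) list \<Rightarrow> (int \<times> 'c) list \<Rightarrow> (int \<times> 'c) list \<Rightarrow> 'a" where
  "deconc_term g u1 u2 v1 v2 = [par (cross u2 v1)] \<cdot> shuffle_sum (\<lambda>w1. shuffle_sum (\<lambda>w2. g w1 w2) u2 v2) u1 v1"

lemma deconc_term_closed [simp]: "(\<And>w1 w2. g w1 w2 \<in> carrier G) \<Longrightarrow> deconc_term g u1 u2 v1 v2 \<in> carrier G"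
  by (simp add: deconc_term_def)

text \<open>Deconcatenation is an algebra morphism for the shuffle product.\<close>

lemma shuffle_sum_deconcatenation:
  assumes "\<And>w1 w2. g w1 w2 \<in> carrier G"
  shows "shuffle_sum (\<lambda>w. finsum G (\<lambda>(w1, w2). g w1 w2) (fsplits w)) u v =
    finsum G (\<lambda>(u1, u2). finsum G (\<lambda>(v1, v2). deconc_term g u1 u2 v1 v2) (fsplits v)) (fsplits u)"
  using assms
proof (induction "length u + length v" arbitrary: u v g rule: less_induct)
  case less
  note g = less.prems
  have cl: "finsum G (\<lambda>(w1, w2). g' w1 w2) (fsplits w) \<in> carrier G"
    if "\<And>w1 w2. g' w1 w2 \<in> carrier G" for g' :: "(int \<times> 'c) list \<Rightarrow> (int \<times> 'c) list \<Rightarrow> 'a" and w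
    using that by (auto intro!: finsum_closed)
  show ?case
  proof (cases u)
    case Nil
    then show ?thesis using g by (auto simp: fsplits_Nil deconc_term_def cross_def int_pow_pm1 cl[unfolded case_prod_unfold] case_prod_unfold)
  next
    case (Cons a u')
    note u = this
    show ?thesis
    proof (cases v)
      case Nil
      then show ?thesis using g u
        by (auto simp: fsplits_Nil deconc_term_def cross_def int_pow_pm1 case_prod_unfold)
    next
      case (Cons b v')
      note v = this
      let ?ga = "\<lambda>w1. g (a # w1)" and ?gb = "\<lambda>w1. g (b # w1)"
      let ?s = "par (cross (a # u') [b])"
      let ?S = "\<lambda>f w. finsum G (\<lambda>(w1, w2). f w1 w2) (fsplits w)"
      have eqa: "?S g (c # w) = g [] (c # w) \<oplus> ?S (\<lambda>w1. g (c # w1)) w" for c w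
        by (rule finsum_fsplits_Cons) (rule g)
      have gg: "g w1 w2 \<in> carrier G" for w1 w2 by (rule g)
      have IHa: "shuffle_sum (?S ?ga) u' (b # v') = ?S (\<lambda>u1 u2. ?S (\<lambda>v1 v2. deconc_term ?ga u1 u2 v1 v2) (b # v')) u'"
        by (rule less.hyps) (use u v g in auto)
      have IHb: "shuffle_sum (?S ?gb) (a # u') v' = ?S (\<lambda>u1 u2. ?S (\<lambda>v1 v2. deconc_term ?gb u1 u2 v1 v2) v') (a # u')"
        by (rule less.hyps) (use u v g in auto)
      \<comment> \<open>\<open>T\<close> collects the cuts whose first piece is empty. They are
        split off on both sides by \<open>finsum_fsplits_Cons\<close>.\<close>
      define T where "T = g []"
      have Tc: "T w \<in> carrier G" for w by (simp add: T_def gg)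
      \<comment> \<open>Cuts with nonempty first piece, sorted by the first letter of that piece
        after shuffling: \<open>a\<close> for the A sums, \<open>b\<close> for the B sums. Index 1
        means that the other word contributes nothing to the first piece, index 2 that it
        does.\<close>
      let ?A1 = "\<lambda>u1 u2. deconc_term ?ga u1 u2 [] (b # v')"
      let ?A2 = "\<lambda>u1 u2. ?S (\<lambda>v1 v2. deconc_term ?ga u1 u2 (b # v1) v2) v'"
      let ?B1 = "?S (\<lambda>v1 v2. deconc_term ?gb [] (a # u') v1 v2) v'"
      let ?B2 = "\<lambda>u1 u2. ?S (\<lambda>v1 v2. deconc_term ?gb (a # u1) u2 v1 v2) v'"
      have c: "?A1 u1 u2 \<in> carrier G" "?A2 u1 u2 \<in> carrier G" "?B1 \<in> carrier G" "?B2 u1 u2 \<in> carrier G" for u1 u2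
        by (auto intro!: finsum_closed deconc_term_closed gg)
      have cS: "?S ?A1 u' \<in> carrier G" "?S ?A2 u' \<in> carrier G" "?S ?B2 u' \<in> carrier G"
        by (intro cl c)+
      have "shuffle_sum (?S g) (a # u') (b # v') =
          shuffle_sum (\<lambda>w. T (a # w) \<oplus> ?S ?ga w) u' (b # v') \<oplus> [?s] \<cdot> shuffle_sum (\<lambda>w. T (b # w) \<oplus> ?S ?gb w) (a # u') v'"
        by (simp only: shuffle_sum.simps eqa T_def)
      also have "\<dots> = (shuffle_sum (\<lambda>w. T (a # w)) u' (b # v') \<oplus> shuffle_sum (?S ?ga) u' (b # v')) \<oplus>
         [?s] \<cdot> (shuffle_sum (\<lambda>w. T (b # w)) (a # u') v' \<oplus> shuffle_sum (?S ?gb) (a # u') v')"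
        by (subst (1 2) shuffle_sum_add) (auto simp: Tc intro!: cl gg)
      also have "\<dots> = shuffle_sum T (a # u') (b # v') \<oplus> (shuffle_sum (?S ?ga) u' (b # v') \<oplus> [?s] \<cdot> shuffle_sum (?S ?gb) (a # u') v')"
      proof -
        have "shuffle_sum (?S ?ga) u' (b # v') \<in> carrier G" "shuffle_sum (?S ?gb) (a # u') v' \<in> carrier G"
          by (intro shuffle_sum_closed' cl gg)+
        then show ?thesis using Tc by (simp add: a_ac)
      qed
      also have "shuffle_sum (?S ?ga) u' (b # v') = ?S ?A1 u' \<oplus> ?S ?A2 u'"
        unfolding IHa by (subst finsum_fsplits_Cons, force intro!: deconc_term_closed gg, rule finsum_addf_pair) (rule c)+
      also have "shuffle_sum (?S ?gb) (a # u') v' = ?B1 \<oplus> ?S ?B2 u'"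
        unfolding IHb by (rule finsum_fsplits_Cons) (intro cl deconc_term_closed gg)
      also have "[?s] \<cdot> (?B1 \<oplus> ?S ?B2 u') = [?s] \<cdot> ?B1 \<oplus> ?S (\<lambda>u1 u2. [?s] \<cdot> ?B2 u1 u2) u'"
        using c cS by (simp add: par_pow_finsum case_prod_unfold)
      finally have L: "shuffle_sum (?S g) (a # u') (b # v') =
         shuffle_sum T (a # u') (b # v') \<oplus> ((?S ?A1 u' \<oplus> ?S ?A2 u') \<oplus> ([?s] \<cdot> ?B1 \<oplus> ?S (\<lambda>u1 u2. [?s] \<cdot> ?B2 u1 u2) u'))" .
      \<comment> \<open>The right side is expanded along the cuts of u and then of v; it falls into
        the same five groups as \<open>L\<close>.\<close>
      have "?S (\<lambda>u1 u2. ?S (\<lambda>v1 v2. deconc_term g u1 u2 v1 v2) (b # v')) (a # u') =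
         ?S (\<lambda>v1 v2. deconc_term g [] (a # u') v1 v2) (b # v') \<oplus>
         ?S (\<lambda>u1 u2. ?S (\<lambda>v1 v2. deconc_term g (a # u1) u2 v1 v2) (b # v')) u'"
        by (rule finsum_fsplits_Cons) (intro cl deconc_term_closed gg)
      also have "?S (\<lambda>v1 v2. deconc_term g [] (a # u') v1 v2) (b # v') = shuffle_sum T (a # u') (b # v') \<oplus> [?s] \<cdot> ?B1"
      proof -
        have "deconc_term g [] (a # u') [] (b # v') = shuffle_sum T (a # u') (b # v')"
          using Tc by (simp add: deconc_term_def cross_def int_pow_pm1 T_def del: shuffle_sum.simps(3))
        moreover have "deconc_term g [] (a # u') (b # v1) v2 = [?s] \<cdot> deconc_term ?gb [] (a # u') v1 v2" for v1 v2
        proof -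
          have "cross (a # u') [b] + cross (a # u') v1 = cross (a # u') (b # v1)"
            by (simp add: cross_def algebra_simps)
          then show ?thesis using gg by (simp add: deconc_term_def par_pow_par_pow)
        qed
        ultimately show ?thesis using c(3)
          by (subst finsum_fsplits_Cons) (auto simp: gg case_prod_unfold par_pow_finsum intro!: deconc_term_closed)
      qed
      also have "?S (\<lambda>u1 u2. ?S (\<lambda>v1 v2. deconc_term g (a # u1) u2 v1 v2) (b # v')) u' =
         ?S (\<lambda>u1 u2. ?A1 u1 u2 \<oplus> (?A2 u1 u2 \<oplus> [?s] \<cdot> ?B2 u1 u2)) u'"
      proof (intro finsum_cong_on refl, clarify)
        fix u1 u2 assume "(u1, u2) \<in> fsplits u'"
        then have u': "u' = u1 @ u2" by (simp add: fsplits_def)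
        have 1: "deconc_term g (a # u1) u2 [] (b # v') = ?A1 u1 u2"
          by (simp add: deconc_term_def)
        have 2: "deconc_term g (a # u1) u2 (b # v1) v2 = deconc_term ?ga u1 u2 (b # v1) v2 \<oplus> [?s] \<cdot> deconc_term ?gb (a # u1) u2 v1 v2" for v1 v2
        proof -
          have "cross u2 (b # v1) + cross (a # u1) [b] = cross (a # u') [b] + cross u2 v1"
            unfolding u' by (simp add: cross_def algebra_simps)
          then show ?thesis using gg by (simp add: deconc_term_def par_pow_par_pow)
        qed
        show "?S (\<lambda>v1 v2. deconc_term g (a # u1) u2 v1 v2) (b # v') = ?A1 u1 u2 \<oplus> (?A2 u1 u2 \<oplus> [?s] \<cdot> ?B2 u1 u2)"
        proof -
          have "?S (\<lambda>v1 v2. deconc_term g (a # u1) u2 v1 v2) (b # v') =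
             ?A1 u1 u2 \<oplus> ?S (\<lambda>v1 v2. deconc_term ?ga u1 u2 (b # v1) v2 \<oplus> [?s] \<cdot> deconc_term ?gb (a # u1) u2 v1 v2) v'"
            unfolding 1[symmetric] 2[symmetric] by (rule finsum_fsplits_Cons) (intro deconc_term_closed gg)
          also have "?S (\<lambda>v1 v2. deconc_term ?ga u1 u2 (b # v1) v2 \<oplus> [?s] \<cdot> deconc_term ?gb (a # u1) u2 v1 v2) v' =
             ?A2 u1 u2 \<oplus> ?S (\<lambda>v1 v2. [?s] \<cdot> deconc_term ?gb (a # u1) u2 v1 v2) v'"
            by (rule finsum_addf_pair) (intro deconc_term_closed par_pow_closed gg)+
          also have "?S (\<lambda>v1 v2. [?s] \<cdot> deconc_term ?gb (a # u1) u2 v1 v2) v' = [?s] \<cdot> ?B2 u1 u2"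
            by (subst par_pow_finsum) (auto simp: case_prod_unfold gg intro!: deconc_term_closed)
          finally show ?thesis .
        qed
      qed
      also have "\<dots> = ?S ?A1 u' \<oplus> (?S ?A2 u' \<oplus> ?S (\<lambda>u1 u2. [?s] \<cdot> ?B2 u1 u2) u')"
      proof -
        have "?S (\<lambda>u1 u2. ?A1 u1 u2 \<oplus> (?A2 u1 u2 \<oplus> [?s] \<cdot> ?B2 u1 u2)) u' =
          ?S ?A1 u' \<oplus> ?S (\<lambda>u1 u2. ?A2 u1 u2 \<oplus> [?s] \<cdot> ?B2 u1 u2) u'"
          by (rule finsum_addf_pair) (intro a_closed par_pow_closed c)+
        also have "?S (\<lambda>u1 u2. ?A2 u1 u2 \<oplus> [?s] \<cdot> ?B2 u1 u2) u' = ?S ?A2 u' \<oplus> ?S (\<lambda>u1 u2. [?s] \<cdot> ?B2 u1 u2) u'"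
          by (rule finsum_addf_pair) (intro par_pow_closed c)+
        finally show ?thesis .
      qed
      finally show ?thesis unfolding u v L
      proof -
        assume R: "?S (\<lambda>u1 u2. ?S (\<lambda>v1 v2. deconc_term g u1 u2 v1 v2) (b # v')) (a # u') =
          (shuffle_sum T (a # u') (b # v') \<oplus> [?s] \<cdot> ?B1) \<oplus> (?S ?A1 u' \<oplus> (?S ?A2 u' \<oplus> ?S (\<lambda>u1 u2. [?s] \<cdot> ?B2 u1 u2) u'))"
        have "?S (\<lambda>u1 u2. [?s] \<cdot> ?B2 u1 u2) u' \<in> carrier G" by (intro cl par_pow_closed c)
        moreover have "shuffle_sum T (a # u') (b # v') \<in> carrier G" using Tc by (intro shuffle_sum_closed')
        ultimately show "shuffle_sum T (a # u') (b # v') \<oplus> ((?S ?A1 u' \<oplus> ?S ?A2 u') \<oplus> ([?s] \<cdot> ?B1 \<oplus> ?S (\<lambda>u1 u2. [?s] \<cdot> ?B2 u1 u2) u')) =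
          ?S (\<lambda>u1 u2. ?S (\<lambda>v1 v2. deconc_term g u1 u2 v1 v2) (b # v')) (a # u')"
          unfolding R using cS(1,2) c(3) by (simp add: a_ac del: shuffle_sum.simps(3))
      qed
    qed
  qed
qed

end

section \<open>From sums over shuffle permutations to shuffle products\<close>

lemma sign_koszul_par: "\<exists>e. sign \<sigma> * koszul_sign \<sigma> es = par e"
proof -
  let ?S = "{(a, b). a < b \<and> b < length es \<and> \<sigma> b < \<sigma> a}"
  have "finite ?S" by (rule finite_subset[of _ "{..<length es} \<times> {..<length es}"]) auto
  then have "koszul_sign \<sigma> es = par (\<Sum>(a, b)\<in>?S. es ! a * es ! b)"
    unfolding koszul_sign_def by (simp add: prod_par[symmetric] case_prod_unfold)
  moreover have "sign \<sigma> = par (if evenperm \<sigma> then 0 else 1)" by (simp add: sign_def)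
  ultimately show ?thesis by (auto simp: par_add[symmetric])
qed

lemma permute_list_fix_last:
  assumes p: "\<sigma> permutes {..<length xs}"
  shows "permute_list (inv_into UNIV \<sigma>) (xs @ [x]) = permute_list (inv_into UNIV \<sigma>) xs @ [x]"
proof -
  note q = permutes_inv[OF p]
  have "inv_into UNIV \<sigma> i < length xs" if "i < length xs" for i
    using permutes_in_image[OF q, of i] that by simp
  moreover have "inv_into UNIV \<sigma> (length xs) = length xs" using q by (rule permutes_not_in) simp
  ultimately show ?thesis by (auto simp: permute_list_def nth_append)
qed

lemma permute_list_move_last:
  assumes p: "\<sigma> permutes {..<length (xs @ ys)}"
  shows "permute_list (inv_into UNIV (\<sigma> \<circ> cyc (length xs) (length ys))) (xs @ x # ys) =
    permute_list (inv_into UNIV \<sigma>) (xs @ ys) @ [x]"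
proof -
  let ?c = "cyc (length xs) (length ys)" and ?k = "length (xs @ ys)"
  note q = permutes_inv[OF p]
  have cp: "?c permutes {..<Suc ?k}" by (rule cyc_permutes) simp
  have iv: "inv_into UNIV (\<sigma> \<circ> ?c) = inv_into UNIV ?c \<circ> inv_into UNIV \<sigma>"
    by (rule o_inv_distrib[OF permutes_bij[OF p] permutes_bij[OF cp]])
  have ic: "inv_into UNIV ?c x = (if x < length xs then x else if x < ?k then Suc x else if x = ?k then length xs else x)" for x
    by (rule inv_f_eq[OF cyc_inj]) (auto simp: cyc_def)
  have lt: "inv_into UNIV \<sigma> i < ?k" if "i < ?k" for i
    using permutes_in_image[OF q, of i] that by simp
  have k: "inv_into UNIV \<sigma> ?k = ?k" using q by (rule permutes_not_in) simp
  have "(xs @ x # ys) ! inv_into UNIV ?c i = (xs @ ys) ! i" if "i < ?k" for i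
    unfolding ic using that by (auto simp: nth_append)
  then have "map (\<lambda>i. (xs @ x # ys) ! inv_into UNIV (\<sigma> \<circ> ?c) i) [0..<?k] = map (\<lambda>i. (xs @ ys) ! inv_into UNIV \<sigma> i) [0..<?k]"
    using lt by (auto simp: iv)
  moreover have "(xs @ x # ys) ! inv_into UNIV (\<sigma> \<circ> ?c) ?k = x" unfolding iv comp_apply k ic by simp
  moreover have "length (xs @ x # ys) = Suc ?k" by simp
  ultimately show ?thesis unfolding permute_list_def by (simp only: upt_Suc_append map_append list.map zero_le)
qed

context abelian_group
begin

text \<open>The sum in \<open>vanishes_on_shuffles\<close>, for a function that sees the degree
  labels along with the elements.\<close>

definition perm_sum :: "((int \<times> 'c) list \<Rightarrow> 'a) \<Rightarrow> nat \<Rightarrow> (int \<times> 'c) list \<Rightarrow> 'a" where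
  "perm_sum g i ps = (\<Oplus>\<sigma>\<in>shuffle_perms i (length ps).
     [(sign \<sigma> * koszul_sign \<sigma> (map fst ps))] \<cdot> g (permute_list (inv_into UNIV \<sigma>) ps))"

text \<open>Shuffles are sorted by the block whose last letter ends up last. If it is the last
  letter of v, nothing is crossed and no sign arises; if it is that of u, it crosses all of v. In
  \<open>shuffle_sum\<close> the sign-free case belongs to the first word, so besides being reversed
  the two words trade places.\<close>

lemma perm_sum_shuffle_sum:
  assumes "\<And>w. g w \<in> carrier G"
  shows "perm_sum g (length u) (u @ v) = shuffle_sum (\<lambda>w. g (rev w)) (rev v) (rev u)"
  using assms
proof (induction "length u + length v" arbitrary: u v g rule: less_induct)
  case less
  note g = less.prems
  have sgc: "[(sign \<sigma> * koszul_sign \<sigma> es)] \<cdot> g w \<in> carrier G" for \<sigma> es w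
  proof -
    obtain e where "sign \<sigma> * koszul_sign \<sigma> es = par e" using sign_koszul_par by blast
    then show ?thesis using g by simp
  qed
  consider "u = []" | "v = []" | u0 a v0 b where "u = u0 @ [a]" "v = v0 @ [b]"
    by (cases u rule: rev_cases; cases v rule: rev_cases) auto
  then show ?case
  proof cases
    case 1
    then show ?thesis using g by (simp add: perm_sum_def shuffle_perms_0 int_pow_pm1 permute_list_id)
  next
    case 2
    then show ?thesis using g by (simp add: perm_sum_def shuffle_perms_all int_pow_pm1 permute_list_id)
  next
    case 3
    let ?i = "length u0" and ?j = "length v0" and ?ps = "u @ v"
    let ?k = "Suc (?i + ?j)" and ?c = "cyc (length u0) (Suc (length v0))"
    let ?t = "\<lambda>\<sigma>. [(sign \<sigma> * koszul_sign \<sigma> (map fst ?ps))] \<cdot> g (permute_list (inv_into UNIV \<sigma>) ?ps)"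
    let ?S = "shuffle_perms (Suc ?i) (Suc ?k)"
    have S: "?S = {\<sigma> \<in> ?S. \<sigma> ?k = ?k} \<union> {\<sigma> \<in> ?S. \<sigma> ?i = ?k}"
      using shuffle_perms_last_cases by auto
    have disj: "{\<sigma> \<in> ?S. \<sigma> ?k = ?k} \<inter> {\<sigma> \<in> ?S. \<sigma> ?i = ?k} = {}"
    proof -
      have False if "\<sigma> \<in> ?S" "\<sigma> ?k = \<sigma> ?i" for \<sigma>
      proof -
        have "inj \<sigma>" using that(1) permutes_inj by (auto simp: shuffle_perms_def)
        from injD[OF this that(2)] show False by simp
      qed
      then show ?thesis by (intro equals0I) (metis (mono_tags, lifting) IntE mem_Collect_eq)
    qed
    have "perm_sum g (length u) (u @ v) = finsum G ?t ?S"
      by (simp add: perm_sum_def 3)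
    also have "\<dots> = finsum G ?t {\<sigma> \<in> ?S. \<sigma> ?k = ?k} \<oplus> finsum G ?t {\<sigma> \<in> ?S. \<sigma> ?i = ?k}"
      by (subst S, rule finsum_Un_disjoint) (use disj sgc in auto)
    also have "finsum G ?t {\<sigma> \<in> ?S. \<sigma> ?k = ?k} = perm_sum (\<lambda>w. g (w @ [b])) (length u) (u @ v0)"
      unfolding shuffle_perms_fix_last perm_sum_def
    proof (rule finsum_cong_on)
      show "shuffle_perms (Suc ?i) ?k = shuffle_perms (length u) (length (u @ v0))" by (simp add: 3)
    next
      fix \<sigma> assume "\<sigma> \<in> shuffle_perms (length u) (length (u @ v0))"
      then have p: "\<sigma> permutes {..<length (u @ v0)}" by (auto simp: shuffle_perms_def)
      have "koszul_sign \<sigma> (map fst (u @ v0) @ [fst b]) = koszul_sign \<sigma> (map fst (u @ v0))"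
        by (rule koszul_sign_fix_last) (use p in simp)
      moreover have "permute_list (inv_into UNIV \<sigma>) ((u @ v0) @ [b]) = permute_list (inv_into UNIV \<sigma>) (u @ v0) @ [b]"
        by (rule permute_list_fix_last[OF p])
      ultimately show "?t \<sigma> = [(sign \<sigma> * koszul_sign \<sigma> (map fst (u @ v0)))] \<cdot> g (permute_list (inv_into UNIV \<sigma>) (u @ v0) @ [b])"
        using 3 by simp
    qed
    also have "\<dots> = shuffle_sum (\<lambda>w. g (rev w @ [b])) (rev v0) (rev u)"
      by (rule less.hyps) (use 3 g in auto)
    also have "finsum G ?t {\<sigma> \<in> ?S. \<sigma> ?i = ?k} = (\<Oplus>\<sigma>\<in>shuffle_perms ?i ?k. ?t (\<sigma> \<circ> ?c))"
      by (rule finsum_bij[OF shuffle_perms_move_last]) (use sgc in auto)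
    also have "\<dots> = (\<Oplus>\<sigma>\<in>shuffle_perms ?i ?k. [par (cross (rev v) [a])] \<cdot>
        ([(sign \<sigma> * koszul_sign \<sigma> (map fst (u0 @ v)))] \<cdot> g (permute_list (inv_into UNIV \<sigma>) (u0 @ v) @ [a])))"
    proof (rule finsum_cong_on[OF refl])
      fix \<sigma> assume "\<sigma> \<in> shuffle_perms ?i ?k"
      then have p: "\<sigma> permutes {..<length (u0 @ v)}" using 3 by (auto simp: shuffle_perms_def)
      have ps: "?ps = u0 @ a # v" and lv: "length v = Suc ?j" using 3 by auto
      have "koszul_sign (\<sigma> \<circ> cyc (length (map fst u0)) (length (map fst v))) (map fst u0 @ fst a # map fst v) =
         par (fst a * sum_list (map fst v)) * koszul_sign \<sigma> (map fst u0 @ map fst v)"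
        by (rule koszul_sign_move_last) (use p in simp)
      then have ko: "koszul_sign (\<sigma> \<circ> ?c) (map fst ?ps) = par (fst a * tdeg v) * koszul_sign \<sigma> (map fst (u0 @ v))"
        by (simp add: ps lv tdeg_def)
      have pl: "permute_list (inv_into UNIV (\<sigma> \<circ> ?c)) ?ps = permute_list (inv_into UNIV \<sigma>) (u0 @ v) @ [a]"
        using permute_list_move_last[OF p, of a] by (simp add: ps lv)
      have "permutation \<sigma>" using p permutes_imp_permutation by blast
      moreover have "permutation ?c"
        by (rule permutes_imp_permutation[OF _ cyc_permutes[of _ _ "Suc ?k"]]) auto
      ultimately have "sign (\<sigma> \<circ> ?c) = sign \<sigma> * (-1) ^ Suc ?j" by (simp only: sign_compose sign_cyc)
      also have "(-1) ^ Suc ?j = par (int (length v))" by (simp add: lv par_def)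
      finally have sg: "sign (\<sigma> \<circ> ?c) = sign \<sigma> * par (int (length v))" .
      obtain e where e: "sign \<sigma> * koszul_sign \<sigma> (map fst (u0 @ v)) = par e" using sign_koszul_par by blast
      have "cross (rev v) [a] = fst a * tdeg v + int (length v)"
        by (simp add: cross_def tdeg_def sum_list_rev rev_map[symmetric])
      then have "sign (\<sigma> \<circ> ?c) * koszul_sign (\<sigma> \<circ> ?c) (map fst ?ps) = par (cross (rev v) [a]) * par e"
        unfolding ko sg e[symmetric] by (simp add: par_add)
      then show "?t (\<sigma> \<circ> ?c) = [par (cross (rev v) [a])] \<cdot>
        ([(sign \<sigma> * koszul_sign \<sigma> (map fst (u0 @ v)))] \<cdot> g (permute_list (inv_into UNIV \<sigma>) (u0 @ v) @ [a]))"
        unfolding e pl using g by (simp only: par_add[symmetric] par_pow_par_pow)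
    qed
    also have "\<dots> = [par (cross (rev v) [a])] \<cdot> perm_sum (\<lambda>w. g (w @ [a])) (length u0) (u0 @ v)"
    proof (subst par_pow_finsum[symmetric])
      fix \<sigma>
      obtain e where e: "sign \<sigma> * koszul_sign \<sigma> (map fst (u0 @ v)) = par e" using sign_koszul_par by blast
      show "[(sign \<sigma> * koszul_sign \<sigma> (map fst (u0 @ v)))] \<cdot> g (permute_list (inv_into UNIV \<sigma>) (u0 @ v) @ [a]) \<in> carrier G"
        unfolding e using g by simp
    qed (simp add: perm_sum_def 3)
    also have "perm_sum (\<lambda>w. g (w @ [a])) (length u0) (u0 @ v) = shuffle_sum (\<lambda>w. g (rev w @ [a])) (rev v) (rev u0)"
      by (rule less.hyps) (use 3 g in auto)
    finally show ?thesis by (simp add: 3)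
  qed
qed

end

section \<open>The transferred maps vanish on shuffles\<close>

lemma homog_list_mset: "mset w = mset u + mset v \<Longrightarrow> homog_list V w \<longleftrightarrow> homog_list V u \<and> homog_list V v"
  unfolding homog_list_def by (metis homog_list_append homog_list_def mset_append mset_eq_setD)

lemma tdeg_mset: "mset w = mset u + mset v \<Longrightarrow> tdeg w = tdeg u + tdeg v"
  unfolding tdeg_def by (metis mset_append mset_map sum_list_append map_append sum_mset_sum_list)

lemma length_mset: "mset w = mset u + mset v \<Longrightarrow> length w = length u + length v"
  by (metis size_mset size_union)

lemma homog_list_rev [simp]: "homog_list V (rev w) = homog_list V w"
  by (simp add: homog_list_def)

lemma tdeg_rev [simp]: "tdeg (rev w) = tdeg w"
  by (simp add: tdeg_def sum_list_rev rev_map[symmetric])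

context contraction
begin

text \<open>Reads the word backwards, as the shuffle recursion requires. The value 0 on wrongly
  labelled words puts every value in the carrier, which the lemmas on shuffle sums assume for all
  words.\<close>

definition F_rev :: "(int \<times> 'a) list \<Rightarrow> 'a" where
  "F_rev w = (if homog_list A w then f_min (elts (rev w)) else \<zero>)"

definition P_rev :: "(int \<times> 'a) list \<Rightarrow> 'a" where
  "P_rev w = (if homog_list A w then p_min (rev w) else \<zero>)"

lemma F_rev_closed [simp]: "F_rev w \<in> carrier A"
  using f_min_closed[OF homog_list_carrier, of "rev w"] by (simp add: F_rev_def)

lemma P_rev_closed [simp]: "P_rev w \<in> carrier A"
  by (simp add: P_rev_def p_min_closed)

text \<open>With the value 0 on the empty word, improper cuts contribute nothing; this is why
  \<open>P_rev\<close> can be written over \<open>fsplits\<close>, where deconcatenation is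
  multiplicative.\<close>

lemma F_rev_Nil [simp]: "F_rev [] = \<zero>"
  by (simp add: F_rev_def f_min_def)

lemma F_rev_grade:
  assumes "homog_list A w" "w \<noteq> []" shows "F_rev w \<in> grade A (tdeg w + 1 - int (length w))"
  using f_min_grade[of "rev w"] assms by (simp add: F_rev_def)

lemma F_rev_P_rev: "2 \<le> length w \<Longrightarrow> F_rev w = \<ominus> (h (P_rev w))"
  by (simp add: F_rev_def P_rev_def f_min_p_min)

definition rev_sign :: "(int \<times> 'a) list \<Rightarrow> (int \<times> 'a) list \<Rightarrow> int" where
  "rev_sign w1 w2 = int (length w2) - 1 + (1 - int (length w1)) * tdeg w2"

text \<open>Reversing a word exchanges the two pieces of a cut, so the piece \<open>w2\<close>
  supplies the left factor and \<open>rev_sign\<close> is the sign of \<open>p_min\<close> with the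
  roles exchanged.\<close>

definition rev_prod :: "(int \<times> 'a) list \<Rightarrow> (int \<times> 'a) list \<Rightarrow> 'a" where
  "rev_prod w1 w2 = [par (rev_sign w1 w2)] \<cdot> (F_rev w2 \<otimes> F_rev w1)"

lemma rev_prod_closed [simp]: "rev_prod w1 w2 \<in> carrier A"
  by (simp add: rev_prod_def)

lemma P_rev_splits:
  "P_rev w = (if homog_list A w then finsum A (\<lambda>(w1, w2). rev_prod w1 w2) (fsplits w) else \<zero>)"
proof (cases "homog_list A w")
  case True
  have "P_rev w = finsum A (\<lambda>(us, vs). rev_prod (rev vs) (rev us)) (splits (rev w))"
    unfolding P_rev_def p_min_def using True
  proof (simp, intro finsum_cong_on refl, clarify)
    fix us vs assume uv: "(us, vs) \<in> splits (rev w)"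
    have "homog_list A (us @ vs)" using splitsD(5)[OF uv] True by (metis homog_list_rev)
    then show "[par (int (length us) - 1 + (1 - int (length vs)) * tdeg us)] \<cdot> (f_min (elts us) \<otimes> f_min (elts vs)) = rev_prod (rev vs) (rev us)"
      by (simp add: rev_prod_def rev_sign_def F_rev_def)
  qed
  also have "\<dots> = finsum A (\<lambda>(w1, w2). rev_prod w1 w2) {(w1, w2). w1 @ w2 = w \<and> w1 \<noteq> [] \<and> w2 \<noteq> []}"
    by (rule finsum_witness[where i = "\<lambda>(us, vs). (rev vs, rev us)" and j = "\<lambda>(w1, w2). (rev w2, rev w1)"])
      (auto simp: splits_def rev_swap[symmetric])
  also have "\<dots> = finsum A (\<lambda>(w1, w2). rev_prod w1 w2) (fsplits w)"
    by (rule finsum_mono_neutral[OF finite_fsplits, symmetric]) (auto simp: fsplits_def rev_prod_def)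
  finally show ?thesis using True by simp
qed (simp add: P_rev_def)

text \<open>The sign depends only on lengths and total degrees, which are constant over all shuffles
  of two given words. It can thus be taken out, and bilinearity of the product separates the two
  shuffle sums.\<close>

lemma deconc_term_rev_prod:
  assumes hom: "homog_list A u1" "homog_list A u2" "homog_list A v1" "homog_list A v2"
  shows "deconc_term rev_prod u1 u2 v1 v2 =
     [par (cross u2 v1 + rev_sign (u1 @ v1) (u2 @ v2))] \<cdot> (shuffle_sum F_rev u2 v2 \<otimes> shuffle_sum F_rev u1 v1)"
proof -
  let ?e = "rev_sign (u1 @ v1) (u2 @ v2)"
  have "shuffle_sum (\<lambda>w1. shuffle_sum (\<lambda>w2. rev_prod w1 w2) u2 v2) u1 v1 =
     shuffle_sum (\<lambda>w1. shuffle_sum (\<lambda>w2. [par ?e] \<cdot> (F_rev w2 \<otimes> F_rev w1)) u2 v2) u1 v1"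
  proof (intro shuffle_sum_cong)
    fix w1 w2 assume "mset w1 = mset u1 + mset v1" "mset w2 = mset u2 + mset v2"
    note m = this[THEN tdeg_mset] this[THEN length_mset]
    show "rev_prod w1 w2 = [par ?e] \<cdot> (F_rev w2 \<otimes> F_rev w1)"
      by (simp add: rev_prod_def rev_sign_def m)
  qed
  also have "\<dots> = shuffle_sum (\<lambda>w1. [par ?e] \<cdot> (shuffle_sum F_rev u2 v2 \<otimes> F_rev w1)) u1 v1"
  proof (intro shuffle_sum_cong)
    fix w1
    have "shuffle_sum (\<lambda>w2. [par ?e] \<cdot> (F_rev w2 \<otimes> F_rev w1)) u2 v2 = [par ?e] \<cdot> (shuffle_sum F_rev u2 v2 \<otimes> F_rev w1)"
      using shuffle_sum_additive_hom[OF abelian_group_axioms abelian_group_axioms, of "\<lambda>x. [par ?e] \<cdot> (x \<otimes> F_rev w1)" F_rev u2 v2]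
      by (simp add: l_distr)
    then show "shuffle_sum (\<lambda>w2. [par ?e] \<cdot> (F_rev w2 \<otimes> F_rev w1)) u2 v2 = [par ?e] \<cdot> (shuffle_sum F_rev u2 v2 \<otimes> F_rev w1)" .
  qed
  also have "\<dots> = [par ?e] \<cdot> (shuffle_sum F_rev u2 v2 \<otimes> shuffle_sum F_rev u1 v1)"
    using shuffle_sum_additive_hom[OF abelian_group_axioms abelian_group_axioms, of "\<lambda>x. [par ?e] \<cdot> (shuffle_sum F_rev u2 v2 \<otimes> x)" F_rev u1 v1]
    by (simp add: r_distr)
  finally show ?thesis by (simp add: deconc_term_def par_pow_par_pow)
qed

text \<open>For \<open>P_rev\<close>, deconcatenation yields products of shuffle sums of
  \<open>F_rev\<close>. Such a product vanishes if one factor shuffles two nonempty words of smaller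
  total length, by induction, or shuffles two empty words. What remains are the two terms in which
  each factor involves exactly one of u and v completely, and these cancel by graded commutativity.
  Since \<open>F_rev\<close> is minus \<open>h\<close> of \<open>P_rev\<close> on words of length at
  least two, its vanishing follows.\<close>

lemma shuffle_sum_rev_vanish:
  assumes "homog_list A u" "homog_list A v" "u \<noteq> []" "v \<noteq> []"
  shows shuffle_sum_P_rev: "shuffle_sum P_rev u v = \<zero>" and shuffle_sum_F_rev: "shuffle_sum F_rev u v = \<zero>"
  using assms
proof (induction "length u + length v" arbitrary: u v rule: less_induct)
  case less
  have P: "shuffle_sum P_rev u v = \<zero>" if uv: "homog_list A u" "homog_list A v" "u \<noteq> []" "v \<noteq> []"
    and IH: "\<And>u' v'. length u' + length v' < length u + length v \<Longrightarrow> homog_list A u' \<Longrightarrow> homog_list A v' \<Longrightarrow>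
       u' \<noteq> [] \<Longrightarrow> v' \<noteq> [] \<Longrightarrow> shuffle_sum F_rev u' v' = \<zero>"
  proof -
    let ?D = "\<lambda>(p, q). deconc_term rev_prod (fst p) (snd p) (fst q) (snd q)"
    let ?T = "{(([], u), (v, [])), ((u, []), ([], v))}"
    have "shuffle_sum P_rev u v = shuffle_sum (\<lambda>w. finsum A (\<lambda>(w1, w2). rev_prod w1 w2) (fsplits w)) u v"
      by (intro shuffle_sum_cong) (simp add: P_rev_splits homog_list_mset uv)
    also have "\<dots> = finsum A (\<lambda>(u1, u2). finsum A (\<lambda>(v1, v2). deconc_term rev_prod u1 u2 v1 v2) (fsplits v)) (fsplits u)"
      by (rule shuffle_sum_deconcatenation) simp
    also have "\<dots> = finsum A (\<lambda>p. finsum A (\<lambda>q. ?D (p, q)) (fsplits v)) (fsplits u)"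
      by (simp add: case_prod_unfold)
    also have "\<dots> = finsum A (\<lambda>(p, q). ?D (p, q)) (fsplits u \<times> fsplits v)"
      by (rule finsum_Sigma) auto
    also have "\<dots> = finsum A ?D ?T"
      unfolding case_prod_eta
    proof (rule finsum_mono_neutral[OF finite_cartesian_product[OF finite_fsplits finite_fsplits]])
      fix x assume x: "x \<in> fsplits u \<times> fsplits v - ?T"
      obtain u1 u2 v1 v2 where e: "x = ((u1, u2), (v1, v2))" by (cases x) auto
      have u: "u = u1 @ u2" "v = v1 @ v2" using x e by (auto simp: fsplits_def)
      have hom: "homog_list A u1" "homog_list A u2" "homog_list A v1" "homog_list A v2" using uv u by auto
      have "shuffle_sum F_rev u2 v2 = \<zero> \<or> shuffle_sum F_rev u1 v1 = \<zero>"
      proof (cases "u2 \<noteq> [] \<and> v2 \<noteq> [] \<and> (u1 \<noteq> [] \<or> v1 \<noteq> [])")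
        case True
        then have "length u2 + length v2 < length u + length v" using u by auto
        then show ?thesis using IH[of u2 v2] True hom by blast
      next
        case False
        note F = this
        show ?thesis
        proof (cases "u1 \<noteq> [] \<and> v1 \<noteq> [] \<and> (u2 \<noteq> [] \<or> v2 \<noteq> [])")
          case True
          then have "length u1 + length v1 < length u + length v" using u by auto
          then show ?thesis using IH[of u1 v1] True hom by blast
        next
          case False
          have "(u1 = [] \<and> v1 = []) \<or> (u2 = [] \<and> v2 = [])"
            using F False uv(3,4) u x e by auto
          then show ?thesis by auto
        qed
      qed
      then show "?D x = \<zero>" unfolding e using deconc_term_rev_prod[OF hom] by auto
    qed (auto simp: fsplits_def)
    also have "\<dots> = deconc_term rev_prod [] u v [] \<oplus> deconc_term rev_prod u [] [] v"
      using uv by simp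
    also have "\<dots> = \<zero>"
    proof -
      let ?a = "tdeg u + 1 - int (length u)" and ?b = "tdeg v + 1 - int (length v)"
      let ?s = "cross u v + rev_sign v u" and ?t = "rev_sign u v"
      have gr: "F_rev u \<in> grade A ?a" "F_rev v \<in> grade A ?b" using F_rev_grade uv by auto
      have "deconc_term rev_prod [] u v [] = [par ?s] \<cdot> (F_rev u \<otimes> F_rev v)"
        using uv by (subst deconc_term_rev_prod) auto
      moreover have "deconc_term rev_prod u [] [] v = [par ?t] \<cdot> (F_rev v \<otimes> F_rev u)"
        using uv by (subst deconc_term_rev_prod) (auto simp: cross_def)
      moreover have "F_rev v \<otimes> F_rev u = [par (?a * ?b)] \<cdot> (F_rev u \<otimes> F_rev v)"
        by (rule graded_comm[OF gr])
      \<comment> \<open>The sign from crossing the words and the sign from commuting the factors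
        leave the two products with opposite signs.\<close>
      moreover have "par ?s = par (?t + ?a * ?b + 1)"
        by (rule par_eqI) (simp add: cross_def rev_sign_def, argo)
      ultimately show ?thesis by (auto simp: par_pow_par_pow par_pow r_neg l_neg)
    qed
    finally show ?thesis .
  qed
  have F: "shuffle_sum F_rev u v = \<zero>" if uv: "homog_list A u" "homog_list A v" "u \<noteq> []" "v \<noteq> []" and P: "shuffle_sum P_rev u v = \<zero>"
  proof -
    have "shuffle_sum F_rev u v = shuffle_sum (\<lambda>w. \<ominus> (h (P_rev w))) u v"
    proof (intro shuffle_sum_cong F_rev_P_rev)
      fix w assume "mset w = mset u + mset v"
      from length_mset[OF this] show "2 \<le> length w" using uv by (cases u; cases v) auto
    qed
    also have "\<dots> = \<ominus> (h (shuffle_sum P_rev u v))"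
      by (rule shuffle_sum_additive_hom[OF abelian_group_axioms abelian_group_axioms]) (auto simp: h_add minus_add a_comm)
    finally show ?thesis using P by simp
  qed
  { case 1 show ?case by (rule P) (use 1 less.hyps(2) in auto) }
  { case 2
    have "shuffle_sum P_rev u v = \<zero>" by (rule P) (use 2 less.hyps(2) in auto)
    with 2 show ?case by (intro F) auto }
qed

text \<open>Any additive function of \<open>P_rev\<close> inherits its vanishing on shuffles. Both
  transferred families have this form, with minus \<open>h\<close> for the morphism and
  \<open>pr\<close> for the operations.\<close>

lemma perm_sum_rev:
  assumes i: "i < length ps" "0 < i" and hom: "homog_list A ps" and g: "\<And>w. g w \<in> carrier A"
    and eq: "\<And>w. mset w = mset ps \<Longrightarrow> g w = f (P_rev (rev w))" and f: "f \<in> carrier A \<rightarrow> carrier A"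
    and add: "\<And>x y. x \<in> carrier A \<Longrightarrow> y \<in> carrier A \<Longrightarrow> f (x \<oplus> y) = f x \<oplus> f y"
  shows "perm_sum g i ps = \<zero>"
proof -
  let ?u = "take i ps" and ?v = "drop i ps"
  have "homog_list A (?u @ ?v)" using hom by simp
  then have h': "homog_list A ?u" "homog_list A ?v" unfolding homog_list_append by auto
  have l: "length ?u = i" using i by simp
  have "perm_sum g i ps = shuffle_sum (\<lambda>w. g (rev w)) (rev ?v) (rev ?u)"
    using perm_sum_shuffle_sum[of g ?u ?v] g l by simp
  also have "\<dots> = shuffle_sum (\<lambda>w. f (P_rev w)) (rev ?v) (rev ?u)"
  proof (intro shuffle_sum_cong)
    fix w assume "mset w = mset (rev ?v) + mset (rev ?u)"
    then have "mset w = mset ?u + mset ?v" by (simp add: add.commute)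
    then have "mset (rev w) = mset ps" by (simp only: mset_rev mset_append[symmetric] append_take_drop_id)
    then show "g (rev w) = f (P_rev w)" using eq by simp
  qed
  also have "\<dots> = f (shuffle_sum P_rev (rev ?v) (rev ?u))"
    by (rule shuffle_sum_additive_hom[OF abelian_group_axioms abelian_group_axioms f add]) auto
  also have "shuffle_sum P_rev (rev ?v) (rev ?u) = \<zero>"
    by (rule shuffle_sum_P_rev) (use h' i in auto)
  also have "f \<zero> = \<zero>" by (rule additive_map_zero_minus(1)[OF abelian_group_axioms abelian_group_axioms f add])
  finally show ?thesis .
qed

lemma permute_list_elts:
  "\<sigma> permutes {..<length ps} \<Longrightarrow> permute_list (inv_into UNIV \<sigma>) (elts ps) = elts (permute_list (inv_into UNIV \<sigma>) ps)"
  using permute_list_map[OF permutes_inv] by metis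

lemma mset_permute_inv: "\<sigma> permutes {..<length ps} \<Longrightarrow> mset (permute_list (inv_into UNIV \<sigma>) ps) = mset ps"
  by (rule mset_permute_list[OF permutes_inv])

lemma vanishes_on_shuffles_f_min: "vanishes_on_shuffles H A f_min"
  unfolding vanishes_on_shuffles_def
proof (intro allI impI, elim conjE)
  fix ps i assume ps: "homog_list H ps" and i: "0 < i" "i < length ps"
  have psA: "homog_list A ps" by (rule homog_list_H[OF ps])
  \<comment> \<open>Set to zero away from the rearrangements of \<open>ps\<close>, so that the value
    lies in the carrier for every word; on the permuted words in the sum nothing changes.\<close>
  let ?g = "\<lambda>w. if mset w = mset ps then f_min (elts w) else \<zero>"
  have hom: "homog_list A w" if "mset w = mset ps" for w using psA that homog_list_mset[of w ps "[]" A] by simp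
  have "perm_sum ?g i ps = \<zero>"
  proof (rule perm_sum_rev[OF i(2,1) psA, where f = "\<lambda>x. \<ominus> (h x)"])
    show "?g w \<in> carrier A" for w using f_min_closed[OF homog_list_carrier[OF hom]] by simp
    show "?g w = \<ominus> (h (P_rev (rev w)))" if "mset w = mset ps" for w
    proof -
      have "length w = length ps" using that by (metis size_mset)
      then show ?thesis using that hom[OF that] i by (simp add: P_rev_def f_min_p_min)
    qed
  qed (auto simp: h_add minus_add a_comm)
  moreover have "perm_sum ?g i ps = (\<Oplus>\<sigma>\<in>shuffle_perms i (length ps).
      [(sign \<sigma> * koszul_sign \<sigma> (map fst ps))] \<cdot> f_min (permute_list (inv_into UNIV \<sigma>) (elts ps)))"
    unfolding perm_sum_def
  proof (intro finsum_cong_on refl)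
    fix \<sigma> assume "\<sigma> \<in> shuffle_perms i (length ps)"
    then have "\<sigma> permutes {..<length ps}" by (simp add: shuffle_perms_def)
    then show "[(sign \<sigma> * koszul_sign \<sigma> (map fst ps))] \<cdot> ?g (permute_list (inv_into UNIV \<sigma>) ps) =
      [(sign \<sigma> * koszul_sign \<sigma> (map fst ps))] \<cdot> f_min (permute_list (inv_into UNIV \<sigma>) (elts ps))"
      by (simp add: permute_list_elts mset_permute_inv)
  qed
  ultimately show "(\<Oplus>\<sigma>\<in>shuffle_perms i (length ps).
      [(sign \<sigma> * koszul_sign \<sigma> (map fst ps))] \<cdot> f_min (permute_list (inv_into UNIV \<sigma>) (elts ps))) = \<zero>" by simp
qed

lemma vanishes_on_shuffles_m_min: "vanishes_on_shuffles H H m_min"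
  unfolding vanishes_on_shuffles_def
proof (intro allI impI, elim conjE)
  fix ps i assume ps: "homog_list H ps" and i: "0 < i" "i < length ps"
  have psA: "homog_list A ps" by (rule homog_list_H[OF ps])
  let ?g = "\<lambda>w. if mset w = mset ps then m_min (elts w) else \<zero>"
  have hom: "homog_list A w" if "mset w = mset ps" for w using psA that homog_list_mset[of w ps "[]" A] by simp
  have "perm_sum ?g i ps = \<zero>"
  proof (rule perm_sum_rev[OF i(2,1) psA, where f = pr])
    show "?g w \<in> carrier A" for w using m_min_H[OF homog_list_carrier[OF hom]] by simp
    show "?g w = pr (P_rev (rev w))" if "mset w = mset ps" for w
    proof -
      have "w \<noteq> []" using that i by auto
      then show ?thesis using that hom[OF that] i by (simp add: P_rev_def m_min_p_min)
    qed
  qed (auto simp: pr_add)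
  moreover have "perm_sum ?g i ps = (\<Oplus>\<^bsub>H\<^esub>\<sigma>\<in>shuffle_perms i (length ps).
      [(sign \<sigma> * koszul_sign \<sigma> (map fst ps))] \<cdot>\<^bsub>H\<^esub> m_min (permute_list (inv_into UNIV \<sigma>) (elts ps)))"
  proof -
    have trm: "[(sign \<sigma> * koszul_sign \<sigma> (map fst ps))] \<cdot>\<^bsub>H\<^esub> m_min (permute_list (inv_into UNIV \<sigma>) (elts ps)) =
        [(sign \<sigma> * koszul_sign \<sigma> (map fst ps))] \<cdot> ?g (permute_list (inv_into UNIV \<sigma>) ps)"
      "[(sign \<sigma> * koszul_sign \<sigma> (map fst ps))] \<cdot>\<^bsub>H\<^esub> m_min (permute_list (inv_into UNIV \<sigma>) (elts ps)) \<in> carrier H"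
      if "\<sigma> \<in> shuffle_perms i (length ps)" for \<sigma>
    proof -
      have p: "\<sigma> permutes {..<length ps}" using that by (simp add: shuffle_perms_def)
      have mH: "m_min (elts (permute_list (inv_into UNIV \<sigma>) ps)) \<in> carrier H"
        by (rule m_min_H[OF homog_list_carrier[OF hom[OF mset_permute_inv[OF p]]]])
      obtain e where e: "sign \<sigma> * koszul_sign \<sigma> (map fst ps) = par e" using sign_koszul_par by blast
      show "[(sign \<sigma> * koszul_sign \<sigma> (map fst ps))] \<cdot>\<^bsub>H\<^esub> m_min (permute_list (inv_into UNIV \<sigma>) (elts ps)) =
        [(sign \<sigma> * koszul_sign \<sigma> (map fst ps))] \<cdot> ?g (permute_list (inv_into UNIV \<sigma>) ps)"
        "[(sign \<sigma> * koszul_sign \<sigma> (map fst ps))] \<cdot>\<^bsub>H\<^esub> m_min (permute_list (inv_into UNIV \<sigma>) (elts ps)) \<in> carrier H"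
        unfolding e permute_list_elts[OF p] using mH mset_permute_inv[OF p] by (simp_all add: H_par)
    qed
    show ?thesis unfolding perm_sum_def
      by (subst H_finsum[OF trm(2)]) (auto intro!: finsum_cong_on simp: trm(1))
  qed
  ultimately show "(\<Oplus>\<^bsub>H\<^esub>\<sigma>\<in>shuffle_perms i (length ps).
      [(sign \<sigma> * koszul_sign \<sigma> (map fst ps))] \<cdot>\<^bsub>H\<^esub> m_min (permute_list (inv_into UNIV \<sigma>) (elts ps))) = \<zero>\<^bsub>H\<^esub>" by simp
qed

lemma minimal_unital_cinf_algebra_H: "minimal_unital_cinf_algebra K H m_min"
proof (intro minimal_unital_cinf_algebra.intro unital_cinf_algebra.intro unital_cinf_algebra_axioms.intro
    minimal_unital_cinf_algebra_axioms.intro graded_vector_space_H multilinear_maps_m_min has_degrees_m_min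
    stasheff_m_min vanishes_on_shuffles_m_min)
  show "\<one>\<^bsub>H\<^esub> \<in> grade H 0" using one_grade by (simp add: H_grade)
  show "m_min [\<one>\<^bsub>H\<^esub>, x] = x" "m_min [x, \<one>\<^bsub>H\<^esub>] = x" if "x \<in> carrier H" for x
    using that by (simp_all add: m_min_pair)
  show "m_min xs = \<zero>\<^bsub>H\<^esub>" if "xs \<in> lists (carrier H)" "\<one>\<^bsub>H\<^esub> \<in> set xs" "3 \<le> length xs" for xs
    using m_min_unit[of xs] that by (auto simp: in_lists_conv_set)
qed simp_all

end

section \<open>DGCAs as C-infinity algebras\<close>

lemma dgca_ops_long: "3 \<le> length xs \<Longrightarrow> dgca_ops A d xs = \<zero>\<^bsub>A\<^esub>"
  by (cases "(A, d, xs)" rule: dgca_ops.cases) auto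

context graded_comm_alg
begin

lemma dgca_ops_closed: "set xs \<subseteq> carrier A \<Longrightarrow> dgca_ops A d xs \<in> carrier A"
  by (cases "(A, d, xs)" rule: dgca_ops.cases) auto

lemma dgca_ops_zero: "set us \<subseteq> carrier A \<Longrightarrow> set ws \<subseteq> carrier A \<Longrightarrow> dgca_ops A d (us @ [\<zero>] @ ws) = \<zero>"
  by (cases "(A, d, us @ [\<zero>] @ ws)" rule: dgca_ops.cases) (auto simp: append_eq_Cons_conv Cons_eq_append_conv)

lemma multilinear_maps_dgca_ops: "multilinear_maps K A A (dgca_ops A d)"
  unfolding multilinear_maps_def
proof (intro ballI)
  fix us vs assume c: "us \<in> lists (carrier A)" "vs \<in> lists (carrier A)"
  consider "us = []" "vs = []" | y where "us = [y]" "vs = []" | y where "us = []" "vs = [y]"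
    | "3 \<le> length us + length vs + 1"
    by (cases us; cases vs; cases "tl us"; cases "tl vs") auto
  then show "linear_map K A A (\<lambda>x. dgca_ops A d (us @ [x] @ vs))"
  proof cases
    case 1 then show ?thesis using d_linear by simp
  next
    case 2 then show ?thesis using c linear_map_mult_left[OF linear_map_id, of y] by simp
  next
    case 3 then show ?thesis using c linear_map_mult_right[OF linear_map_id, of y] by simp
  next
    case 4 then show ?thesis by (simp add: dgca_ops_long linear_map_zero)
  qed
qed

lemma has_degrees_dgca_ops: "has_degrees A A 2 (dgca_ops A d)"
  unfolding has_degrees_def
proof (intro allI impI, elim conjE)
  fix ps :: "(int \<times> 'a) list" assume ps: "ps \<noteq> []" "homog_list A ps"
  consider p where "ps = [p]" | p q where "ps = [p, q]" | "3 \<le> length ps"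
    using ps(1) by (cases ps; cases "tl ps"; cases "tl (tl ps)") auto
  then show "dgca_ops A d (elts ps) \<in> grade A (tdeg ps + 2 - int (length ps))"
  proof cases
    case 1 then show ?thesis using ps by (cases p) (auto dest: d_grade simp: add.commute)
  next
    case 2 then show ?thesis using ps by (cases p; cases q) (auto simp: mult_grade)
  next
    case 3 then show ?thesis by (simp add: dgca_ops_long)
  qed
qed

lemma insertions_1: "insertions [p] = {([], [p], [])}"
  and insertions_2: "insertions [p, q] = {([], [p], [q]), ([p], [q], []), ([], [p, q], [])}"
  by (auto simp: insertions_def append_eq_Cons_conv Cons_eq_append_conv)

text \<open>In arity one the relation is \<open>d d = 0\<close>, in arity two the Leibniz rule, in
  arity three associativity. From arity four on, the inner or the outer operation of every term has
  arity at least three.\<close>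

lemma stasheff_dgca_ops: "stasheff A (dgca_ops A d)"
  unfolding stasheff_def
proof (intro allI impI, elim conjE)
  fix ps :: "(int \<times> 'a) list" assume ps: "ps \<noteq> []" "homog_list A ps"
  note c = homog_list_carrier[OF ps(2)]
  let ?m = "dgca_ops A d"
  let ?s = "\<lambda>us vs ws :: (int \<times> 'a) list. par (int (length us) + int (length vs) * int (length ws) + (2 - int (length vs)) * tdeg us)"
  let ?t = "\<lambda>us vs ws. ?m (elts us @ [?m (elts vs)] @ elts ws)"
  have eq: "insertion_sum A ?m ?m ps = finsum A (\<lambda>(us, vs, ws). [?s us vs ws] \<cdot> ?t us vs ws) (insertions ps)"
    by (simp add: insertion_sum_def insertions_def)
  \<comment> \<open>The outer operation takes \<open>length us + length ws + 1\<close> arguments,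
    the inserted value counting as one.\<close>
  have van: "?t us vs ws = \<zero>" if "us @ vs @ ws = ps" "3 \<le> length vs \<or> 3 \<le> length us + length ws + 1" for us vs ws
  proof (cases "3 \<le> length vs")
    case True
    have "set (elts us) \<subseteq> carrier A" "set (elts ws) \<subseteq> carrier A"
      using c that(1)[symmetric] by (simp_all add: image_Un)
    then show ?thesis using dgca_ops_zero[of "elts us" "elts ws"] True by (simp add: dgca_ops_long)
  next
    case False then show ?thesis using that by (intro dgca_ops_long) auto
  qed
  consider p where "ps = [p]" | p q where "ps = [p, q]" | p q r where "ps = [p, q, r]" | "4 \<le> length ps"
    using ps(1) by (cases ps; cases "tl ps"; cases "tl (tl ps)"; cases "tl (tl (tl ps))") auto
  then show "insertion_sum A ?m ?m ps = \<zero>"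
  proof cases
    case 1
    then show ?thesis unfolding eq using c by (simp add: insertions_1 d_d int_pow_pm1)
  next
    case 2
    obtain e x f y where pq: "p = (e, x)" "q = (f, y)" by (cases p; cases q)
    have xy: "x \<in> carrier A" "y \<in> carrier A" "x \<in> grade A e" using c ps 2 pq by auto
    have "insertion_sum A ?m ?m ps = \<ominus> (d x \<otimes> y) \<oplus> ([par (1 + e)] \<cdot> (x \<otimes> d y) \<oplus> d (x \<otimes> y))"
      using xy unfolding eq unfolding 2 pq insertions_2 by (simp add: int_pow_pm1)
    also have "\<dots> = \<zero>"
      using xy by (auto simp: leibniz par_pow minus_add a_ac r_neg l_neg r_neg1 r_neg2)
    finally show ?thesis .
  next
    case 3
    obtain e x f y g z where pq: "p = (e, x)" "q = (f, y)" "r = (g, z)" by (cases p; cases q; cases r)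
    have xyz: "x \<in> carrier A" "y \<in> carrier A" "z \<in> carrier A" using c 3 pq by auto
    let ?T = "{([], [p, q], [r]), ([p], [q, r], [])}"
    have "insertion_sum A ?m ?m ps = finsum A (\<lambda>(us, vs, ws). [?s us vs ws] \<cdot> ?t us vs ws) ?T"
      unfolding eq
    proof (rule finsum_mono_neutral[OF finite_insertions])
      fix i assume i: "i \<in> insertions ps - ?T"
      obtain us vs ws where e: "i = (us, vs, ws)" by (cases i)
      then have w: "us @ vs @ ws = [p, q, r]" "vs \<noteq> []" using i 3 by (auto simp: insertions_def)
      have "length us + length vs + length ws = 3" using arg_cong[OF w(1), of length] by simp
      moreover have "length vs \<noteq> 2"
        using w i e by (auto simp: append_eq_Cons_conv Cons_eq_append_conv)
      ultimately have "3 \<le> length vs \<or> 3 \<le> length us + length ws + 1" using w(2) by (cases vs) auto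
      then show "(case i of (us, vs, ws) \<Rightarrow> [?s us vs ws] \<cdot> ?t us vs ws) = \<zero>"
        using van[of us vs ws] w 3 by (simp add: e)
    qed (use 3 pq xyz in \<open>auto simp: insertions_def\<close>)
    also have "\<dots> = (x \<otimes> y) \<otimes> z \<oplus> \<ominus> (x \<otimes> (y \<otimes> z))"
      using xyz by (simp add: pq par_def int_pow_pm1)
    finally show ?thesis using xyz by (simp add: m_assoc r_neg)
  next
    case 4
    show ?thesis unfolding eq
    proof (rule finsum_all_zero, clarify)
      fix us vs ws assume w: "(us, vs, ws) \<in> insertions ps"
      have "length us + length vs + length ws = length ps" using arg_cong[OF insertionsD(4)[OF w], of length] by simp
      then have "3 \<le> length vs \<or> 3 \<le> length us + length ws + 1" using 4 by linarith
      then show "[?s us vs ws] \<cdot> ?t us vs ws = \<zero>"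
        using van[OF insertionsD(4)[OF w]] by simp
    qed
  qed
qed

text \<open>Only arity two is at stake, where the signed sum over the two shuffles is the graded
  commutator.\<close>

lemma vanishes_on_shuffles_dgca_ops: "vanishes_on_shuffles A A (dgca_ops A d)"
  unfolding vanishes_on_shuffles_def
proof (intro allI impI, elim conjE)
  fix ps :: "(int \<times> 'a) list" and i assume ps: "homog_list A ps" and i: "0 < i" "i < length ps"
  let ?t = "\<lambda>\<sigma>. [(sign \<sigma> * koszul_sign \<sigma> (map fst ps))] \<cdot> dgca_ops A d (permute_list (inv_into UNIV \<sigma>) (elts ps))"
  show "finsum A ?t (shuffle_perms i (length ps)) = \<zero>"
  proof (cases "3 \<le> length ps")
    case True
    show ?thesis
    proof (rule finsum_all_zero)
      fix \<sigma>
      obtain e where e: "sign \<sigma> * koszul_sign \<sigma> (map fst ps) = par e" using sign_koszul_par by blast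
      show "?t \<sigma> = \<zero>" unfolding e using True by (subst dgca_ops_long) simp_all
    qed
  next
    case False
    then obtain p q where pq: "ps = [p, q]" using i by (cases ps; cases "tl ps"; cases "tl (tl ps)") auto
    obtain e x f y where p: "p = (e, x)" "q = (f, y)" by (cases p; cases q)
    have xy: "x \<in> grade A e" "y \<in> grade A f" "x \<in> carrier A" "y \<in> carrier A" using ps pq p grade_carrier by auto
    let ?g = "\<lambda>w. if mset w = mset ps then dgca_ops A d (elts w) else \<zero>"
    have "homog_list A w" if "mset w = mset ps" for w using ps that homog_list_mset[of w ps "[]" A] by simp
    then have g: "?g w \<in> carrier A" for w using dgca_ops_closed[OF homog_list_carrier] by simp
    have "finsum A ?t (shuffle_perms i (length ps)) = perm_sum ?g (length [p]) ([p] @ [q])"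
      unfolding perm_sum_def
    proof (rule finsum_cong_on)
      show "shuffle_perms i (length ps) = shuffle_perms (length [p]) (length ([p] @ [q]))" using i pq by (auto simp: less_Suc_eq)
      fix \<sigma> assume "\<sigma> \<in> shuffle_perms (length [p]) (length ([p] @ [q]))"
      then have s: "\<sigma> permutes {..<length ps}" using pq by (simp add: shuffle_perms_def)
      have "mset (permute_list (inv_into UNIV \<sigma>) ps) = mset ps" by (rule mset_permute_list[OF permutes_inv[OF s]])
      moreover have "permute_list (inv_into UNIV \<sigma>) (elts ps) = elts (permute_list (inv_into UNIV \<sigma>) ps)"
        by (rule permute_list_map[OF permutes_inv[OF s]])
      ultimately show "?t \<sigma> = [(sign \<sigma> * koszul_sign \<sigma> (map fst ([p] @ [q])))] \<cdot> ?g (permute_list (inv_into UNIV \<sigma>) ([p] @ [q]))"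
        using pq by simp
    qed
    also have "\<dots> = x \<otimes> y \<oplus> [par (f * e + 1)] \<cdot> (y \<otimes> x)"
      by (subst perm_sum_shuffle_sum) (use g in \<open>auto simp: pq p cross_def\<close>)
    also have "\<dots> = \<zero>"
      using graded_comm[OF xy(1,2)] xy(3,4) by (auto simp: par_pow_par_pow par_pow r_neg mult.commute)
    finally show ?thesis .
  qed
qed

lemma unital_cinf_algebra_dgca_ops: "unital_cinf_algebra K A (dgca_ops A d)"
proof (intro unital_cinf_algebra.intro unital_cinf_algebra_axioms.intro graded_vector_space_axioms
    multilinear_maps_dgca_ops has_degrees_dgca_ops stasheff_dgca_ops vanishes_on_shuffles_dgca_ops one_grade)
qed (auto simp: dgca_ops_long)

end

section \<open>Cohomology\<close>

text \<open>Only the additive structure enters cohomology classes and induced maps, so the same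
  lemmas serve \<open>A\<close>, the harmonic space with zero differential and the cohomology
  itself.\<close>

locale cochain_complex = abelian_group V for V :: "('k, 'a) graded_alg" (structure) +
  fixes d :: "'a \<Rightarrow> 'a"
  assumes diff_closed [simp]: "x \<in> carrier V \<Longrightarrow> d x \<in> carrier V"
    and diff_add: "x \<in> carrier V \<Longrightarrow> y \<in> carrier V \<Longrightarrow> d (x \<oplus> y) = d x \<oplus> d y"
    and diff_diff [simp]: "x \<in> carrier V \<Longrightarrow> d (d x) = \<zero>"
begin

lemma diff_zero [simp]: "d \<zero> = \<zero>" and diff_minus: "x \<in> carrier V \<Longrightarrow> d (\<ominus> x) = \<ominus> (d x)"
  by (rule additive_map_zero_minus[of V V]; auto simp: abelian_group_axioms diff_add)+

lemma coboundaries_ops: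
  "\<zero> \<in> coboundaries V d"
  "x \<in> coboundaries V d \<Longrightarrow> y \<in> coboundaries V d \<Longrightarrow> x \<oplus> y \<in> coboundaries V d"
  "x \<in> coboundaries V d \<Longrightarrow> \<ominus> x \<in> coboundaries V d"
  "x \<in> coboundaries V d \<Longrightarrow> x \<in> cocycles V d"
  "x \<in> coboundaries V d \<Longrightarrow> x \<in> carrier V"
proof -
  show "\<zero> \<in> coboundaries V d" using diff_zero unfolding coboundaries_def by (metis imageI zero_closed)
  show "x \<in> coboundaries V d \<Longrightarrow> y \<in> coboundaries V d \<Longrightarrow> x \<oplus> y \<in> coboundaries V d"
    unfolding coboundaries_def by (auto simp: diff_add[symmetric])
  show "x \<in> coboundaries V d \<Longrightarrow> \<ominus> x \<in> coboundaries V d"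
    unfolding coboundaries_def by (auto simp: diff_minus[symmetric])
qed (auto simp: coboundaries_def cocycles_def)

lemma coh_class_eq: "coh_class V d x = {b \<oplus> x | b. b \<in> coboundaries V d}"
  by (auto simp: coh_class_def a_r_coset_def' )

lemma coh_class_self: "x \<in> carrier V \<Longrightarrow> x \<in> coh_class V d x"
  unfolding coh_class_eq using coboundaries_ops(1) by force

lemma coh_class_eq_iff:
  assumes x: "x \<in> carrier V" and y: "y \<in> carrier V"
  shows "coh_class V d x = coh_class V d y \<longleftrightarrow> x \<ominus> y \<in> coboundaries V d"
proof
  assume "coh_class V d x = coh_class V d y"
  then have "x \<in> coh_class V d y" using coh_class_self[OF x] by simp
  then obtain b where b: "b \<in> coboundaries V d" "x = b \<oplus> y" by (auto simp: coh_class_eq)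
  then have "x \<ominus> y = b" using y coboundaries_ops(5) by (simp add: a_minus_def a_assoc r_neg)
  then show "x \<ominus> y \<in> coboundaries V d" using b by simp
next
  have *: "coh_class V d x \<subseteq> coh_class V d y" if "x \<in> carrier V" "y \<in> carrier V" "x \<ominus> y \<in> coboundaries V d" for x y
  proof
    fix z assume "z \<in> coh_class V d x"
    then obtain b where b: "b \<in> coboundaries V d" "z = b \<oplus> x" by (auto simp: coh_class_eq)
    have "z = (b \<oplus> (x \<ominus> y)) \<oplus> y"
      using that b coboundaries_ops(5)[OF b(1)] by (simp add: a_minus_def a_assoc l_neg)
    then show "z \<in> coh_class V d y" unfolding coh_class_eq using coboundaries_ops(2)[OF b(1) that(3)] by blast
  qed
  assume a: "x \<ominus> y \<in> coboundaries V d"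
  have "y \<ominus> x = \<ominus> (x \<ominus> y)" using x y by (simp add: a_minus_def minus_add a_comm)
  then have "y \<ominus> x \<in> coboundaries V d" using coboundaries_ops(3)[OF a] by simp
  then show "coh_class V d x = coh_class V d y" using * a x y by blast
qed

lemma coh_class_member:
  "x \<in> carrier V \<Longrightarrow> y \<in> coh_class V d x \<Longrightarrow> y \<in> carrier V \<and> coh_class V d y = coh_class V d x"
proof -
  assume x: "x \<in> carrier V" and y: "y \<in> coh_class V d x"
  then obtain b where b: "b \<in> coboundaries V d" "y = b \<oplus> x" by (auto simp: coh_class_eq)
  then have "y \<in> carrier V" "y \<ominus> x = b" using x coboundaries_ops(5)[OF b(1)] by (auto simp: a_minus_def a_assoc r_neg)
  then show ?thesis using x b coh_class_eq_iff by metis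
qed

lemma coh_class_zero: "x \<in> carrier V \<Longrightarrow> coh_class V d x = coh_class V d \<zero> \<longleftrightarrow> x \<in> coboundaries V d"
proof -
  assume x: "x \<in> carrier V"
  have "\<ominus> \<zero> = \<zero>" by (rule minus_equality) simp_all
  then have "x \<ominus> \<zero> = x" using x by (simp only: a_minus_def r_zero)
  then show ?thesis using coh_class_eq_iff[OF x zero_closed] by (simp only:)
qed

lemma coboundaries_coh_class: "coboundaries V d = coh_class V d \<zero>"
  using coboundaries_ops(5) by (force simp: coh_class_eq)

end

lemma carrier_cohomology: "carrier (cohomology V d) = coh_class V d ` cocycles V d"
  by (auto simp: cohomology_def Let_def FactRing_def A_RCOSETS_def' coh_class_def a_r_coset_def')

text \<open>The induced map is defined as a union over all representatives of a class. For a chain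
  map these all have the same image class, so one representative suffices, and bijectivity becomes
  two conditions on cocycles.\<close>

lemma iso_on_cohomologyI:
  assumes V: "cochain_complex V d" and W: "cochain_complex W e"
    and f: "f \<in> carrier V \<rightarrow> carrier W"
    and add: "\<And>x y. x \<in> carrier V \<Longrightarrow> y \<in> carrier V \<Longrightarrow> f (x \<oplus>\<^bsub>V\<^esub> y) = f x \<oplus>\<^bsub>W\<^esub> f y"
    and chain: "\<And>x. x \<in> carrier V \<Longrightarrow> f (d x) = e (f x)"
    and inj: "\<And>x. x \<in> carrier V \<Longrightarrow> d x = \<zero>\<^bsub>V\<^esub> \<Longrightarrow> f x \<in> coboundaries W e \<Longrightarrow> x \<in> coboundaries V d"
    and surj: "\<And>y. y \<in> carrier W \<Longrightarrow> e y = \<zero>\<^bsub>W\<^esub> \<Longrightarrow>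
      \<exists>x z. x \<in> carrier V \<and> d x = \<zero>\<^bsub>V\<^esub> \<and> z \<in> carrier W \<and> y = f x \<oplus>\<^bsub>W\<^esub> e z"
  shows "iso_on_cohomology V d W e f"
proof -
  interpret V: cochain_complex V d by fact
  interpret W: cochain_complex W e by fact
  have fc: "f x \<in> carrier W" if "x \<in> carrier V" for x using f that by auto
  have fz: "f \<zero>\<^bsub>V\<^esub> = \<zero>\<^bsub>W\<^esub>" and fm: "\<And>x. x \<in> carrier V \<Longrightarrow> f (\<ominus>\<^bsub>V\<^esub> x) = \<ominus>\<^bsub>W\<^esub> f x"
    using additive_map_zero_minus[OF V.abelian_group_axioms W.abelian_group_axioms f add] by auto
  have fsub: "f (x \<ominus>\<^bsub>V\<^esub> y) = f x \<ominus>\<^bsub>W\<^esub> f y" if "x \<in> carrier V" "y \<in> carrier V" for x y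
    using that by (simp add: a_minus_def add fm)
  have cm: "coh_map W e f (coh_class V d x) = coh_class W e (f x)" if x: "x \<in> carrier V" for x
  proof -
    have "coh_class W e (f y) = coh_class W e (f x)" if "y \<in> coh_class V d x" for y
    proof -
      have y: "y \<in> carrier V" "y \<ominus>\<^bsub>V\<^esub> x \<in> coboundaries V d"
        using V.coh_class_member[OF x that] V.coh_class_eq_iff x by auto
      then obtain z where "z \<in> carrier V" "y \<ominus>\<^bsub>V\<^esub> x = d z" by (auto simp: coboundaries_def)
      then have "f y \<ominus>\<^bsub>W\<^esub> f x = e (f z)" "f z \<in> carrier W"
        using fsub[OF y(1) x] chain[of z] fc by auto
      then have "f y \<ominus>\<^bsub>W\<^esub> f x \<in> coboundaries W e" by (simp add: coboundaries_def)
      then show ?thesis using W.coh_class_eq_iff[OF fc fc] x y by blast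
    qed
    note const = this
    show ?thesis unfolding coh_map_def
    proof (rule SUP_eq_const)
      show "coh_class V d x \<noteq> {}" using V.coh_class_self[OF x] by blast
    qed (rule const)
  qed
  have coc: "x \<in> cocycles V d \<longleftrightarrow> x \<in> carrier V \<and> d x = \<zero>\<^bsub>V\<^esub>" for x by (auto simp: cocycles_def)
  show ?thesis unfolding iso_on_cohomology_def carrier_cohomology
  proof (rule bij_betw_imageI)
    show "inj_on (coh_map W e f) (coh_class V d ` cocycles V d)"
    proof (rule inj_onI, clarify)
      fix x y assume x: "x \<in> cocycles V d" and y: "y \<in> cocycles V d"
        and eq: "coh_map W e f (coh_class V d x) = coh_map W e f (coh_class V d y)"
      have c: "x \<in> carrier V" "y \<in> carrier V" "x \<ominus>\<^bsub>V\<^esub> y \<in> carrier V" using x y by (auto simp: coc)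
      have "f x \<ominus>\<^bsub>W\<^esub> f y \<in> coboundaries W e" using eq cm[OF c(1)] cm[OF c(2)] W.coh_class_eq_iff[OF fc[OF c(1)] fc[OF c(2)]] by simp
      moreover have "d (x \<ominus>\<^bsub>V\<^esub> y) = \<zero>\<^bsub>V\<^esub>"
        using x y c by (simp add: a_minus_def V.diff_add V.diff_minus coc)
      ultimately have "x \<ominus>\<^bsub>V\<^esub> y \<in> coboundaries V d" using c fsub[OF c(1,2)] by (intro inj) auto
      then show "coh_class V d x = coh_class V d y" using V.coh_class_eq_iff[OF c(1,2)] by simp
    qed
    show "coh_map W e f ` coh_class V d ` cocycles V d = coh_class W e ` cocycles W e"
    proof (intro equalityI subsetI)
      fix X assume "X \<in> coh_map W e f ` coh_class V d ` cocycles V d"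
      then obtain x where "x \<in> cocycles V d" "X = coh_class W e (f x)" using cm coc by auto
      moreover from this have "f x \<in> cocycles W e" using chain[of x] fz fc by (auto simp: coc cocycles_def)
      ultimately show "X \<in> coh_class W e ` cocycles W e" by auto
    next
      fix Y assume "Y \<in> coh_class W e ` cocycles W e"
      then obtain y where y: "y \<in> carrier W" "e y = \<zero>\<^bsub>W\<^esub>" "Y = coh_class W e y" by (auto simp: cocycles_def)
      then obtain x z where x: "x \<in> carrier V" "d x = \<zero>\<^bsub>V\<^esub>" "z \<in> carrier W" "y = f x \<oplus>\<^bsub>W\<^esub> e z" using surj by blast
      have "y \<ominus>\<^bsub>W\<^esub> f x = e z" using x fc by (simp add: a_minus_def W.a_comm[of "f x"] W.a_assoc W.r_neg)
      then have "Y = coh_class W e (f x)" using x(3) y(3) W.coh_class_eq_iff[OF y(1) fc[OF x(1)]] by (simp add: coboundaries_def)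
      then show "Y \<in> coh_map W e f ` coh_class V d ` cocycles V d" using cm[OF x(1)] x by (intro image_eqI[of _ _ "coh_class V d x"] imageI) (auto simp: coc)
    qed
  qed
qed

sublocale graded_comm_alg \<subseteq> cplx: cochain_complex A d
  by unfold_locales (auto simp: d_add d_d)

context contraction
begin

lemma zero_cochain_complex_H: "cochain_complex H (\<lambda>x. \<zero>)"
  by (intro cochain_complex.intro cochain_complex_axioms.intro H.abelian_group_axioms) auto

text \<open>The linear part of the morphism is the inclusion of the harmonic subspace. An exact
  harmonic element is fixed and killed by \<open>pr\<close>, hence zero, and a cocycle y equals
  \<open>pr y\<close> plus the exact element \<open>d (h y)\<close>.\<close>

lemma cinf_quasi_isomorphic_H: "cinf_quasi_isomorphic K H m_min A (dgca_ops A d)"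
  unfolding cinf_quasi_isomorphic_def
proof (intro exI conjI)
  show "unital_cinf_morphism K H m_min A (dgca_ops A d) f_min"
    using minimal_unital_cinf_algebra_H unital_cinf_algebra_dgca_ops
  proof (intro unital_cinf_morphism.intro unital_cinf_morphism_axioms.intro multilinear_maps_f_min has_degrees_f_min
      vanishes_on_shuffles_f_min)
    show "insertion_sum A f_min m_min ps = composition_sum A (dgca_ops A d) f_min ps"
      if "ps \<noteq> []" "homog_list H ps" for ps using f_min_morphism that by simp
    show "f_min xs = \<zero>" if "xs \<in> lists (carrier H)" "\<one>\<^bsub>H\<^esub> \<in> set xs" "2 \<le> length xs" for xs
      using f_min_unit[of xs] that by (auto simp: in_lists_conv_set)
  qed (auto simp: minimal_unital_cinf_algebra_def)
  have "iso_on_cohomology H (\<lambda>x. \<zero>) A d (\<lambda>x. x)"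
  proof (rule iso_on_cohomologyI[OF zero_cochain_complex_H cplx.cochain_complex_axioms])
    fix x assume "x \<in> carrier H" "x \<in> coboundaries A d"
    then obtain z where "z \<in> carrier A" "x = d z" by (auto simp: coboundaries_def)
    then have "x = \<zero>" using H_pr[OF \<open>x \<in> carrier H\<close>] by simp
    then show "x \<in> coboundaries H (\<lambda>x. \<zero>)" using \<open>x \<in> carrier H\<close> by (auto simp: coboundaries_def)
  next
    fix y assume y: "y \<in> carrier A" "d y = \<zero>"
    then have "y = pr y \<oplus> d (h y)" using pr_decomp[of y] by simp
    then show "\<exists>x z. x \<in> carrier H \<and> \<zero> = \<zero>\<^bsub>H\<^esub> \<and> z \<in> carrier A \<and> y = x \<oplus> d z"
      using y by (intro exI[of _ "pr y"] exI[of _ "h y"]) auto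
  qed auto
  then show "iso_on_cohomology H (\<lambda>x. m_min [x]) A (\<lambda>y. dgca_ops A d [y]) (\<lambda>x. f_min [x])" by simp
qed

end

section \<open>Transport along bijections\<close>

text \<open>Transport of structure: nothing is assumed of \<open>W\<close> beyond the compatibility
  of its operations with \<open>\<phi>\<close>, and its axioms are derived from those of
  \<open>V\<close>. It is used for the cohomology, seen from its harmonic representatives, and for
  moving an algebra into another type.\<close>

locale graded_bij = graded_space V K
  for V :: "('k, 'a) graded_alg" (structure) and K :: "'k ring" +
  fixes W :: "('k, 'b) graded_alg" and \<phi> :: "'a \<Rightarrow> 'b"
  assumes bij: "bij_betw \<phi> (carrier V) (carrier W)"
    and map_add: "x \<in> carrier V \<Longrightarrow> y \<in> carrier V \<Longrightarrow> \<phi> (x \<oplus> y) = \<phi> x \<oplus>\<^bsub>W\<^esub> \<phi> y"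
    and map_smult: "c \<in> carrier K \<Longrightarrow> x \<in> carrier V \<Longrightarrow> \<phi> (c \<odot> x) = c \<odot>\<^bsub>W\<^esub> \<phi> x"
    and map_zero: "\<phi> \<zero> = \<zero>\<^bsub>W\<^esub>"
    and map_grade: "grade W k = \<phi> ` grade V k"
begin

lemma carrier_W: "carrier W = \<phi> ` carrier V"
  using bij by (simp add: bij_betw_def)

lemma map_inj: "x \<in> carrier V \<Longrightarrow> y \<in> carrier V \<Longrightarrow> \<phi> x = \<phi> y \<longleftrightarrow> x = y"
  using bij by (auto simp: bij_betw_def inj_on_def)

lemma module_W: "module K W"
proof (rule moduleI)
  show "abelian_group W"
  proof (rule abelian_groupI)
    fix x assume "x \<in> carrier W"
    then obtain x0 where x: "x0 \<in> carrier V" "x = \<phi> x0" by (auto simp: carrier_W)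
    have "\<phi> (\<ominus> x0) \<oplus>\<^bsub>W\<^esub> x = \<zero>\<^bsub>W\<^esub>" using x by (simp add: map_add[symmetric] l_neg map_zero)
    then show "\<exists>y\<in>carrier W. y \<oplus>\<^bsub>W\<^esub> x = \<zero>\<^bsub>W\<^esub>" using x by (auto simp: carrier_W)
  qed (auto simp: carrier_W map_add[symmetric] map_zero[symmetric] a_ac)
qed (auto simp: carrier_W map_add[symmetric] map_smult[symmetric] smult_l_distr smult_r_distr
    smult_assoc1 K.is_cring)

lemma map_finsum:
  "(\<And>i. i \<in> S \<Longrightarrow> g i \<in> carrier V) \<Longrightarrow> \<phi> (finsum V g S) = finsum W (\<lambda>i. \<phi> (g i)) S"
  using module_W by (intro finsum_additive_hom)
    (auto simp: module_def abelian_group_def map_add map_zero carrier_W)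

lemma graded_vector_space_W: "graded_vector_space K W"
proof -
  interpret W: module K W by (rule module_W)
  have am: "\<phi> (\<ominus> x) = \<ominus>\<^bsub>W\<^esub> \<phi> x" if "x \<in> carrier V" for x
    by (rule additive_map_zero_minus(2)[OF abelian_group_axioms W.abelian_group_axioms])
      (use that in \<open>auto simp: carrier_W map_add\<close>)
  show ?thesis
  proof (intro graded_vector_space.intro graded_vector_space_axioms.intro module_W K.field_axioms)
    fix k show "submodule (grade W k) K W"
    proof (rule W.submoduleI)
      show "grade W k \<subseteq> carrier W" by (auto simp: map_grade carrier_W grade_carrier)
      show "\<zero>\<^bsub>W\<^esub> \<in> grade W k" unfolding map_grade map_zero[symmetric] by (rule imageI) simp
      show "\<ominus>\<^bsub>W\<^esub> x \<in> grade W k" if "x \<in> grade W k" for x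
        using that by (auto simp: map_grade am[symmetric] grade_carrier grade_minus)
      show "x \<oplus>\<^bsub>W\<^esub> y \<in> grade W k" if "x \<in> grade W k" "y \<in> grade W k" for x y
        using that by (auto simp: map_grade map_add[symmetric] grade_carrier grade_add)
      show "c \<odot>\<^bsub>W\<^esub> x \<in> grade W k" if "c \<in> carrier K" "x \<in> grade W k" for c x
        using that by (auto simp: map_grade map_smult[symmetric] grade_carrier grade_smult)
    qed
  next
    fix y assume "y \<in> carrier W"
    then obtain x where x: "x \<in> carrier V" "y = \<phi> x" by (auto simp: carrier_W)
    have nz: "\<phi> z \<noteq> \<zero>\<^bsub>W\<^esub> \<longleftrightarrow> z \<noteq> \<zero>" if "z \<in> carrier V" for z
      using map_inj[of z \<zero>] that by (simp add: map_zero)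
    show "\<exists>!g. homog_decomp W y g"
    proof (rule ex1I)
      have e: "{k. \<phi> (component V k x) \<noteq> \<zero>\<^bsub>W\<^esub>} = {k. component V k x \<noteq> \<zero>}" using nz x by auto
      have "x = (\<Oplus>k\<in>{k. component V k x \<noteq> \<zero>}. component V k x)"
        using x finite_component by (intro component_sum) auto
      then have "\<phi> x = finsum W (\<lambda>k. \<phi> (component V k x)) {k. component V k x \<noteq> \<zero>}"
        using map_finsum[of "{k. component V k x \<noteq> \<zero>}" "\<lambda>k. component V k x"] x by simp
      then show "homog_decomp W y (\<lambda>k. \<phi> (component V k x))"
        using x finite_component component_grade by (auto simp: homog_decomp_def e map_grade)
      fix G assume G: "homog_decomp W y G"
      then have "\<forall>k. \<exists>z. z \<in> grade V k \<and> G k = \<phi> z" by (auto simp: homog_decomp_def map_grade)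
      then obtain g where g: "\<And>k. g k \<in> grade V k" "\<And>k. G k = \<phi> (g k)" by metis
      have gc: "g k \<in> carrier V" for k using g(1) grade_carrier by blast
      have e2: "{k. G k \<noteq> \<zero>\<^bsub>W\<^esub>} = {k. g k \<noteq> \<zero>}" using nz gc g(2) by auto
      have "y = finsum W G {k. g k \<noteq> \<zero>}" "finite {k. g k \<noteq> \<zero>}" using G by (auto simp: homog_decomp_def e2)
      then have "\<phi> x = \<phi> (finsum V g {k. g k \<noteq> \<zero>})"
        using x map_finsum[of "{k. g k \<noteq> \<zero>}" g] gc g(2) by (simp cong: finsum_cong_on)
      then have "x = finsum V g {k. g k \<noteq> \<zero>}" using map_inj x gc by auto
      then have "component V k x = g k" for k
        using g(1) \<open>finite {k. g k \<noteq> \<zero>}\<close> by (intro component_unique) auto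
      then show "G = (\<lambda>k. \<phi> (component V k x))" using g(2) by auto
    qed
  qed
qed

lemma component_W:
  assumes x: "x \<in> carrier V"
  shows "component W k (\<phi> x) = \<phi> (component V k x)"
proof -
  interpret W: graded_space W K by (simp add: graded_space_def graded_vector_space_W)
  let ?S = "{k. component V k x \<noteq> \<zero>}"
  show ?thesis
  proof (rule W.component_unique[where S = ?S and g = "\<lambda>k. \<phi> (component V k x)"])
    have "x = (\<Oplus>k\<in>?S. component V k x)" using x finite_component by (intro component_sum) auto
    then show "\<phi> x = finsum W (\<lambda>k. \<phi> (component V k x)) ?S"
      using map_finsum[of ?S "\<lambda>k. component V k x"] x by simp
  qed (use x in \<open>auto simp: map_grade map_zero component_grade finite_component\<close>)
qed

end

locale dgca_bij = graded_comm_alg V K d + graded_bij V K W \<phi>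
  for V :: "('k, 'a) graded_alg" (structure) and K :: "'k ring" and d
    and W :: "('k, 'b) graded_alg" and \<phi> :: "'a \<Rightarrow> 'b" +
  fixes e :: "'b \<Rightarrow> 'b"
  assumes map_mult: "x \<in> carrier V \<Longrightarrow> y \<in> carrier V \<Longrightarrow> \<phi> (x \<otimes> y) = \<phi> x \<otimes>\<^bsub>W\<^esub> \<phi> y"
    and map_one: "\<phi> \<one> = \<one>\<^bsub>W\<^esub>"
    and map_d: "x \<in> carrier V \<Longrightarrow> \<phi> (d x) = e (\<phi> x)"
begin

lemma dgca_W: "dgca K W e"
proof -
  interpret W: graded_space W K by (simp add: graded_space_def graded_vector_space_W)
  have am: "\<phi> (\<ominus> x) = \<ominus>\<^bsub>W\<^esub> \<phi> x" if "x \<in> carrier V" for x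
    by (rule additive_map_zero_minus(2)[OF abelian_group_axioms W.abelian_group_axioms])
      (use that in \<open>auto simp: carrier_W map_add\<close>)
  have pp: "\<phi> ([par k] \<cdot> x) = [par k] \<cdot>\<^bsub>W\<^esub> \<phi> x" if "x \<in> carrier V" for x k
  proof -
    have "\<phi> x \<in> carrier W" using that by (simp add: carrier_W)
    then show ?thesis using that by (simp add: par_pow W.par_pow am)
  qed
  have ring: "ring W"
  proof (rule ringI)
    show "monoid W"
      by (rule monoidI) (auto simp: carrier_W map_mult[symmetric] map_one[symmetric] m_assoc)
  qed (auto simp: W.abelian_group_axioms carrier_W map_mult[symmetric] map_add[symmetric] l_distr r_distr)
  show ?thesis
  proof (intro dgca.intro dgca_axioms.intro graded_vector_space_W ring)
    show "(c \<odot>\<^bsub>W\<^esub> x) \<otimes>\<^bsub>W\<^esub> y = c \<odot>\<^bsub>W\<^esub> (x \<otimes>\<^bsub>W\<^esub> y)"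
      if "c \<in> carrier K" "x \<in> carrier W" "y \<in> carrier W" for c x y
      using that by (auto simp: carrier_W map_mult[symmetric] map_smult[symmetric] smult_mult_left)
    show "x \<otimes>\<^bsub>W\<^esub> (c \<odot>\<^bsub>W\<^esub> y) = c \<odot>\<^bsub>W\<^esub> (x \<otimes>\<^bsub>W\<^esub> y)"
      if "c \<in> carrier K" "x \<in> carrier W" "y \<in> carrier W" for c x y
      using that by (auto simp: carrier_W map_mult[symmetric] map_smult[symmetric] smult_mult_right)
    show "\<one>\<^bsub>W\<^esub> \<in> grade W 0" using one_grade by (auto simp: map_grade map_one[symmetric])
    show "x \<otimes>\<^bsub>W\<^esub> y \<in> grade W (i + j)" if "x \<in> grade W i" "y \<in> grade W j" for x y i j
      using that by (auto simp: map_grade map_mult[symmetric] grade_carrier intro: mult_grade)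
    show "y \<otimes>\<^bsub>W\<^esub> x = [par (i * j)] \<cdot>\<^bsub>W\<^esub> (x \<otimes>\<^bsub>W\<^esub> y)" if "x \<in> grade W i" "y \<in> grade W j" for x y i j
    proof -
      obtain x0 y0 where x: "x0 \<in> grade V i" "x = \<phi> x0" and y: "y0 \<in> grade V j" "y = \<phi> y0"
        using \<open>x \<in> grade W i\<close> \<open>y \<in> grade W j\<close> by (auto simp: map_grade)
      have c: "x0 \<in> carrier V" "y0 \<in> carrier V" using x y grade_carrier by auto
      have "\<phi> (y0 \<otimes> x0) = \<phi> ([par (i * j)] \<cdot> (x0 \<otimes> y0))" using graded_comm[OF x(1) y(1)] by simp
      then show ?thesis using c x y by (simp add: pp map_mult)
    qed
    show "linear_map K W W e"
      by (auto simp: linear_map_def carrier_W map_add[symmetric] map_smult[symmetric] map_d[symmetric] d_add d_smult)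
    show "e x \<in> grade W (i + 1)" if "x \<in> grade W i" for x i
      using that by (auto simp: map_grade map_d[symmetric] grade_carrier d_grade)
    show "e (e x) = \<zero>\<^bsub>W\<^esub>" if "x \<in> carrier W" for x
      using that by (auto simp: carrier_W map_d[symmetric] d_d map_zero)
    show "e (x \<otimes>\<^bsub>W\<^esub> y) = (e x \<otimes>\<^bsub>W\<^esub> y) \<oplus>\<^bsub>W\<^esub> [par i] \<cdot>\<^bsub>W\<^esub> (x \<otimes>\<^bsub>W\<^esub> e y)"
      if "x \<in> grade W i" "y \<in> carrier W" for x y i
    proof -
      obtain x0 y0 where x: "x0 \<in> grade V i" "x = \<phi> x0" and y: "y0 \<in> carrier V" "y = \<phi> y0"
        using \<open>x \<in> grade W i\<close> \<open>y \<in> carrier W\<close> by (auto simp: map_grade carrier_W)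
      have c: "x0 \<in> carrier V" using x grade_carrier by auto
      have "\<phi> (d (x0 \<otimes> y0)) = \<phi> ((d x0 \<otimes> y0) \<oplus> [par i] \<cdot> (x0 \<otimes> d y0))" using leibniz[OF x(1) y(1)] by simp
      then show ?thesis using c x y by (simp add: pp map_mult map_add map_d)
    qed
  qed
qed

end

section \<open>The cohomology algebra\<close>

context contraction
begin

text \<open>Replaces the left-over product of the harmonic space by the projected product. This is a
  concrete model of the cohomology algebra, from which the DGCA structure of the quotient is
  transported.\<close>

definition harmonic_alg :: "('k, 'a) graded_alg" where
  "harmonic_alg = H\<lparr>monoid.mult := \<lambda>x y. pr (x \<otimes> y)\<rparr>"

lemma harmonic_alg_simps [simp]: "carrier harmonic_alg = carrier H" "zero harmonic_alg = \<zero>" "add harmonic_alg = add A" "smult harmonic_alg = smult A"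
  "one harmonic_alg = \<one>" "grade harmonic_alg k = grade H k" "x \<otimes>\<^bsub>harmonic_alg\<^esub> y = pr (x \<otimes> y)"
  by (simp_all add: harmonic_alg_def)

lemma pr_closed_eq: "x \<in> carrier A \<Longrightarrow> d x = \<zero> \<Longrightarrow> x = pr x \<oplus> d (h x)"
  using pr_decomp[of x] by simp

text \<open>For a cocycle, x and \<open>pr x\<close> differ by \<open>d (h x)\<close>, and the
  product of an exact element with a cocycle is exact, hence killed by \<open>pr\<close>. This makes
  the projected product associative.\<close>

lemma pr_mult_closed:
  assumes x: "x \<in> carrier A" "d x = \<zero>" and y: "y \<in> carrier A" "d y = \<zero>"
  shows "pr (x \<otimes> y) = pr (pr x \<otimes> y)" "pr (x \<otimes> y) = pr (x \<otimes> pr y)"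
proof -
  have "d (h x \<otimes> y) = d (h x) \<otimes> y" using x y by (simp add: leibniz_eps)
  moreover have "x \<otimes> y = pr x \<otimes> y \<oplus> d (h x) \<otimes> y"
    using x y pr_closed_eq[OF x] l_distr[of "pr x" "d (h x)" y] by simp
  ultimately have "x \<otimes> y = pr x \<otimes> y \<oplus> d (h x \<otimes> y)" by simp
  then have "pr (x \<otimes> y) = pr (pr x \<otimes> y \<oplus> d (h x \<otimes> y))" by (rule arg_cong)
  then show "pr (x \<otimes> y) = pr (pr x \<otimes> y)" using x y by (simp add: pr_add)
  have "d (eps x \<otimes> h y) = x \<otimes> d (h y)" using x y by (simp add: leibniz_eps d_eps)
  moreover have "x \<otimes> y = x \<otimes> pr y \<oplus> x \<otimes> d (h y)"
    using x y pr_closed_eq[OF y] r_distr[of "pr y" "d (h y)" x] by simp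
  ultimately have "x \<otimes> y = x \<otimes> pr y \<oplus> d (eps x \<otimes> h y)" by simp
  then have "pr (x \<otimes> y) = pr (x \<otimes> pr y \<oplus> d (eps x \<otimes> h y))" by (rule arg_cong)
  then show "pr (x \<otimes> y) = pr (x \<otimes> pr y)" using x y by (simp add: pr_add)
qed

lemma d_mult_closed: "x \<in> carrier A \<Longrightarrow> d x = \<zero> \<Longrightarrow> y \<in> carrier A \<Longrightarrow> d y = \<zero> \<Longrightarrow> d (x \<otimes> y) = \<zero>"
  by (simp add: leibniz_eps)

lemma graded_bij_harmonic_alg: "graded_bij H K harmonic_alg (\<lambda>x. x)"
  by (intro graded_bij.intro graded_bij_axioms.intro H.graded_space_axioms) (auto simp: bij_betw_def)

lemma dgca_harmonic_alg: "dgca K harmonic_alg (\<lambda>x. \<zero>)"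
proof -
  have gvs: "graded_vector_space K harmonic_alg" by (rule graded_bij.graded_vector_space_W[OF graded_bij_harmonic_alg])
  interpret harmonic_alg: graded_space harmonic_alg K by (simp add: graded_space_def gvs)
  have sub: "carrier harmonic_alg \<subseteq> carrier A" by auto
  have parHA: "[par k] \<cdot>\<^bsub>harmonic_alg\<^esub> x = [par k] \<cdot> x" if "x \<in> carrier H" for x k
    using sub_par_pow[OF harmonic_alg.abelian_group_axioms abelian_group_axioms sub, of x k] that by simp
  have ring: "ring harmonic_alg"
  proof (rule ringI)
    show "monoid harmonic_alg"
    proof (rule monoidI)
      fix x y z assume "x \<in> carrier harmonic_alg" "y \<in> carrier harmonic_alg" "z \<in> carrier harmonic_alg"
      then have c: "x \<in> carrier A" "y \<in> carrier A" "z \<in> carrier A" "d x = \<zero>" "d y = \<zero>" "d z = \<zero>" by auto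
      have "pr (pr (x \<otimes> y) \<otimes> z) = pr ((x \<otimes> y) \<otimes> z)"
        using c by (intro pr_mult_closed(1)[symmetric]) (auto simp: d_mult_closed)
      moreover have "pr (x \<otimes> pr (y \<otimes> z)) = pr (x \<otimes> (y \<otimes> z))"
        using c by (intro pr_mult_closed(2)[symmetric]) (auto simp: d_mult_closed)
      ultimately show "x \<otimes>\<^bsub>harmonic_alg\<^esub> y \<otimes>\<^bsub>harmonic_alg\<^esub> z = x \<otimes>\<^bsub>harmonic_alg\<^esub> (y \<otimes>\<^bsub>harmonic_alg\<^esub> z)" using c by (simp add: m_assoc)
    qed auto
  qed (auto simp: harmonic_alg.abelian_group_axioms l_distr r_distr pr_add)
  show ?thesis
  proof (intro dgca.intro dgca_axioms.intro gvs ring)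
    show "y \<otimes>\<^bsub>harmonic_alg\<^esub> x = [par (i * j)] \<cdot>\<^bsub>harmonic_alg\<^esub> (x \<otimes>\<^bsub>harmonic_alg\<^esub> y)" if "x \<in> grade harmonic_alg i" "y \<in> grade harmonic_alg j" for x y i j
    proof -
      have c: "x \<in> carrier H" "y \<in> carrier H" "x \<in> grade A i" "y \<in> grade A j" using that by (auto simp: H_grade)
      show ?thesis using graded_comm[OF c(3,4)] c by (simp add: parHA pr_par)
    qed
    show "\<zero> = (\<zero> \<otimes>\<^bsub>harmonic_alg\<^esub> y) \<oplus>\<^bsub>harmonic_alg\<^esub> [par i] \<cdot>\<^bsub>harmonic_alg\<^esub> (x \<otimes>\<^bsub>harmonic_alg\<^esub> \<zero>)"
      if "x \<in> grade harmonic_alg i" "y \<in> carrier harmonic_alg" for x y i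
      using that by (auto simp: H_grade parHA)
    show "x \<otimes>\<^bsub>harmonic_alg\<^esub> y \<in> grade harmonic_alg (i + j)" if "x \<in> grade harmonic_alg i" "y \<in> grade harmonic_alg j" for x y i j
      using that by (auto simp: H_grade intro: pr_grade mult_grade)
  qed (auto simp: smult_mult_left smult_mult_right pr_smult H_grade one_grade linear_map_def)
qed

lemma coh_class_pr: "x \<in> carrier A \<Longrightarrow> d x = \<zero> \<Longrightarrow> coh_class A d (pr x) = coh_class A d x"
proof -
  assume x: "x \<in> carrier A" "d x = \<zero>"
  have "x \<ominus> pr x = d (h x)"
    using x pr_closed_eq[OF x] r_neg1 by (simp add: harmonic_proj_def a_minus_def minus_add r_neg2)
  then have "x \<ominus> pr x \<in> coboundaries A d" using x by (auto simp: coboundaries_def)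
  then show ?thesis using cplx.coh_class_eq_iff[of x "pr x"] x by simp
qed

section \<open>The cohomology as a DGCA with zero differential\<close>

abbreviation coh :: "('k, 'a set) graded_alg" where "coh \<equiv> cohomology A d"

lemma a_r_coset_cocycles: "coboundaries A d +>\<^bsub>A\<lparr>carrier := cocycles A d\<rparr>\<^esub> x = coh_class A d x"
  by (simp add: coh_class_def a_r_coset_def')

lemma coh_add:
  assumes "x \<in> carrier A" "y \<in> carrier A"
  shows "coh_class A d x \<oplus>\<^bsub>coh\<^esub> coh_class A d y = coh_class A d (x \<oplus> y)"
proof -
  have "coh_class A d x \<oplus>\<^bsub>coh\<^esub> coh_class A d y = {a \<oplus> b | a b. a \<in> coh_class A d x \<and> b \<in> coh_class A d y}"
    by (auto simp: cohomology_def Let_def FactRing_def set_add_defs)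
  also have "\<dots> = coh_class A d (x \<oplus> y)"
  proof (intro equalityI subsetI)
    fix z assume "z \<in> {a \<oplus> b | a b. a \<in> coh_class A d x \<and> b \<in> coh_class A d y}"
    then obtain a b where ab: "a \<in> coboundaries A d" "b \<in> coboundaries A d" "z = (a \<oplus> x) \<oplus> (b \<oplus> y)"
      by (auto simp: cplx.coh_class_eq)
    then have "z = (a \<oplus> b) \<oplus> (x \<oplus> y)" using assms cplx.coboundaries_ops(5) by (simp add: a_ac)
    then show "z \<in> coh_class A d (x \<oplus> y)" using ab cplx.coboundaries_ops(2) by (auto simp: cplx.coh_class_eq)
  next
    fix z assume "z \<in> coh_class A d (x \<oplus> y)"
    then obtain b where b: "b \<in> coboundaries A d" "z = b \<oplus> (x \<oplus> y)" by (auto simp: cplx.coh_class_eq)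
    then have "z = (b \<oplus> x) \<oplus> y" using assms cplx.coboundaries_ops(5) by (simp add: a_assoc)
    moreover have "b \<oplus> x \<in> coh_class A d x" using b by (auto simp: cplx.coh_class_eq)
    ultimately show "z \<in> {a \<oplus> b | a b. a \<in> coh_class A d x \<and> b \<in> coh_class A d y}"
      using cplx.coh_class_self[OF assms(2)] by blast
  qed
  finally show ?thesis .
qed

lemma coh_mult:
  assumes x: "x \<in> carrier A" "d x = \<zero>" and y: "y \<in> carrier A" "d y = \<zero>"
  shows "coh_class A d x \<otimes>\<^bsub>coh\<^esub> coh_class A d y = coh_class A d (x \<otimes> y)"
proof -
  have *: "coh_class A d (a \<otimes> b) = coh_class A d (x \<otimes> y)"
    if "a \<in> coh_class A d x" "b \<in> coh_class A d y" for a b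
  proof -
    obtain u v where uv: "u \<in> carrier A" "v \<in> carrier A" "a = d u \<oplus> x" "b = d v \<oplus> y"
      using \<open>a \<in> _\<close> \<open>b \<in> _\<close> by (auto simp: cplx.coh_class_eq coboundaries_def)
    \<comment> \<open>The primitive comes from \<open>a - x = d u\<close> and
      \<open>b - y = d v\<close>: the difference of the products is \<open>d u\<close> times b plus
      x times \<open>d v\<close>, and b and x are closed. The involution on x undoes the sign of the
      Leibniz rule.\<close>
    have "a \<otimes> b = d (u \<otimes> b \<oplus> eps x \<otimes> v) \<oplus> x \<otimes> y"
      using x y uv by (simp add: d_add leibniz_eps d_eps d_d l_distr r_distr a_ac)
    then have "a \<otimes> b \<ominus> x \<otimes> y = d (u \<otimes> b \<oplus> eps x \<otimes> v)"
      using x y uv by (simp add: a_minus_def a_assoc r_neg)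
    then have "a \<otimes> b \<ominus> x \<otimes> y \<in> coboundaries A d" using x y uv by (auto simp: coboundaries_def)
    then show ?thesis using cplx.coh_class_eq_iff[of "a \<otimes> b" "x \<otimes> y"] x y uv by simp
  qed
  have "coh_class A d x \<otimes>\<^bsub>coh\<^esub> coh_class A d y = (\<Union>a\<in>coh_class A d x. \<Union>b\<in>coh_class A d y. coh_class A d (a \<otimes> b))"
    by (simp add: cohomology_def Let_def FactRing_def rcoset_mult_def a_r_coset_cocycles)
  also have "\<dots> = coh_class A d (x \<otimes> y)"
    using cplx.coh_class_self[OF x(1)] cplx.coh_class_self[OF y(1)] *
    by (intro SUP_eq_const) blast+
  finally show ?thesis .
qed

lemma coh_smult:
  assumes c: "c \<in> carrier K" and x: "x \<in> carrier A"
  shows "c \<odot>\<^bsub>coh\<^esub> coh_class A d x = coh_class A d (c \<odot> x)"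
proof -
  have "coh_class A d (c \<odot> a) = coh_class A d (c \<odot> x)" if a: "a \<in> coh_class A d x" for a
  proof -
    obtain u where u: "u \<in> carrier A" "a = d u \<oplus> x"
      using a by (auto simp: cplx.coh_class_eq coboundaries_def)
    then have "c \<odot> a \<ominus> c \<odot> x = d (c \<odot> u)" using c x by (simp add: smult_r_distr d_smult a_minus_def a_assoc r_neg)
    then have "c \<odot> a \<ominus> c \<odot> x \<in> coboundaries A d" using c u by (auto simp: coboundaries_def)
    then show ?thesis using cplx.coh_class_eq_iff[of "c \<odot> a" "c \<odot> x"] c x u by simp
  qed
  note * = this
  have "c \<odot>\<^bsub>coh\<^esub> coh_class A d x = (\<Union>a\<in>coh_class A d x. coh_class A d (c \<odot> a))"
    by (simp add: cohomology_def Let_def)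
  also have "\<dots> = coh_class A d (c \<odot> x)"
    using cplx.coh_class_self[OF x] * by (intro SUP_eq_const) blast+
  finally show ?thesis .
qed

lemma coh_zero: "zero coh = coh_class A d \<zero>" and coh_one: "one coh = coh_class A d \<one>"
  and coh_grade: "grade coh k = coh_class A d ` (cocycles A d \<inter> grade A k)"
  by (simp_all add: cohomology_def Let_def FactRing_def a_r_coset_cocycles cplx.coboundaries_coh_class[symmetric])

text \<open>Every class has exactly one harmonic representative, which is moreover homogeneous if
  the class is; products agree because passing from x to \<open>pr x\<close> does not change the
  class of a cocycle.\<close>

lemma dgca_bij_coh: "dgca_bij harmonic_alg K (\<lambda>x. \<zero>) coh (coh_class A d) (\<lambda>X. zero coh)"
proof (intro dgca_bij.intro dgca_bij_axioms.intro graded_comm_alg.intro graded_bij.intro graded_bij_axioms.intro dgca_harmonic_alg)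
  show "graded_space harmonic_alg K"
    by (simp add: graded_space_def graded_bij.graded_vector_space_W[OF graded_bij_harmonic_alg])
  show "bij_betw (coh_class A d) (carrier harmonic_alg) (carrier coh)"
  proof (rule bij_betw_imageI)
    show "inj_on (coh_class A d) (carrier harmonic_alg)"
    proof (rule inj_onI)
      fix x y assume c: "x \<in> carrier harmonic_alg" "y \<in> carrier harmonic_alg" and "coh_class A d x = coh_class A d y"
      then have "x \<ominus> y \<in> coboundaries A d" using cplx.coh_class_eq_iff[of x y] by auto
      then obtain z where z: "z \<in> carrier A" "x \<ominus> y = d z" by (auto simp: coboundaries_def)
      have "x \<ominus> y = pr (x \<ominus> y)" using c by (simp add: a_minus_def pr_add pr_minus)
      then have "x \<ominus> y = \<zero>" using z by simp
      moreover have "x = (x \<ominus> y) \<oplus> y" using c by (simp add: a_minus_def a_assoc l_neg)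
      ultimately show "x = y" using c by simp
    qed
    show "coh_class A d ` carrier harmonic_alg = carrier coh"
    proof -
      have "coh_class A d x \<in> coh_class A d ` carrier H" if "x \<in> carrier A" "d x = \<zero>" for x
        using coh_class_pr[OF that] that by (metis imageI pr_H)
      then show ?thesis by (auto simp: carrier_cohomology cocycles_def)
    qed
  qed
  show "grade coh k = coh_class A d ` grade harmonic_alg k" for k
  proof -
    have "coh_class A d x \<in> coh_class A d ` (carrier H \<inter> grade A k)" if "x \<in> grade A k" "d x = \<zero>" for x
      using coh_class_pr[of x] that grade_carrier[of x k] pr_grade[of x k] by (metis IntI imageI pr_H)
    then show ?thesis by (auto simp: coh_grade H_grade cocycles_def)
  qed
  show "coh_class A d (x \<otimes>\<^bsub>harmonic_alg\<^esub> y) = coh_class A d x \<otimes>\<^bsub>coh\<^esub> coh_class A d y"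
    if "x \<in> carrier harmonic_alg" "y \<in> carrier harmonic_alg" for x y
    using that by (simp add: coh_mult coh_class_pr d_mult_closed)
qed (auto simp: coh_add coh_smult coh_zero coh_one)

lemma dgca_coh: "dgca K coh (\<lambda>X. zero coh)"
  by (rule dgca_bij.dgca_W[OF dgca_bij_coh])

lemma graded_space_harmonic_alg: "graded_space harmonic_alg K"
  by (simp add: graded_space_def graded_bij.graded_vector_space_W[OF graded_bij_harmonic_alg])

lemma finsum_harmonic_alg: "(\<And>i. i \<in> S \<Longrightarrow> f i \<in> carrier H) \<Longrightarrow> finsum harmonic_alg f S = finsum A f S"
proof -
  have harmonic_alg: "abelian_group harmonic_alg"
    using graded_space_harmonic_alg by (simp add: graded_space_def graded_vector_space_def module_def)
  have sub: "carrier harmonic_alg \<subseteq> carrier A" by auto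
  show "(\<And>i. i \<in> S \<Longrightarrow> f i \<in> carrier H) \<Longrightarrow> finsum harmonic_alg f S = finsum A f S"
    by (rule sub_finsum[OF harmonic_alg abelian_group_axioms sub]) simp_all
qed

lemma component_harmonic_alg:
  assumes x: "x \<in> carrier A"
  shows "component harmonic_alg k (pr x) = component A k (pr x)"
proof (rule graded_space.component_unique[OF graded_space_harmonic_alg, where S = "{k. component A k (pr x) \<noteq> \<zero>}"
      and g = "\<lambda>k. component A k (pr x)"])
  have cH: "component A k (pr x) \<in> carrier H" for k using x by (simp add: component_pr)
  show "component A k (pr x) \<in> grade harmonic_alg k" for k
    using x cH component_grade[of "pr x" k] by (simp only: H_grade harmonic_alg_simps pr_closed Int_iff simp_thms)
  show "finite {k. component A k (pr x) \<noteq> \<zero>}" using x finite_component[of "pr x"] by simp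
  have "pr x = (\<Oplus>k\<in>{k. component A k (pr x) \<noteq> \<zero>}. component A k (pr x))"
    using x finite_component[of "pr x"] by (intro component_sum) auto
  also have "\<dots> = finsum harmonic_alg (\<lambda>k. component A k (pr x)) {k. component A k (pr x) \<noteq> \<zero>}"
    by (rule finsum_harmonic_alg[symmetric]) (rule cH)
  finally show "pr x = finsum harmonic_alg (\<lambda>k. component A k (pr x)) {k. component A k (pr x) \<noteq> \<zero>}" .
qed simp

lemma d_component:
  assumes "x \<in> carrier A" shows "d (component A k x) = component A (k + 1) (d x)"
  using assms
proof (induction x rule: grade_induct)
  case (homog j y)
  then show ?case using d_grade[OF homog] by (simp add: component_homog[of _ j] component_homog[of _ "j+1"])
next
  case (add y z) then show ?case by (simp add: component_add d_add)
qed

text \<open>The grading of the quotient is understood through its bijection with the harmonic model,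
  so components are computed on harmonic representatives.\<close>

lemma component_coh:
  assumes x: "x \<in> carrier A" "d x = \<zero>"
  shows "component coh k (coh_class A d x) = coh_class A d (component A k x)"
proof -
  have "component coh k (coh_class A d (pr x)) = coh_class A d (component harmonic_alg k (pr x))"
    by (rule graded_bij.component_W[OF dgca_bij.axioms(2)[OF dgca_bij_coh]]) (use x in simp)
  also have "component harmonic_alg k (pr x) = pr (component A k x)" using x by (simp add: component_harmonic_alg component_pr)
  also have "coh_class A d (pr (component A k x)) = coh_class A d (component A k x)"
    using x d_component[of x k] by (intro coh_class_pr) auto
  finally show ?thesis using x by (simp add: coh_class_pr)
qed

end

section \<open>Poincare duality and the vanishing of higher multiplications\<close>

locale hodge_poincare = contraction A K d h
  for A :: "('k, 'a) graded_alg" (structure) and K :: "'k ring" and d h +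
  fixes n :: nat and I :: "'a set \<Rightarrow> 'k"
  assumes poincare: "poincare_dgca K A d n I"
    and pairing_h_h: "x \<in> carrier A \<Longrightarrow> y \<in> carrier A \<Longrightarrow> pairing A d n I (h x) (h y) = \<zero>\<^bsub>K\<^esub>"
    and pairing_pr_h: "x \<in> carrier A \<Longrightarrow> y \<in> carrier A \<Longrightarrow> pairing A d n I (pr x) (h y) = \<zero>\<^bsub>K\<^esub>"
begin

lemma grade_out: "k < 0 \<or> int n < k \<Longrightarrow> x \<in> grade A k \<Longrightarrow> x = \<zero>"
  using poincare_dgca.grade_bounds[OF poincare, of k] by auto

text \<open>Extends the fundamental class to a linear functional on all of \<open>A\<close>. The
  pairing becomes \<open>J\<close> of a product, so associativity and the Leibniz rule apply inside
  it.\<close>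

definition J :: "'a \<Rightarrow> 'k" where
  "J x = I (coh_class A d (component A (int n) x))"

lemma pairing_J: "pairing A d n I x y = J (x \<otimes> y)"
  by (simp add: pairing_def J_def)

text \<open>Degree n + 1 is zero. Hence the component of degree n of any element is closed and has a
  class that can be integrated.\<close>

lemma d_top: "x \<in> carrier A \<Longrightarrow> d (component A (int n) x) = \<zero>"
  using d_grade[OF component_grade[of x "int n"]] by (intro grade_out[of "int n + 1"]) auto

lemma coh_class_top: "x \<in> carrier A \<Longrightarrow> coh_class A d (component A (int n) x) \<in> grade coh (int n)"
  by (auto simp: coh_grade cocycles_def d_top component_grade)

lemma J_closed [simp]: "x \<in> carrier A \<Longrightarrow> J x \<in> carrier K"
  using poincare_dgca.I_closed[OF poincare coh_class_top] by (simp add: J_def)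

lemma J_add:
  assumes "x \<in> carrier A" "y \<in> carrier A" shows "J (x \<oplus> y) = J x \<oplus>\<^bsub>K\<^esub> J y"
  using poincare_dgca.I_add[OF poincare coh_class_top[OF assms(1)] coh_class_top[OF assms(2)]] assms
  by (simp add: J_def coh_add component_add)

lemma J_smult:
  assumes "c \<in> carrier K" "x \<in> carrier A" shows "J (c \<odot> x) = c \<otimes>\<^bsub>K\<^esub> J x"
  using poincare_dgca.I_smult[OF poincare assms(1) coh_class_top[OF assms(2)]] assms
  by (simp add: J_def coh_smult component_smult)

lemma J_zero [simp]: "J \<zero> = \<zero>\<^bsub>K\<^esub>" and J_minus: "x \<in> carrier A \<Longrightarrow> J (\<ominus> x) = \<ominus>\<^bsub>K\<^esub> J x"
  by (rule additive_map_zero_minus[OF abelian_group_axioms K.abelian_group_axioms]; auto simp: J_add)+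

lemma J_finsum_zero:
  assumes "\<And>i. i \<in> S \<Longrightarrow> f i \<in> carrier A" "\<And>i. i \<in> S \<Longrightarrow> J (f i) = \<zero>\<^bsub>K\<^esub>"
  shows "J (finsum A f S) = \<zero>\<^bsub>K\<^esub>"
proof -
  have "J (finsum A f S) = finsum K (\<lambda>i. J (f i)) S"
    by (rule finsum_additive_hom) (use assms in \<open>auto simp: J_add K.abelian_monoid_axioms\<close>)
  then show ?thesis using assms by (simp add: K.finsum_all_zero)
qed

lemma J_par: "x \<in> carrier A \<Longrightarrow> J ([par e] \<cdot> x) = (if even e then J x else \<ominus>\<^bsub>K\<^esub> J x)"
  by (simp add: par_pow J_minus)

lemma J_d [simp]:
  assumes x: "x \<in> carrier A" shows "J (d x) = \<zero>\<^bsub>K\<^esub>"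
proof -
  have "component A (int n) (d x) = d (component A (int n - 1) x)" using d_component[OF x, of "int n - 1"] by simp
  then have "coh_class A d (component A (int n) (d x)) = coh_class A d \<zero>"
    using x by (subst cplx.coh_class_zero) (auto simp: coboundaries_def)
  then have "J (d x) = J \<zero>" by (simp add: J_def)
  then show ?thesis by simp
qed

lemma J_homog: "x \<in> grade A k \<Longrightarrow> k \<noteq> int n \<Longrightarrow> J x = \<zero>\<^bsub>K\<^esub>"
  using J_zero component_homog[of x k "int n"] by (simp add: J_def component_homog[of \<zero> 0])

lemma J_comm:
  "x \<in> grade A i \<Longrightarrow> y \<in> grade A j \<Longrightarrow> J (x \<otimes> y) = \<zero>\<^bsub>K\<^esub> \<Longrightarrow> J (y \<otimes> x) = \<zero>\<^bsub>K\<^esub>"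
  using graded_comm[of x i y j] grade_carrier by (auto simp: J_par)

lemma J_h_h: "x \<in> carrier A \<Longrightarrow> y \<in> carrier A \<Longrightarrow> J (h x \<otimes> h y) = \<zero>\<^bsub>K\<^esub>"
  and J_H_h: "x \<in> carrier H \<Longrightarrow> y \<in> carrier A \<Longrightarrow> J (x \<otimes> h y) = \<zero>\<^bsub>K\<^esub>"
  using pairing_h_h[of x y] pairing_pr_h[of x y] by (simp_all add: pairing_J)

text \<open>The unit is harmonic, so this is an instance of the orthogonality between harmonic
  elements and the image of \<open>h\<close>.\<close>

lemma J_h [simp]: "x \<in> carrier A \<Longrightarrow> J (h x) = \<zero>\<^bsub>K\<^esub>"
  using J_H_h[of \<one> x] by simp

lemma J_pr: "x \<in> carrier A \<Longrightarrow> J (pr x) = J x"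
  by (simp add: harmonic_proj_def a_minus_def J_add J_minus minus_add)

lemma J_stokes: "x \<in> carrier A \<Longrightarrow> y \<in> carrier A \<Longrightarrow> J (d x \<otimes> y) = \<ominus>\<^bsub>K\<^esub> J (eps x \<otimes> d y)"
  using J_d[of "x \<otimes> y"] by (intro K.minus_equality[symmetric]) (simp_all add: leibniz_eps J_add)

text \<open>Every class is represented by some \<open>pr b\<close>, and its pairing with the class
  of a is \<open>J\<close> of the product of a and \<open>pr b\<close>. Nondegeneracy on cohomology
  therefore makes a exact, and an exact harmonic element is zero.\<close>

lemma J_nondegenerate:
  assumes a: "a \<in> carrier H" and orth: "\<And>k b. b \<in> grade H k \<Longrightarrow> J (a \<otimes> b) = \<zero>\<^bsub>K\<^esub>"
  shows "a = \<zero>"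
proof -
  have orthH: "J (a \<otimes> b) = \<zero>\<^bsub>K\<^esub>" if "b \<in> carrier H" for b
    using that
  proof (induction b rule: H.grade_induct)
    case (homog k b) then show ?case by (rule orth)
  next
    case (add b c) then show ?case using a by (simp add: r_distr J_add)
  qed
  have "coh_class A d a = zero coh"
  proof (rule poincare_dgca.nondegenerate_left[OF poincare])
    show "coh_class A d a \<in> carrier coh" using a by (auto simp: carrier_cohomology cocycles_def)
    fix Y assume "Y \<in> carrier coh"
    then obtain b where b: "b \<in> carrier A" "d b = \<zero>" "Y = coh_class A d b" by (auto simp: carrier_cohomology cocycles_def)
    have "coh_pairing A d n I (coh_class A d a) Y = J (a \<otimes> pr b)"
    proof -
      have "coh_class A d b = coh_class A d (pr b)" using b by (simp add: coh_class_pr)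
      then show ?thesis unfolding coh_pairing_def J_def b(3) using a b
        by (simp add: coh_mult component_coh d_mult_closed)
    qed
    then show "coh_pairing A d n I (coh_class A d a) Y = \<zero>\<^bsub>K\<^esub>" using orthH[of "pr b"] b by simp
  qed
  then have "a \<in> coboundaries A d" using cplx.coh_class_zero[of a] a by (simp add: coh_zero)
  then obtain z where "z \<in> carrier A" "a = d z" by (auto simp: coboundaries_def)
  then show ?thesis using H_pr[OF a] by simp
qed

end

section \<open>Connectedness and the degree count\<close>

locale connected_hodge_poincare = hodge_poincare A K d h n I
  for A :: "('k, 'a) graded_alg" (structure) and K :: "'k ring" and d h n I +
  fixes r :: nat
  assumes connected: "connected_dgca K A d r" and r2: "2 \<le> r"
begin

text \<open>In cohomology the element is a multiple of the unit class, and harmonic representatives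
  are unique.\<close>

lemma H_grade_0:
  assumes "x \<in> grade H 0" shows "\<exists>c\<in>carrier K. x = c \<odot> \<one>"
proof -
  have x: "x \<in> carrier H" "x \<in> grade A 0" using assms by (auto simp: H_grade)
  then have "coh_class A d x \<in> grade coh 0" by (auto simp: coh_grade cocycles_def)
  then have "coh_class A d x \<in> (\<lambda>c. c \<odot>\<^bsub>coh\<^esub> \<one>\<^bsub>coh\<^esub>) ` carrier K"
    using connected unfolding connected_dgca_def bij_betw_def by blast
  then obtain c where c: "c \<in> carrier K" "coh_class A d x = c \<odot>\<^bsub>coh\<^esub> \<one>\<^bsub>coh\<^esub>"
    by blast
  then have "coh_class A d x = coh_class A d (c \<odot> \<one>)" by (simp add: coh_one coh_smult)
  moreover have "inj_on (coh_class A d) (carrier H)"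
    using graded_bij.bij[OF dgca_bij.axioms(2)[OF dgca_bij_coh]] by (simp add: bij_betw_def)
  ultimately have "x = c \<odot> \<one>" using x c(1) inj_onD[of "coh_class A d" "carrier H" x "c \<odot> \<one>"] by simp
  then show ?thesis using c(1) by blast
qed

lemma H_grade_low:
  assumes x: "x \<in> grade H k" and k: "k \<noteq> 0" "k < int r" shows "x = \<zero>"
proof (cases "k < 0")
  case True then show ?thesis using x grade_out by (auto simp: H_grade)
next
  case False
  have x: "x \<in> carrier H" "x \<in> grade A k" using assms by (auto simp: H_grade)
  then have "coh_class A d x \<in> grade coh k" by (auto simp: coh_grade cocycles_def)
  moreover have "grade coh k = {zero coh}" using connected False k by (auto simp: connected_dgca_def)
  ultimately have "coh_class A d x = coh_class A d \<zero>" by (simp add: coh_zero)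
  moreover have "inj_on (coh_class A d) (carrier H)"
    using graded_bij.bij[OF dgca_bij.axioms(2)[OF dgca_bij_coh]] by (simp add: bij_betw_def)
  ultimately show ?thesis using x inj_onD[of "coh_class A d" "carrier H" x \<zero>] by simp
qed

lemma J_p_min:
  assumes ps: "homog_list H ps" and k: "3 \<le> length ps"
  shows "J (p_min ps) = \<zero>\<^bsub>K\<^esub>"
proof -
  have psA: "homog_list A ps" by (rule homog_list_H[OF ps])
  have trm: "J (f_min (elts us) \<otimes> f_min (elts vs)) = \<zero>\<^bsub>K\<^esub>" "f_min (elts us) \<otimes> f_min (elts vs) \<in> carrier A"
    if t: "(us, vs) \<in> splits ps" for us vs
  proof -
    note s = splitsD[OF t]
    have hl: "homog_list A us" "homog_list A vs" "homog_list H us" "homog_list H vs" using ps psA s by auto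
    note gr = f_min_grade[OF hl(1) s(6)] f_min_grade[OF hl(2) s(7)]
    have fH: "f_min (elts qs) \<in> carrier H" if "homog_list H qs" "length qs = 1" for qs
      using that H.homog_list_carrier[of qs] by (cases qs) auto
    have fh: "\<exists>x\<in>carrier A. f_min (elts qs) = h x" if "homog_list A qs" "2 \<le> length qs" for qs
      using f_min_p_min[OF that] p_min_closed[OF that(1)]
      by (intro bexI[of _ "\<ominus> (p_min qs)"]) (auto simp: h_minus)
    show "f_min (elts us) \<otimes> f_min (elts vs) \<in> carrier A" using gr grade_carrier by blast
    have "length us + length vs = length ps" using s(5) by simp
    then consider "2 \<le> length us" "2 \<le> length vs" | "length us = 1" "2 \<le> length vs" | "2 \<le> length us" "length vs = 1"
      using k s(6,7) by (cases us; cases vs) (auto simp: Suc_le_eq, (cases "tl us = []"; cases "tl vs = []"; auto)+)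
    then show "J (f_min (elts us) \<otimes> f_min (elts vs)) = \<zero>\<^bsub>K\<^esub>"
    proof cases
      case 1 then show ?thesis using fh hl J_h_h by metis
    next
      case 2 then show ?thesis using fh fH hl J_H_h by metis
    next
      case 3
      \<comment> \<open>Orthogonality is available with the value of \<open>h\<close> on the right;
        graded commutativity transfers it to the other order.\<close>
      then have "J (f_min (elts vs) \<otimes> f_min (elts us)) = \<zero>\<^bsub>K\<^esub>" using fh fH hl J_H_h by metis
      then show ?thesis by (rule J_comm[OF gr(2,1)])
    qed
  qed
  show ?thesis unfolding p_min_def
    by (rule J_finsum_zero) (use trm in \<open>auto simp: J_par\<close>)
qed

lemma m_min_linear:
  assumes "set us \<subseteq> carrier A" "set vs \<subseteq> carrier A"
  shows "linear_map K A A (\<lambda>x. m_min (us @ [x] @ vs))"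
  unfolding m_min_def by (rule multilin_decalage[OF multilin_\<mu> assms])

lemma m_min_vanish_homog:
  assumes ps: "homog_list H ps" and k: "3 \<le> length ps" and n: "n \<le> (length ps + 1) * (r - 1) + 2"
  shows "m_min (elts ps) = \<zero>"
proof (cases "\<forall>(e, x) \<in> set ps. int r \<le> e")
  case False
  then obtain e x where ex: "(e, x) \<in> set ps" "e < int r" by auto
  then obtain us vs where sp: "ps = us @ (e, x) # vs" using split_list by metis
  have c: "set (elts us) \<subseteq> carrier H" "set (elts vs) \<subseteq> carrier H" "x \<in> grade H e"
    using ps sp H.homog_list_carrier[of us] H.homog_list_carrier[of vs] by auto
  then have lin: "linear_map K A A (\<lambda>x. m_min (elts us @ [x] @ elts vs))"
    by (intro m_min_linear) auto
  show ?thesis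
  proof (cases "e = 0")
    case True
    then obtain c where c': "c \<in> carrier K" "x = c \<odot> \<one>" using H_grade_0 c(3) by blast
    have "m_min (elts us @ [\<one>] @ elts vs) = \<zero>"
      using c k sp by (intro m_min_unit) auto
    then show ?thesis using linear_mapD(3)[OF lin c'(1), of \<one>] c' sp by simp
  next
    case False
    then have "x = \<zero>" using H_grade_low c(3) ex(2) by blast
    moreover have "m_min (elts us @ [\<zero>] @ elts vs) = \<zero>"
      by (rule additive_map_zero_minus(1)[OF abelian_group_axioms abelian_group_axioms])
        (use linear_mapD[OF lin] in auto)
    ultimately show ?thesis using sp by simp
  qed
next
  case True
  let ?a = "m_min (elts ps)" and ?D = "tdeg ps + 2 - int (length ps)"
  have psA: "homog_list A ps" by (rule homog_list_H[OF ps])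
  have ne: "ps \<noteq> []" using k by auto
  have aD: "?a \<in> grade A ?D" by (rule m_min_grade[OF psA ne])
  have aH: "?a \<in> carrier H" by (rule m_min_H[OF homog_list_carrier[OF psA]])
  have "int (length ps) * int r \<le> tdeg ps"
    using True by (induction ps) (auto simp: algebra_simps)
  then have D: "int (length ps) * (int r - 1) + 2 \<le> ?D" by (simp add: algebra_simps)
  have "int n \<le> int ((length ps + 1) * (r - 1) + 2)" using n by (simp only: zle_int)
  also have "\<dots> = (int (length ps) + 1) * (int r - 1) + 2" using r2 by (simp only: of_nat_add of_nat_mult of_nat_diff of_nat_1 of_nat_numeral)
  finally have nD: "int n - ?D < int r" using D by (simp add: algebra_simps)
  show ?thesis
  proof (rule J_nondegenerate[OF aH])
    fix j b assume b: "b \<in> grade H j"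
    then have bA: "b \<in> grade A j" "b \<in> carrier A" by (auto simp: H_grade)
    have abD: "?a \<otimes> b \<in> grade A (?D + j)" by (rule mult_grade[OF aD bA(1)])
    show "J (?a \<otimes> b) = \<zero>\<^bsub>K\<^esub>"
    proof (cases "?D + j = int n")
      case False then show ?thesis using J_homog[OF abD] by simp
    next
      case True
      then have j: "j < int r" using nD by linarith
      show ?thesis
      proof (cases "j = 0")
        case True
        then obtain c where c: "c \<in> carrier K" "b = c \<odot> \<one>" using H_grade_0 b by blast
        \<comment> \<open>The integral does not see the projection, since it vanishes on exact
          elements and on the image of \<open>h\<close>.\<close>
        have "J ?a = J (p_min ps)" using m_min_p_min[OF psA ne] p_min_closed[OF psA] by (simp add: J_pr)
        then have "J ?a = \<zero>\<^bsub>K\<^esub>" using J_p_min[OF ps k] by simp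
        then show ?thesis using c aH by (simp add: smult_mult_right J_smult)
      next
        case False
        then have "b = \<zero>" using H_grade_low[OF b] j by simp
        then show ?thesis using aH by simp
      qed
    qed
  qed
qed

text \<open>Extends the homogeneous case by multilinearity: the arguments are replaced by
  homogeneous ones from the right, the labelled suffix \<open>ps\<close> growing while the prefix
  \<open>us\<close> shrinks.\<close>

lemma m_min_vanish:
  assumes "set xs \<subseteq> carrier H" "3 \<le> length xs" "n \<le> (length xs + 1) * (r - 1) + 2"
  shows "m_min xs = \<zero>"
proof -
  have "m_min (us @ elts ps) = \<zero>"
    if "set us \<subseteq> carrier H" "homog_list H ps" "length us + length ps = length xs" for us ps
    using that
  proof (induction us arbitrary: ps rule: rev_induct)
    case Nil then show ?case using m_min_vanish_homog[of ps] assms by simp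
  next
    case (snoc x us)
    have c: "set us \<subseteq> carrier A" "set (elts ps) \<subseteq> carrier A"
      using snoc.prems(1) homog_list_carrier[OF homog_list_H[OF snoc.prems(2)]] by auto
    note lin = m_min_linear[OF c]
    have "x \<in> carrier H" using snoc.prems by auto
    then have "m_min (us @ [x] @ elts ps) = \<zero>"
    proof (induction x rule: H.grade_induct)
      case (homog k x)
      then show ?case using snoc.IH[of "(k, x) # ps"] snoc.prems by simp
    next
      case (add x y)
      then show ?case using linear_mapD(2)[OF lin, of x y] by simp
    qed
    then show ?case by simp
  qed
  from this[of xs "[]"] show ?thesis using assms by simp
qed

end

section \<open>Formality\<close>

lemma (in graded_comm_alg) sub_dgca:
  assumes S: "submodule S K A" and comp: "\<And>x k. x \<in> S \<Longrightarrow> component A k x \<in> S"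
    and one: "\<one> \<in> S" and mult: "\<And>x y. x \<in> S \<Longrightarrow> y \<in> S \<Longrightarrow> x \<otimes> y \<in> S"
    and diff: "\<And>x. x \<in> S \<Longrightarrow> d x \<in> S"
  shows "dgca K (A\<lparr>carrier := S, grade := \<lambda>k. S \<inter> grade A k\<rparr>) d" (is "dgca K ?W d")
proof -
  have gvs: "graded_vector_space K ?W" by (rule graded_subspace[OF S comp])
  have ab: "abelian_group ?W" using gvs by (simp add: graded_vector_space_def module_def)
  have small_alg: "x \<in> carrier A" if "x \<in> S" for x using submoduleE(1)[OF S] that by blast
  have sub: "carrier ?W \<subseteq> carrier A" using small_alg by auto
  have par: "[par k] \<cdot>\<^bsub>?W\<^esub> x = [par k] \<cdot> x" if "x \<in> S" for x k
    by (rule sub_par_pow[OF ab abelian_group_axioms sub]) (use that in auto)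
  have ring: "ring ?W"
  proof (rule ringI[OF ab])
    show "monoid ?W" by (rule monoidI) (auto simp: one mult small_alg m_assoc)
  qed (auto simp: small_alg l_distr r_distr)
  show ?thesis
    by (intro dgca.intro dgca_axioms.intro gvs ring)
      (auto simp: small_alg par one mult diff one_grade mult_grade d_grade smult_mult_left smult_mult_right
        d_d linear_map_def d_add d_smult graded_comm[symmetric] leibniz)
qed

context dgca_bij
begin

lemma inv_map [simp]: "x \<in> carrier V \<Longrightarrow> inv_into (carrier V) \<phi> (\<phi> x) = x"
  using bij by (simp add: bij_betw_def)

text \<open>A quasi-isomorphism out of the copy \<open>W\<close> is obtained from one out of
  \<open>V\<close>, with all conditions stated in \<open>V\<close>. Both legs of the zig-zag start
  from such a copy.\<close>

lemma quasi_iso_from_W: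
  assumes B: "dgca K B e'" and f: "f \<in> ring_hom V B" and lin: "linear_map K V B f"
    and gr: "\<And>k. f ` grade V k \<subseteq> grade B k" and chain: "\<And>x. x \<in> carrier V \<Longrightarrow> f (d x) = e' (f x)"
    and inj: "\<And>x. x \<in> carrier V \<Longrightarrow> d x = \<zero> \<Longrightarrow> f x \<in> coboundaries B e' \<Longrightarrow> x \<in> coboundaries V d"
    and surj: "\<And>y. y \<in> carrier B \<Longrightarrow> e' y = \<zero>\<^bsub>B\<^esub> \<Longrightarrow>
      \<exists>x z. x \<in> carrier V \<and> d x = \<zero> \<and> z \<in> carrier B \<and> y = f x \<oplus>\<^bsub>B\<^esub> e' z"
  shows "dgca_quasi_iso K W e B e' (\<lambda>w. f (inv_into (carrier V) \<phi> w))"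
proof -
  have W: "dgca K W e" by (rule dgca_W)
  interpret W: graded_comm_alg W K e by (simp add: graded_comm_alg_def W)
  interpret B: graded_comm_alg B K e' by (simp add: graded_comm_alg_def B)
  let ?g = "\<lambda>w. f (inv_into (carrier V) \<phi> w)"
  note fl = linear_mapD[OF lin]
  have lin': "linear_map K W B ?g"
    by (auto simp: linear_map_def carrier_W map_add[symmetric] map_smult[symmetric] fl)
  have hom: "?g \<in> ring_hom W B"
    using f by (auto simp: ring_hom_def carrier_W map_add[symmetric] map_mult[symmetric] map_one[symmetric])
  have ch: "?g (e w) = e' (?g w)" if "w \<in> carrier W" for w
    using that by (auto simp: carrier_W map_d[symmetric] chain)
  have iso: "iso_on_cohomology W e B e' ?g"
  proof (rule iso_on_cohomologyI[OF W.cplx.cochain_complex_axioms B.cplx.cochain_complex_axioms])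
    show "?g \<in> carrier W \<rightarrow> carrier B" "\<And>x y. x \<in> carrier W \<Longrightarrow> y \<in> carrier W \<Longrightarrow> ?g (x \<oplus>\<^bsub>W\<^esub> y) = ?g x \<oplus>\<^bsub>B\<^esub> ?g y"
      using linear_mapD[OF lin'] by auto
    show "?g (e w) = e' (?g w)" if "w \<in> carrier W" for w by (rule ch[OF that])
    show "w \<in> coboundaries W e" if w: "w \<in> carrier W" "e w = \<zero>\<^bsub>W\<^esub>" "?g w \<in> coboundaries B e'" for w
    proof -
      obtain x where x: "x \<in> carrier V" "w = \<phi> x" using w by (auto simp: carrier_W)
      have "\<phi> (d x) = \<phi> \<zero>" using w x by (simp add: map_d map_zero)
      then have "d x = \<zero>" using map_inj[of "d x" \<zero>] x by simp
      then have "x \<in> coboundaries V d" using inj[of x] w x by simp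
      then obtain z where "z \<in> carrier V" "x = d z" by (auto simp: coboundaries_def)
      then show ?thesis using x by (auto simp: coboundaries_def carrier_W map_d)
    qed
    show "\<exists>x z. x \<in> carrier W \<and> e x = \<zero>\<^bsub>W\<^esub> \<and> z \<in> carrier B \<and> y = ?g x \<oplus>\<^bsub>B\<^esub> e' z"
      if y: "y \<in> carrier B" "e' y = \<zero>\<^bsub>B\<^esub>" for y
    proof -
      obtain x z where x: "x \<in> carrier V" "d x = \<zero>" "z \<in> carrier B" "y = f x \<oplus>\<^bsub>B\<^esub> e' z" using surj[OF y] by blast
      have "\<phi> x \<in> carrier W" using x by (simp add: carrier_W)
      moreover have "e (\<phi> x) = \<zero>\<^bsub>W\<^esub>" using x map_d[of x] by (simp add: map_zero)
      ultimately show ?thesis using x by (intro exI[of _ "\<phi> x"] exI[of _ z]) simp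
    qed
  qed
  have "?g ` grade W k \<subseteq> grade B k" for k
    using gr[of k] by (auto simp: map_grade grade_carrier)
  then show ?thesis
    unfolding dgca_quasi_iso_def using W B hom lin' ch iso by blast
qed

end

section \<open>The intermediate algebra and formality\<close>

context connected_hodge_poincare
begin

text \<open>Since only harmonic elements are kept below degree 2r - 1, exact elements of degree 2r -
  1 have lost their primitives and must go. The kernel of \<open>h\<close> achieves this: it
  contains no nonzero exact element, but it keeps the harmonic elements and the primitives
  \<open>h x\<close> of exact elements of degree 2r. The cohomology is thus that of
  \<open>A\<close>.\<close>

definition small :: "'a set" where
  "small = {x \<in> carrier A. (\<forall>k < 2 * int r - 1. component A k x \<in> carrier H) \<and> h (component A (2 * int r - 1) x) = \<zero>}"

definition small_alg :: "('k, 'a) graded_alg" where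
  "small_alg = A\<lparr>carrier := small, grade := \<lambda>k. small \<inter> grade A k\<rparr>"

lemma small_closed: "x \<in> small \<Longrightarrow> x \<in> carrier A"
  by (simp add: small_def)

lemma small_homog:
  assumes "x \<in> grade A k"
  shows "x \<in> small \<longleftrightarrow> (k < 2 * int r - 1 \<longrightarrow> x \<in> carrier H) \<and> (k = 2 * int r - 1 \<longrightarrow> h x = \<zero>)"
  using assms grade_carrier[OF assms] by (auto simp: small_def component_homog[OF assms])

lemma small_submodule: "submodule small K A"
  by (rule submoduleI)
    (auto simp: small_def component_add component_smult h_add h_smult minus_eq_smult K.a_inv_closed)

lemma small_component:
  assumes "x \<in> small" shows "component A k x \<in> small"
proof -
  have x: "x \<in> carrier A" using assms by (rule small_closed)
  show ?thesis unfolding small_homog[OF component_grade[OF x]] using assms by (auto simp: small_def)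
qed

lemma graded_space_small_alg: "graded_space small_alg K"
  unfolding small_alg_def graded_space_def by (rule graded_subspace[OF small_submodule small_component])

lemma small_induct [consumes 1, case_names homog add]:
  assumes "x \<in> small" and hom: "\<And>k x. x \<in> small \<Longrightarrow> x \<in> grade A k \<Longrightarrow> P x"
    and add: "\<And>x y. x \<in> small \<Longrightarrow> y \<in> small \<Longrightarrow> P x \<Longrightarrow> P y \<Longrightarrow> P (x \<oplus> y)"
  shows "P x"
  by (rule graded_space.grade_induct[OF graded_space_small_alg, of x P]) (use assms in \<open>auto simp: small_alg_def\<close>)

lemma small_add: "x \<in> small \<Longrightarrow> y \<in> small \<Longrightarrow> x \<oplus> y \<in> small"
  and small_smult: "c \<in> carrier K \<Longrightarrow> x \<in> small \<Longrightarrow> c \<odot> x \<in> small"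
  and small_minus: "x \<in> small \<Longrightarrow> \<ominus> x \<in> small"
  using submoduleE[OF small_submodule] by auto

lemma H_small: "x \<in> carrier H \<Longrightarrow> x \<in> small"
proof -
  assume x: "x \<in> carrier H"
  have "component A k x \<in> carrier H" for k
    using component_pr[of x k] x by (intro H_I) (simp_all only: H_closed H_pr component_closed)
  then show ?thesis using x by (auto simp: small_def)
qed

lemma small_low:
  assumes x: "x \<in> small" "x \<in> grade A k" and k: "k < int r"
  obtains "x = \<zero>" | c where "k = 0" "c \<in> carrier K" "x = c \<odot> \<one>"
proof -
  have "x \<in> carrier H" using small_homog[OF x(2)] x(1) k r2 by auto
  then have xH: "x \<in> grade H k" using x by (simp add: H_grade)
  show ?thesis
  proof (cases "k = 0")
    case True then show ?thesis using H_grade_0 xH that(2) by blast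
  next
    case False then show ?thesis using H_grade_low[OF xH False k] that(1) by blast
  qed
qed

text \<open>In degrees below r the only elements are multiples of the unit. Two factors of degree at
  least r have a product of degree at least 2r, where membership imposes no condition.\<close>

lemma small_mult: "x \<in> small \<Longrightarrow> y \<in> small \<Longrightarrow> x \<otimes> y \<in> small"
proof (induction x rule: small_induct)
  case (homog i x)
  note x = this(1,2)
  from homog(3) show ?case
  proof (induction y rule: small_induct)
    case (homog j y)
    note y = this
    have zero: "\<zero> \<in> small" using H_small by simp
    show ?case
    proof (cases "i < int r")
      case True
      from x True show ?thesis
      proof (rule small_low)
        assume "x = \<zero>" then show ?thesis using y zero by (simp add: small_closed)
      next
        fix c assume "c \<in> carrier K" "x = c \<odot> \<one>"
        then show ?thesis using y by (simp add: smult_mult_left small_closed small_smult)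
      qed
    next
      case iF: False
      show ?thesis
      proof (cases "j < int r")
        case True
        from y True show ?thesis
        proof (rule small_low)
          assume "y = \<zero>" then show ?thesis using x zero by (simp add: small_closed)
        next
          fix c assume "c \<in> carrier K" "y = c \<odot> \<one>"
          then show ?thesis using x by (simp add: smult_mult_right small_closed small_smult)
        qed
      next
        case False
        then show ?thesis using iF small_homog[OF mult_grade[OF x(2) y(2)]] by auto
      qed
    qed
  next
    case (add y z) then show ?case using x by (simp add: r_distr small_closed small_add)
  qed
next
  case (add x z) then show ?case by (simp add: l_distr small_closed small_add)
qed

lemma small_d: "x \<in> small \<Longrightarrow> d x \<in> small"
proof (induction x rule: small_induct)
  case (homog k x)
  have zero: "\<zero> \<in> small" using H_small by simp
  show ?case
  proof (cases "k < 2 * int r - 1")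
    case True
    then have "d x = \<zero>" using small_homog[OF homog(2)] homog(1) by auto
    then show ?thesis using zero by simp
  next
    case False then show ?thesis using small_homog[OF d_grade[OF homog(2)]] by auto
  qed
next
  case (add x y) then show ?case by (simp add: d_add small_closed small_add)
qed

text \<open>Up to degree 2r - 1 the map \<open>h\<close> is zero here. An element of degree at least
  2r is sent to degree at least 2r - 1, and there \<open>h h = 0\<close> is the required condition.
  This closure supplies primitives inside \<open>small\<close>.\<close>

lemma small_h: "x \<in> small \<Longrightarrow> h x \<in> small"
proof (induction x rule: small_induct)
  case (homog k x)
  have zero: "\<zero> \<in> small" using H_small by simp
  show ?case
  proof (cases "k \<le> 2 * int r - 1")
    case True
    then have "h x = \<zero>" using small_homog[OF homog(2)] homog(1) by (cases "k = 2 * int r - 1") auto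
    then show ?thesis using zero by simp
  next
    case False then show ?thesis using small_homog[OF h_grade[OF homog(2)]] homog by (auto simp: small_closed)
  qed
next
  case (add x y) then show ?case by (simp add: h_add small_closed small_add)
qed

lemma small_eps: "x \<in> small \<Longrightarrow> eps x \<in> small"
proof (induction x rule: small_induct)
  case (homog k x)
  then show ?case by (simp add: eps_homog[OF homog(2)] par_pow small_minus small_closed)
next
  case (add x y) then show ?case by (simp add: small_closed small_add)
qed

lemma dgca_small_alg: "dgca K small_alg d"
  unfolding small_alg_def
  by (rule sub_dgca[OF small_submodule small_component]) (use H_small small_mult small_d in auto)

text \<open>The non-harmonic part of x. The aim is that products with such parts project to zero,
  which makes \<open>pr\<close> multiplicative on \<open>small\<close>.\<close>

definition delta :: "'a \<Rightarrow> 'a" where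
  "delta x = d (h x) \<oplus> h (d x)"

lemma delta_eq: "x \<in> carrier A \<Longrightarrow> x = pr x \<oplus> delta x"
  unfolding delta_def by (rule pr_decomp)

lemma delta_small: "x \<in> small \<Longrightarrow> delta x \<in> small"
  by (simp add: delta_def small_d small_h small_add)

lemma delta_closed [simp]: "x \<in> carrier A \<Longrightarrow> delta x \<in> carrier A"
  by (simp add: delta_def)

lemma delta_grade: "x \<in> grade A k \<Longrightarrow> delta x \<in> grade A k"
  using d_grade[of "h x" "k - 1"] h_grade[of "d x" "k + 1"] h_grade[of x k] d_grade[of x k]
  by (auto simp: delta_def intro: grade_add)

lemma delta_add: "x \<in> carrier A \<Longrightarrow> y \<in> carrier A \<Longrightarrow> delta (x \<oplus> y) = delta x \<oplus> delta y"
  by (simp add: delta_def d_add h_add a_ac)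

context
  assumes n: "n \<le> 4 * r - 2"
begin

text \<open>A nonzero \<open>h x\<close> has degree at least \<open>2r - 1\<close>, hence only pairs with elements of degree at
  most \<open>2r - 1\<close>, on which \<open>h\<close> vanishes.\<close>

lemma J_h_small:
  assumes "x \<in> small" "y \<in> small" shows "J (h x \<otimes> y) = \<zero>\<^bsub>K\<^esub>"
  using assms(1)
proof (induction x rule: small_induct)
  case (homog i x)
  note x = this
  have xc: "x \<in> carrier A" using x small_closed by simp
  from assms(2) show ?case
  proof (induction y rule: small_induct)
    case (homog j y)
    note y = this
    have yc: "y \<in> carrier A" using y small_closed by simp
    show ?case
    proof (cases "i \<le> 2 * int r - 1")
      case True
      then have "h x = \<zero>" using small_homog[OF x(2)] x(1) by (cases "i = 2 * int r - 1") auto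
      then show ?thesis using yc by simp
    next
      case False
      note xy = mult_grade[OF h_grade[OF x(2)] y(2)]
      show ?thesis
      proof (cases "i - 1 + j = int n")
        case False then show ?thesis using J_homog[OF xy] by simp
      next
        case True
        then have "j \<le> 2 * int r - 1" using False n r2 by linarith
        then have "h y = \<zero>" using small_homog[OF y(2)] y(1) by (cases "j = 2 * int r - 1") auto
        \<comment> \<open>Once \<open>h y\<close> vanishes, y is a harmonic element plus a value of
          \<open>h\<close>, and both summands are orthogonal to the image of
          \<open>h\<close>.\<close>
        then have "y = pr y \<oplus> h (d y)" using pr_decomp[OF yc] yc by simp
        then have "J (h x \<otimes> y) = J (h x \<otimes> (pr y \<oplus> h (d y)))" by (rule arg_cong)
        also have "\<dots> = J (h x \<otimes> pr y) \<oplus>\<^bsub>K\<^esub> J (h x \<otimes> h (d y))" using xc yc by (simp add: r_distr J_add)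
        also have "J (h x \<otimes> h (d y)) = \<zero>\<^bsub>K\<^esub>" using xc yc by (simp add: J_h_h)
        also have "J (h x \<otimes> pr y) = \<zero>\<^bsub>K\<^esub>"
          by (rule J_comm[OF pr_grade[OF y(2)] h_grade[OF x(2)]]) (use xc yc J_H_h in simp)
        finally show ?thesis by simp
      qed
    qed
  next
    case (add y z) then show ?case using xc by (simp add: r_distr J_add small_closed)
  qed
next
  case (add x z) then show ?case using assms(2) by (simp add: h_add l_distr J_add small_closed)
qed

text \<open>The summand \<open>h (d x)\<close> is covered directly. For \<open>d (h x)\<close>,
  Stokes moves the differential to y and leaves a value of \<open>h\<close> paired with
  \<open>d y\<close>, both coming from \<open>small\<close>.\<close>

lemma J_delta_small:
  assumes "x \<in> small" "y \<in> small" shows "J (delta x \<otimes> y) = \<zero>\<^bsub>K\<^esub>"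
proof -
  have c: "x \<in> carrier A" "y \<in> carrier A" using assms small_closed by auto
  have "J (d (h x) \<otimes> y) = \<ominus>\<^bsub>K\<^esub> J (eps (h x) \<otimes> d y)" using c by (simp add: J_stokes)
  also have "eps (h x) = \<ominus> (h (eps x))" using c by (simp add: h_eps)
  also have "J (\<ominus> (h (eps x)) \<otimes> d y) = \<zero>\<^bsub>K\<^esub>"
    using c J_h_small[OF small_eps[OF assms(1)] small_d[OF assms(2)]] by (simp add: l_minus J_minus)
  finally have "J (d (h x) \<otimes> y) = \<zero>\<^bsub>K\<^esub>" by simp
  then show ?thesis using c J_h_small[OF small_d[OF assms(1)] assms(2)]
    by (simp add: delta_def l_distr J_add)
qed

text \<open>Let z be the product. Against a harmonic b, the element z integrates to zero because y
  times b is again in \<open>small\<close>, and \<open>delta z\<close> does so because z is in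
  \<open>small\<close>. Hence \<open>pr z\<close> is orthogonal to all harmonic elements, and
  Poincare duality applies.\<close>

lemma pr_delta_mult:
  assumes x: "x \<in> small" and y: "y \<in> small" shows "pr (delta x \<otimes> y) = \<zero>"
proof (rule J_nondegenerate)
  let ?z = "delta x \<otimes> y"
  have c: "x \<in> carrier A" "y \<in> carrier A" using assms small_closed by auto
  show "pr ?z \<in> carrier H" using c by simp
  fix k b assume "b \<in> grade H k"
  then have b: "b \<in> carrier H" "b \<in> small" "b \<in> carrier A" using H_small by (auto simp: H_grade)
  have zs: "?z \<in> small" using assms delta_small small_mult by simp
  have "?z \<otimes> b = pr ?z \<otimes> b \<oplus> delta ?z \<otimes> b"
    using delta_eq[of ?z] l_distr[of "pr ?z" "delta ?z" b] c b by simp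
  then have "J (?z \<otimes> b) = J (pr ?z \<otimes> b) \<oplus>\<^bsub>K\<^esub> J (delta ?z \<otimes> b)" using c b by (simp add: J_add)
  moreover have "J (delta ?z \<otimes> b) = \<zero>\<^bsub>K\<^esub>" by (rule J_delta_small[OF zs b(2)])
  moreover have "J (?z \<otimes> b) = \<zero>\<^bsub>K\<^esub>"
    using J_delta_small[OF x small_mult[OF y b(2)]] c b by (simp add: m_assoc)
  ultimately show "J (pr ?z \<otimes> b) = \<zero>\<^bsub>K\<^esub>" using c b by simp
qed

lemma pr_mult_delta:
  assumes "x \<in> small" "y \<in> small" shows "pr (x \<otimes> delta y) = \<zero>"
  using assms(1)
proof (induction x rule: small_induct)
  case (homog i x)
  note x = this
  from assms(2) show ?case
  proof (induction y rule: small_induct)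
    case (homog j y)
    have c: "x \<in> carrier A" "y \<in> carrier A" using x homog small_closed by auto
    have "x \<otimes> delta y = [par (j * i)] \<cdot> (delta y \<otimes> x)"
      by (rule graded_comm[OF delta_grade[OF homog(2)] x(2)])
    then show ?case using c pr_delta_mult[OF homog(1) x(1)] by (simp add: pr_par)
  next
    case (add y z) then show ?case using x by (simp add: delta_add r_distr pr_add small_closed)
  qed
next
  case (add x z) then show ?case using assms(2) by (simp add: l_distr pr_add small_closed)
qed

lemma pr_mult_small:
  assumes x: "x \<in> small" and y: "y \<in> small" shows "pr (x \<otimes> y) = pr (pr x \<otimes> pr y)"
proof -
  have c: "x \<in> carrier A" "y \<in> carrier A" using assms small_closed by auto
  have "x \<otimes> y = pr x \<otimes> y \<oplus> delta x \<otimes> y" using delta_eq[of x] l_distr[of "pr x" "delta x" y] c by simp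
  moreover have "pr x \<otimes> y = pr x \<otimes> pr y \<oplus> pr x \<otimes> delta y" using delta_eq[of y] r_distr[of "pr y" "delta y" "pr x"] c by simp
  ultimately have "pr (x \<otimes> y) = pr ((pr x \<otimes> pr y \<oplus> pr x \<otimes> delta y) \<oplus> delta x \<otimes> y)" by simp
  then show ?thesis
    using c pr_delta_mult[OF x y] pr_mult_delta[of "pr x" y] H_small[of "pr x"] y by (simp add: pr_add)
qed

lemma formal: "formal K A d"
proof -
  \<comment> \<open>An embedding of the elements of \<open>A\<close> into the type prescribed for
    intermediate carriers: x becomes the indicator function of the one-letter word x, which is
    injective because 0 and 1 differ in a field.\<close>
  define \<iota> where "\<iota> = (\<lambda>(x::'a) (l::'a list). if l = [x] then \<one>\<^bsub>K\<^esub> else \<zero>\<^bsub>K\<^esub>)"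
  define \<rho> where "\<rho> = inv_into small \<iota>"
  define W :: "('k, 'a list \<Rightarrow> 'k) graded_alg" where
    "W = \<lparr>carrier = \<iota> ` small, monoid.mult = (\<lambda>f g. \<iota> (\<rho> f \<otimes> \<rho> g)), one = \<iota> \<one>, zero = \<iota> \<zero>,
       add = (\<lambda>f g. \<iota> (\<rho> f \<oplus> \<rho> g)), smult = (\<lambda>c f. \<iota> (c \<odot> \<rho> f)), grade = (\<lambda>k. \<iota> ` (small \<inter> grade A k))\<rparr>"
  define e where "e = (\<lambda>f. \<iota> (d (\<rho> f)))"
  have inj: "inj_on \<iota> S" for S
  proof (rule inj_onI)
    fix x y assume "\<iota> x = \<iota> y"
    then have "\<iota> x [x] = \<iota> y [x]" by simp
    then show "x = y" by (auto simp: \<iota>_def split: if_splits)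
  qed
  have \<rho>: "\<rho> (\<iota> x) = x" if "x \<in> small" for x using that inj by (simp add: \<rho>_def)
  have cSA: "carrier small_alg = small" "add small_alg = add A" "smult small_alg = smult A" "zero small_alg = \<zero>" "one small_alg = \<one>"
    "monoid.mult small_alg = monoid.mult A" "grade small_alg k = small \<inter> grade A k" for k by (simp_all add: small_alg_def)
  have bij: "dgca_bij small_alg K d W \<iota> e"
    by (intro dgca_bij.intro graded_comm_alg.intro dgca_small_alg graded_bij.intro graded_space_small_alg
        graded_bij_axioms.intro dgca_bij_axioms.intro)
      (auto simp: cSA W_def e_def \<rho> bij_betw_def inj)
  have coh_bij: "inj_on (coh_class A d) (carrier H)"
    using graded_bij.bij[OF dgca_bij.axioms(2)[OF dgca_bij_coh]] by (simp add: bij_betw_def)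
  have step1: "\<exists>f. dgca_quasi_iso K W e A d f"
  proof (rule exI, rule dgca_bij.quasi_iso_from_W[OF bij, where f = "\<lambda>x. x"])
    show "dgca K A d" by (rule dgca_axioms)
    show "x \<in> coboundaries small_alg d" if "x \<in> carrier small_alg" "d x = \<zero>\<^bsub>small_alg\<^esub>" "x \<in> coboundaries A d" for x
    proof -
      have x: "x \<in> small" "x \<in> carrier A" "d x = \<zero>" "x \<in> coboundaries A d" using that small_closed by (auto simp: cSA)
      obtain z where "z \<in> carrier A" "x = d z" using x(4) by (auto simp: coboundaries_def)
      \<comment> \<open>The given primitive z may lie outside \<open>small\<close>;
        \<open>h x\<close> is another primitive, and it stays inside.\<close>
      then have "x = d (h x)" by simp
      then show ?thesis using small_h[OF x(1)] by (auto simp: coboundaries_def cSA)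
    qed
    show "\<exists>x z. x \<in> carrier small_alg \<and> d x = \<zero>\<^bsub>small_alg\<^esub> \<and> z \<in> carrier A \<and> y = x \<oplus> d z" if "y \<in> carrier A" "d y = \<zero>" for y
      using that pr_closed_eq[OF that] H_small[of "pr y"]
      by (intro exI[of _ "pr y"] exI[of _ "h y"]) (auto simp: cSA)
  qed (auto simp: ring_hom_def linear_map_def cSA small_closed)
  have step2: "\<exists>f. dgca_quasi_iso K W e coh (\<lambda>X. zero coh) f"
  proof (rule exI, rule dgca_bij.quasi_iso_from_W[OF bij, where f = "\<lambda>x. coh_class A d (pr x)"])
    show "dgca K coh (\<lambda>X. zero coh)" by (rule dgca_coh)
    have cc: "coh_class A d (pr x) \<in> carrier coh" if "x \<in> small" for x
      using that small_closed by (auto simp: carrier_cohomology cocycles_def)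
    show "(\<lambda>x. coh_class A d (pr x)) \<in> ring_hom small_alg coh"
      using cc by (auto simp: ring_hom_def cSA small_closed coh_add pr_add coh_mult coh_one pr_mult_small coh_class_pr d_mult_closed)
    show "linear_map K small_alg coh (\<lambda>x. coh_class A d (pr x))"
      using cc by (auto simp: linear_map_def cSA small_closed coh_add pr_add coh_smult pr_smult)
    show "(\<lambda>x. coh_class A d (pr x)) ` grade small_alg k \<subseteq> grade coh k" for k
      by (auto simp: cSA coh_grade cocycles_def pr_grade small_closed)
    show "coh_class A d (pr (d x)) = zero coh" if "x \<in> carrier small_alg" for x
      using that by (simp add: cSA small_closed coh_zero)
    show "x \<in> coboundaries small_alg d"
      if "x \<in> carrier small_alg" "d x = \<zero>\<^bsub>small_alg\<^esub>" "coh_class A d (pr x) \<in> coboundaries coh (\<lambda>X. zero coh)" for x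
    proof -
      have x: "x \<in> small" "x \<in> carrier A" "d x = \<zero>" using that small_closed by (auto simp: cSA)
      \<comment> \<open>With zero differential on the cohomology, its only coboundary is
        zero.\<close>
      have "coh_class A d (pr x) = coh_class A d \<zero>" using that by (auto simp: coboundaries_def coh_zero)
      then have "pr x = \<zero>" using inj_onD[OF coh_bij, of "pr x" \<zero>] x by simp
      then have "x = d (h x)" using pr_closed_eq[OF x(2,3)] x(2) by simp
      then show ?thesis using small_h[OF x(1)] by (auto simp: coboundaries_def cSA)
    qed
    show "\<exists>x z. x \<in> carrier small_alg \<and> d x = \<zero>\<^bsub>small_alg\<^esub> \<and> z \<in> carrier coh \<and> Y = coh_class A d (pr x) \<oplus>\<^bsub>coh\<^esub> zero coh"
      if Y: "Y \<in> carrier coh" for Y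
    proof -
      obtain b where b: "b \<in> carrier A" "d b = \<zero>" "Y = coh_class A d b" using Y by (auto simp: carrier_cohomology cocycles_def)
      have "coh_class A d (pr b) \<oplus>\<^bsub>coh\<^esub> zero coh = coh_class A d (pr b)" using b by (simp add: coh_zero coh_add)
      also have "\<dots> = Y" using b by (simp add: coh_class_pr)
      finally have "Y = coh_class A d (pr (pr b)) \<oplus>\<^bsub>coh\<^esub> zero coh" using b by simp
      then show ?thesis using b H_small[of "pr b"] Y by (intro exI[of _ "pr b"] exI[of _ Y]) (auto simp: cSA)
    qed
  qed
  show ?thesis
    unfolding formal_def
  \<comment> \<open>There is a single intermediate algebra, so the chain in the middle has length
    zero.\<close>
  proof (intro exI conjI)
    show "dgca_zigzag_step K (A, d) (W, e)" using step1 by (simp add: dgca_zigzag_step_def)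
    show "(dgca_zigzag_step K)\<^sup>*\<^sup>* (W, e) (W, e)" by (rule rtranclp.rtrancl_refl)
    show "dgca_zigzag_step K (W, e) (coh, \<lambda>_. zero coh)" using step2 by (simp add: dgca_zigzag_step_def)
  qed
qed

end

end

lemma hodge_poincareI:
  assumes p: "poincare_dgca K A d n I" and h: "hodge_homotopy K A d n I h"
  shows "hodge_poincare A K d h n I"
proof -
  interpret poincare_dgca K A d n I by fact
  have g: "h x \<in> grade A (k - 1)" if "x \<in> grade A k" for x k
    using h that by (auto simp: hodge_homotopy_def)
  \<comment> \<open>The homotopy sends the unit to degree -1, which is zero in a Poincare
    DGCA.\<close>
  have "h \<one>\<^bsub>A\<^esub> \<in> grade A (- 1)" using g[OF one_grade] by simp
  moreover have "grade A (- 1) = {\<zero>\<^bsub>A\<^esub>}" by (rule grade_bounds) simp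
  ultimately have one: "h \<one>\<^bsub>A\<^esub> = \<zero>\<^bsub>A\<^esub>" by simp
  show ?thesis
    by (intro hodge_poincare.intro hodge_poincare_axioms.intro contraction.intro contraction_axioms.intro
        graded_comm_alg.intro p dgca_axioms)
      (use h g one in \<open>auto simp: hodge_homotopy_def\<close>)
qed

theorem theorem2p12:
  fixes K :: "'k ring" and A :: "('k, 'a) graded_alg" and d h :: "'a \<Rightarrow> 'a"
    and I :: "'a set \<Rightarrow> 'k" and n r l :: nat
  assumes "field K"
    and "\<And>j :: nat. 0 < j \<Longrightarrow> [j] \<cdot>\<^bsub>K\<^esub> \<one>\<^bsub>K\<^esub> \<noteq> \<zero>\<^bsub>K\<^esub>"
    and "2 \<le> r"
    and "poincare_dgca K A d n I"
    and "connected_dgca K A d r"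
    and "hodge_homotopy K A d n I h"
    and "4 \<le> l"
    and "n \<le> l * (r - 1) + 2"
  shows "(\<exists>m. minimal_unital_cinf_algebra K (harmonic_space A d h) m \<and>
            cinf_quasi_isomorphic K (harmonic_space A d h) m A (dgca_ops A d) \<and>
            (\<forall>x \<in> carrier (harmonic_space A d h). \<forall>y \<in> carrier (harmonic_space A d h).
               m [x, y] = harmonic_proj A d h (x \<otimes>\<^bsub>A\<^esub> y)) \<and>
            (\<forall>xs \<in> lists (carrier (harmonic_space A d h)).
               l - 1 \<le> length xs \<longrightarrow> m xs = \<zero>\<^bsub>A\<^esub>) \<and>
            (n \<le> 6 * r - 4 \<longrightarrow>
               (\<forall>xs \<in> lists (carrier (harmonic_space A d h)). 5 \<le> length xs \<longrightarrow> m xs = \<zero>\<^bsub>A\<^esub>)) \<and>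
            (n \<le> 5 * r - 3 \<longrightarrow>
               (\<forall>xs \<in> lists (carrier (harmonic_space A d h)). 4 \<le> length xs \<longrightarrow> m xs = \<zero>\<^bsub>A\<^esub>)) \<and>
            (n \<le> 4 * r - 2 \<longrightarrow>
               (\<forall>xs \<in> lists (carrier (harmonic_space A d h)). 3 \<le> length xs \<longrightarrow> m xs = \<zero>\<^bsub>A\<^esub>))) \<and>
         (n \<le> 4 * r - 2 \<longrightarrow> formal K A d)"
proof -
  interpret connected_hodge_poincare A K d h n I r
    using hodge_poincareI[OF assms(4,6)] assms(3,5)
    by (simp add: connected_hodge_poincare_def connected_hodge_poincare_axioms_def)
  \<comment> \<open>The bound in \<open>m_min_vanish\<close> grows with the arity, so a bound on n
    in terms of q serves all arities from q on.\<close>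
  have van: "m_min xs = \<zero>\<^bsub>A\<^esub>"
    if "xs \<in> lists (carrier H)" "q \<le> length xs" "3 \<le> q" "n \<le> (q + 1) * (r - 1) + 2" for xs q
  proof (rule m_min_vanish)
    have "(q + 1) * (r - 1) \<le> (length xs + 1) * (r - 1)" using that(2) by (intro mult_right_mono) auto
    then show "n \<le> (length xs + 1) * (r - 1) + 2" using that(4) by linarith
  qed (use that in \<open>auto simp: in_lists_conv_set\<close>)
  have "(l - 1 + 1) * (r - 1) + 2 = l * (r - 1) + 2" using assms(7) by simp
  then have "m_min xs = \<zero>\<^bsub>A\<^esub>" if "xs \<in> lists (carrier H)" "l - 1 \<le> length xs" for xs
    using van[OF that] assms(7,8) by simp
  \<comment> \<open>The special bounds are the general one at arities 5, 4 and 3: 6r - 4 = 6(r - 1)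
    + 2, 5r - 3 = 5(r - 1) + 2 and 4r - 2 = 4(r - 1) + 2.\<close>
  moreover have "m_min xs = \<zero>\<^bsub>A\<^esub>" if "n \<le> 6 * r - 4" "xs \<in> lists (carrier H)" "5 \<le> length xs" for xs
    using van[OF that(2,3)] that(1) assms(3) by simp
  moreover have "m_min xs = \<zero>\<^bsub>A\<^esub>" if "n \<le> 5 * r - 3" "xs \<in> lists (carrier H)" "4 \<le> length xs" for xs
    using van[OF that(2,3)] that(1) assms(3) by simp
  moreover have "m_min xs = \<zero>\<^bsub>A\<^esub>" if "n \<le> 4 * r - 2" "xs \<in> lists (carrier H)" "3 \<le> length xs" for xs
    using van[OF that(2,3)] that(1) assms(3) by simp
  ultimately show ?thesis
    using minimal_unital_cinf_algebra_H cinf_quasi_isomorphic_H m_min_pair formal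
    by (intro conjI exI[of _ m_min] impI ballI) auto
qed

end
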